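(* Let $A\in\mathbb{Z}^{m\times n}$ with $\operatorname{rank}A=m$, let $\mathbf{b}\in\mathbb{Z}^m$, and let $\boldsymbol\ell,\mathbf{u}\in(\mathbb{Z}\cup\{\pm\infty\})^n$ with $\boldsymbol\ell<\mathbf{u}$. Define $$\operatorname{IP}:=\{\mathbf{x}\in\mathbb{Z}^n : A\mathbf{x}=\mathbf{b},\ \boldsymbol\ell\le\mathbf{x}\le\mathbf{u}\},\qquad \operatorname{LP}:=\{\mathbf{x}\in\mathbb{R}^n : A\mathbf{x}=\mathbf{b},\ \boldsymbol\ell\le\mathbf{x}\le\mathbf{u}\},$$ and assume $\operatorname{IP}\neq\emptyset$. Let $$\pi:=\max_{\mathbf{x}^*\text{ a vertex of }\operatorname{LP}}\ \min_{\mathbf{z}^*\in\operatorname{IP}}\|\mathbf{x}^*-\mathbf{z}^*\|_1,$$ and set $\Delta:=\Delta(A)$. Then $$\pi\le(m+1)\Delta\,(2\mathfrak{c}(\Delta,m)+1)\le m(m+1)^2\Delta^3+(m+1)\Delta.$$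
   Context: A matrix is treated as the multiset of its columns. Two vectors $\mathbf{a},\overline{\mathbf{a}}\in\mathbb{R}^d$ differ if $\mathbf{a}\neq\pm\overline{\mathbf{a}}$. A multiset $X\subseteq\mathbb{R}^d$ has differing columns if every pair of vectors in $X$ differs and $\mathbf{0}\notin X$. The number of differing columns of a matrix $A$, i.e. the largest cardinality of a subset of the columns of $A$ that has differing columns, is denoted $|A|$. For an integer matrix $A$ with $m$ rows and $\operatorname{rank} A=m$, let $\Delta(A):=\max\{|\det B| : B \text{ is an } m\times m \text{ submatrix of } A\}$. For integers $\Delta,m\ge 1$, $$\mathfrak{c}(\Delta,m):=\max\{|A| : A \text{ is an integer matrix with } m \text{ rows},\ \operatorname{rank}A=m,\ \Delta(A)\le\Delta\}.$$ The constraint matrix $A$ in the claim itself is not required to have differing columns. *)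

theory Defs
  imports
    "HOL-Library.Extended_Real"
    "HOL-Library.Multiset"
    "Jordan_Normal_Form.DL_Rank"
    "Jordan_Normal_Form.DL_Submatrix"
begin

abbreviation real_vec :: "int vec \<Rightarrow> real vec" where
  "real_vec \<equiv> map_vec real_of_int"

abbreviation real_mat :: "int mat \<Rightarrow> real mat" where
  "real_mat \<equiv> map_mat real_of_int"

definition full_row_rank :: "int mat \<Rightarrow> bool" where
  "full_row_rank A \<longleftrightarrow> vec_space.rank (dim_row A) (real_mat A) = dim_row A"

definition differ :: "'a::ab_group_add vec \<Rightarrow> 'a vec \<Rightarrow> bool" where
  "differ a a' \<longleftrightarrow> a \<noteq> a' \<and> a \<noteq> - a'"

text \<open>A pair is a two-element submultiset, so a repeated vector violates the condition,
  whereas a vector occurring once is not compared with itself.\<close>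

definition differing_columns :: "nat \<Rightarrow> 'a::ab_group_add vec multiset \<Rightarrow> bool" where
  "differing_columns d X \<longleftrightarrow>
    (\<forall>a a'. {#a, a'#} \<subseteq># X \<longrightarrow> differ a a') \<and> 0\<^sub>v d \<notin># X"

definition num_differing :: "'a::ab_group_add mat \<Rightarrow> nat" where
  "num_differing A =
    Max {size X | X. X \<subseteq># mset (cols A) \<and> differing_columns (dim_row A) X}"

text \<open>Only meaningful if \<open>A\<close> has at least as many columns as rows, which full row rank
  guarantees.\<close>

definition max_subdet :: "int mat \<Rightarrow> int" where
  "max_subdet A = Max {\<bar>det (submatrix A I J)\<bar> | I J.
    I \<subseteq> {..<dim_row A} \<and> J \<subseteq> {..<dim_col A} \<and> card I = dim_row A \<and> card J = dim_row A}"

definition col_number :: "int \<Rightarrow> nat \<Rightarrow> nat" where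
  "col_number \<Delta> m = Max {num_differing A | A n.
    A \<in> carrier_mat m n \<and> full_row_rank A \<and> max_subdet A \<le> \<Delta>}"

definition extended_ints :: "ereal set" where
  "extended_ints = {ereal (real_of_int k) | k. True} \<union> {\<infinity>, -\<infinity>}"

text \<open>The order \<open>\<le>\<close> on vectors is componentwise and includes equality of dimensions.\<close>

definition LP :: "int mat \<Rightarrow> int vec \<Rightarrow> ereal vec \<Rightarrow> ereal vec \<Rightarrow> real vec set" where
  "LP A b l u = {x \<in> carrier_vec (dim_col A).
    real_mat A *\<^sub>v x = real_vec b \<and> l \<le> map_vec ereal x \<and> map_vec ereal x \<le> u}"

definition IP :: "int mat \<Rightarrow> int vec \<Rightarrow> ereal vec \<Rightarrow> ereal vec \<Rightarrow> int vec set" where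
  "IP A b l u = {z \<in> carrier_vec (dim_col A).
    A *\<^sub>v z = b \<and> l \<le> map_vec ereal (real_vec z) \<and> map_vec ereal (real_vec z) \<le> u}"

text \<open>Extreme points as in \<open>extreme_point_of\<close>, which is not applicable here because
  \<open>real vec\<close> is not a real vector space in the type class sense. For polyhedra these are
  the vertices.\<close>

definition vertices :: "real vec set \<Rightarrow> real vec set" where
  "vertices P = {x \<in> P. \<not> (\<exists>a\<in>P. \<exists>c\<in>P. \<exists>t. a \<noteq> c \<and> 0 < t \<and> t < 1 \<and>
    x = (1 - t) \<cdot>\<^sub>v a + t \<cdot>\<^sub>v c)}"

definition l1_norm :: "real vec \<Rightarrow> real" where
  "l1_norm v = (\<Sum>i<dim_vec v. \<bar>v $ i\<bar>)"

text \<open>A polyhedron has finitely many vertices and every \<open>l1\<close>-ball contains finitely many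
  integer points, so for nonempty \<open>IP\<close> the infimum is a minimum and, as soon as \<open>LP\<close> has a
  vertex, the supremum is a maximum. If \<open>LP\<close> has no vertex, the value is \<open>-\<infinity>\<close>.\<close>

definition proximity :: "int mat \<Rightarrow> int vec \<Rightarrow> ereal vec \<Rightarrow> ereal vec \<Rightarrow> ereal" where
  "proximity A b l u = (SUP x \<in> vertices (LP A b l u). INF z \<in> IP A b l u.
    ereal (l1_norm (x - real_vec z)))"

end

theory Submission
  imports Defs "HOL-Computational_Algebra.Primes"
begin

text \<open>Columns of \<open>A\<close> are treated as functions on row indices, and \<open>\<Delta>\<close> is the largest
absolute value of a determinant of \<open>m\<close> of them. The two inequalities have separate reasons.

\<^bold>\<open>Distance.\<close> Let \<open>x\<close> be a vertex of the polyhedron, \<open>z\<close> a feasible integer point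
closest to it, and \<open>y = z - x\<close>, so \<open>A y = 0\<close>. At a vertex at most one of several equal columns carries a
fractional entry (\<open>vertex_equal_columns\<close>), and since \<open>z\<close> is closest, the entries of \<open>y\<close> at
equal columns never have opposite signs: otherwise one unit could be moved from one to the other. So \<open>y\<close> keeps its
\<open>l1\<close> norm when entries at equal columns are added up, which leaves one weight for each of at most \<open>2 c +
1\<close> distinct columns. A relation of minimal support whose signs agree with those of \<open>y\<close> is, by Cramer's rule, a
multiple of one with at most \<open>m + 1\<close> nonzero entries that are subdeterminants (\<open>elementary_relation\<close>).
Subtracting multiples of such relations from a relation of norm more than \<open>(2 c + 1) (m + 1) \<Delta>\<close> must, at some
step, use a whole one (\<open>conformal_integral_relation\<close>). Distributed over the equal columns this is an integral step
that leads from \<open>z\<close> to a feasible integer point closer to \<open>x\<close> (\<open>proximity_core\<close>).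

\<^bold>\<open>Column number.\<close> The second inequality amounts to \<open>2 c \<le> \<Delta>\<^sup>2 m (m + 1)\<close>. Let
\<open>S\<close> be differing columns and \<open>B\<close> a basis of columns with determinant \<open>\<plusminus>D\<close> of
maximal size. In coordinates with respect to \<open>B\<close>, all minors of the \<open>2 |S| + 1\<close> vectors \<open>0,
\<plusminus>a\<close> have absolute value at most 1. The vectors fall into at most \<open>D\<close> classes according to the
fractional parts of their coordinates (\<open>index_le_Det\<close>); the class of the integral ones has at most \<open>1 + m (m +
1)\<close> elements (\<open>trivial_coset_card\<close>), every other class at most \<open>(D + 1) m (m + 1)\<close>
(\<open>coset_card\<close>), and \<open>(D - 1) (D + 1) + 1 = D\<^sup>2\<close>.

A class is counted by deleting its rows one by one. Deleting a row \<open>x\<close> loses at most the number of vectors that occur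
with two different entries in row \<open>x\<close>, counted for every pair of entries. For a fixed pair these form a family that
is doubled in direction \<open>x\<close>, and its own rows are deleted in the same way, so that the loss is now measured by
families \<open>W\<close> doubled in two directions. For those the key estimate \<open>twice_doubled_card\<close> applies:
\<open>W\<close> is the vertex set of a simplex in which every barycentric coordinate of the origin is at least some
\<open>\<epsilon>\<close>, whence \<open>|W| \<le> 1 / \<epsilon>\<close>. This gives nothing only if the fractional parts in both
directions are one half. The half-integral rows of a family doubled in a half-integral direction are therefore treated together:
the vectors that are not basis vectors up to sign are signed sums of three basis vectors, and the supports of these sums obey the
oddtown rules (\<open>half_rows.card_le\<close>).\<close>

section \<open>Determinants as functions of their columns\<close>

text \<open>The columns are indexed by a function, so exchanging a column is a function update.\<close>

definition Det :: "nat \<Rightarrow> (nat \<Rightarrow> nat \<Rightarrow> 'a::comm_ring_1) \<Rightarrow> 'a" where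
  "Det m f = det (mat m m (\<lambda>(i, j). f j i))"

definition unit :: "nat \<Rightarrow> nat \<Rightarrow> 'a::comm_ring_1" where
  "unit j i = (if i = j then 1 else 0)"

lemma Det_cong: "(\<And>i j. i < m \<Longrightarrow> j < m \<Longrightarrow> f j i = g j i) \<Longrightarrow> Det m f = Det m g"
  unfolding Det_def by (rule arg_cong[where f = det]) (auto intro!: eq_matI)

lemma Det_unit: "Det m unit = 1"
proof -
  have "mat m m (\<lambda>(i, j). unit j i) = (1\<^sub>m m :: 'a mat)"
    by (auto intro!: eq_matI simp: unit_def)
  then show ?thesis by (simp add: Det_def)
qed

lemma cofactor_eq_Det:
  assumes "y < m" "k < m"
  shows "cofactor (mat m m (\<lambda>(i, j). f j i)) y k = Det m (f(k := unit y))"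
proof -
  let ?A = "mat m m (\<lambda>(i, j). (f(k := unit y)) j i)"
  have "Det m (f(k := unit y)) = (\<Sum>i<m. ?A $$ (i, k) * cofactor ?A i k)"
    unfolding Det_def by (rule laplace_expansion_column) (use assms in auto)
  also have "\<dots> = (\<Sum>i<m. if i = y then cofactor ?A i k else 0)"
    by (rule sum.cong) (use assms in \<open>auto simp: unit_def\<close>)
  also have "\<dots> = cofactor ?A y k" using assms by simp
  also have "\<dots> = cofactor (mat m m (\<lambda>(i, j). f j i)) y k"
    unfolding cofactor_def
    by (rule arg_cong[where f = "\<lambda>M. _ * det M"])
       (use assms in \<open>auto simp: mat_delete_def intro!: eq_matI\<close>)
  finally show ?thesis by simp
qed

lemma Det_column_expansion:
  assumes "k < m"
  shows "Det m (f(k := a)) = (\<Sum>i<m. a i * Det m (f(k := unit i)))"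
proof -
  let ?A = "mat m m (\<lambda>(i, j). (f(k := a)) j i)"
  have "Det m (f(k := a)) = (\<Sum>i<m. ?A $$ (i, k) * cofactor ?A i k)"
    unfolding Det_def by (rule laplace_expansion_column) (use assms in auto)
  also have "\<dots> = (\<Sum>i<m. a i * Det m (f(k := unit i)))"
  proof (rule sum.cong[OF refl])
    fix i assume "i \<in> {..<m}"
    then show "?A $$ (i, k) * cofactor ?A i k = a i * Det m (f(k := unit i))"
      using cofactor_eq_Det[of i m k "f(k := a)"] assms by simp
  qed
  finally show ?thesis .
qed

lemma Det_row_expansion:
  assumes "y < m"
  shows "Det m f = (\<Sum>j<m. f j y * Det m (f(j := unit y)))"
proof -
  let ?A = "mat m m (\<lambda>(i, j). f j i)"
  have "Det m f = (\<Sum>j<m. ?A $$ (y, j) * cofactor ?A y j)"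
    unfolding Det_def by (rule laplace_expansion_row) (use assms in auto)
  also have "\<dots> = (\<Sum>j<m. f j y * Det m (f(j := unit y)))"
    by (rule sum.cong) (use assms in \<open>auto simp: cofactor_eq_Det\<close>)
  finally show ?thesis .
qed

lemma Det_sum:
  assumes "k < m" and "\<And>i. i < m \<Longrightarrow> a i = (\<Sum>l\<in>K. c l * g l i)"
  shows "Det m (f(k := a)) = (\<Sum>l\<in>K. c l * Det m (f(k := g l)))"
proof -
  have "Det m (f(k := a)) = (\<Sum>i<m. \<Sum>l\<in>K. c l * (g l i * Det m (f(k := unit i))))"
    unfolding Det_column_expansion[OF assms(1), of f a]
    by (rule sum.cong) (auto simp: assms(2) sum_distrib_right mult.assoc)
  also have "\<dots> = (\<Sum>l\<in>K. c l * (\<Sum>i<m. g l i * Det m (f(k := unit i))))"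
    by (subst sum.swap) (simp add: sum_distrib_left)
  also have "\<dots> = (\<Sum>l\<in>K. c l * Det m (f(k := g l)))"
    by (simp add: Det_column_expansion[OF assms(1), of f "g _"])
  finally show ?thesis .
qed

lemma Det_add:
  assumes "k < m" and "\<And>i. i < m \<Longrightarrow> a i = c * g i + d * h i"
  shows "Det m (f(k := a)) = c * Det m (f(k := g)) + d * Det m (f(k := h))"
  using Det_sum[where K = "{True, False}" and a = a and c = "\<lambda>l. if l then c else d" and g = "\<lambda>l. if l then g else h" and k = k and m = m and f = f] assms
  by simp

lemma Det_equal_columns:
  assumes "j < m" "k < m" "j \<noteq> k" "\<And>i. i < m \<Longrightarrow> f j i = f k i"
  shows "Det m f = 0"
  unfolding Det_def
  by (rule det_identical_columns[of _ m j k]) (use assms in \<open>auto simp: col_def\<close>)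

lemma Det_swap:
  assumes "j < m" "k < m" "j \<noteq> k"
  shows "Det m (f(j := a, k := b)) = - Det m (f(j := b, k := a))"
proof -
  let ?s = "\<lambda>i. a i + b i"
  have 1: "Det m (f(j := ?s, k := c)) = Det m (f(j := a, k := c)) + Det m (f(j := b, k := c))" for c
    using Det_add[of j m ?s 1 a 1 b "f(k := c)"] assms by (simp add: fun_upd_twist)
  have 2: "Det m (f(j := c, k := ?s)) = Det m (f(j := c, k := a)) + Det m (f(j := c, k := b))" for c
    using Det_add[of k m ?s 1 a 1 b "f(j := c)"] assms by simp
  have 3: "Det m (f(j := c, k := c)) = 0" for c
    by (rule Det_equal_columns[of j m k]) (use assms in auto)
  have "0 = Det m (f(j := ?s, k := ?s))" by (simp add: 3)
  also have "\<dots> = Det m (f(j := a, k := b)) + Det m (f(j := b, k := a))"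
    unfolding 1 2 by (simp add: 3)
  finally show ?thesis by (simp add: eq_neg_iff_add_eq_0)
qed

text \<open>Cramer's rule, with both sides multiplied by the determinant so that singular matrices are included.\<close>

lemma Det_cramer:
  assumes "i < m"
  shows "Det m f * a i = (\<Sum>j<m. Det m (f(j := a)) * f j i)"
proof -
  let ?A = "mat m m (\<lambda>(i, j). f j i)"
  have A: "?A \<in> carrier_mat m m" by simp
  have ad: "(adj_mat ?A) $$ (j, k) = Det m (f(j := unit k))" if "j < m" "k < m" for j k
    using that by (simp add: adj_mat_def cofactor_eq_Det)
  have "(\<Sum>j<m. Det m (f(j := a)) * f j i) = (\<Sum>j<m. \<Sum>k<m. a k * (f j i * Det m (f(j := unit k))))"
    by (rule sum.cong) (auto simp: Det_column_expansion[of _ m f a] sum_distrib_right intro!: sum.cong)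
  also have "\<dots> = (\<Sum>k<m. a k * (\<Sum>j<m. f j i * Det m (f(j := unit k))))"
    by (subst sum.swap) (simp add: sum_distrib_left)
  also have "\<dots> = (\<Sum>k<m. a k * ((?A * adj_mat ?A) $$ (i, k)))"
  proof (rule sum.cong[OF refl])
    fix k assume "k \<in> {..<m}"
    then have "(?A * adj_mat ?A) $$ (i, k) = (\<Sum>j\<in>{0..<m}. f j i * Det m (f(j := unit k)))"
      using assms adj_mat(1)[OF A] by (simp add: scalar_prod_def ad)
    then show "a k * (\<Sum>j<m. f j i * Det m (f(j := unit k))) = a k * ((?A * adj_mat ?A) $$ (i, k))"
      by (simp add: atLeast0LessThan)
  qed
  also have "\<dots> = (\<Sum>k<m. if k = i then Det m f * a k else 0)"
    unfolding adj_mat(2)[OF A] using assms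
    by (intro sum.cong) (auto simp: Det_def)
  also have "\<dots> = Det m f * a i" using assms by simp
  finally show ?thesis by simp
qed

lemma Det_of_int: "Det m (\<lambda>j i. of_int (f j i)) = (of_int (Det m f) :: real)"
proof -
  have "mat m m (\<lambda>(i, j). of_int (f j i)) = map_mat (of_int :: int \<Rightarrow> real) (mat m m (\<lambda>(i, j). f j i))"
    by (auto intro!: eq_matI)
  then show ?thesis unfolding Det_def by (simp add: of_int_hom.hom_det)
qed

lemma Det_Ints:
  assumes "\<And>i j. i < m \<Longrightarrow> j < m \<Longrightarrow> f j i \<in> \<int>"
  shows "(Det m f :: real) \<in> \<int>"
proof -
  have "Det m f = Det m (\<lambda>j i. of_int \<lfloor>f j i\<rfloor>)"
    by (rule Det_cong) (use assms in \<open>auto simp: Ints_def\<close>)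
  then show ?thesis by (simp add: Det_of_int)
qed

lemma Det_mult:
  assumes "\<And>i j. i < m \<Longrightarrow> j < m \<Longrightarrow> h j i = (\<Sum>k<m. g j k * f k i)"
  shows "Det m h = Det m f * Det m g"
proof -
  have "mat m m (\<lambda>(i, j). h j i) = mat m m (\<lambda>(i, j). f j i) * mat m m (\<lambda>(i, j). g j i)"
    by (rule eq_matI)
       (auto simp: assms scalar_prod_def atLeast0LessThan mult.commute intro!: sum.cong)
  then show ?thesis unfolding Det_def by (simp add: det_mult[of _ m])
qed

section \<open>Minors with labelled columns\<close>

text \<open>Row indices also label columns: the minor on \<open>J\<close> is the determinant in which the columns outside
\<open>J\<close> are unit vectors. Enlarging or shrinking \<open>J\<close> then needs no renumbering of rows.\<close>

definition minor :: "nat \<Rightarrow> nat set \<Rightarrow> (nat \<Rightarrow> nat \<Rightarrow> 'a::comm_ring_1) \<Rightarrow> 'a" where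
  "minor m J f = Det m (\<lambda>j. if j \<in> J then f j else unit j)"

lemma minor_upd: "minor m J (f(k := a)) =
    (if k \<in> J then Det m ((\<lambda>j. if j \<in> J then f j else unit j)(k := a)) else minor m J f)"
  unfolding minor_def by (auto intro!: Det_cong)

lemma minor_cong_fun: "(\<And>j. j \<in> J \<Longrightarrow> j < m \<Longrightarrow> f j = g j) \<Longrightarrow> minor m J f = minor m J g"
  unfolding minor_def by (rule Det_cong) auto

text \<open>Rows outside \<open>J\<close> are invisible: a multiple of the unit vector \<open>unit i\<close> with \<open>i
\<notin> J\<close> may be added to any column, because \<open>unit i\<close> is itself one of the columns.\<close>

lemma minor_cong:
  assumes J: "J \<subseteq> {..<m}" and fg: "\<And>j i. j \<in> J \<Longrightarrow> i \<in> J \<Longrightarrow> f j i = g j i"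
  shows "minor m J f = minor m J g"
proof -
  have "minor m J f = minor m J (\<lambda>j. if j \<in> K then g j else f j)" if "finite K" "K \<subseteq> J" for K
    using that
  proof (induction K rule: finite_induct)
    case empty
    then show ?case by simp
  next
    case (insert k K)
    let ?h = "\<lambda>j. if j \<in> J then if j \<in> K then g j else f j else unit j"
    have k: "k < m" "k \<in> J" "k \<notin> K" using insert J by auto
    have "Det m (?h(k := g k)) = Det m (?h(k := f k)) + (\<Sum>i\<in>{..<m} - J. (g k i - f k i) * Det m (?h(k := unit i)))"
    proof -
      have "Det m (?h(k := g k)) - Det m (?h(k := f k)) = Det m (?h(k := \<lambda>i. g k i - f k i))"
        using Det_add[of k m "\<lambda>i. g k i - f k i" 1 "g k" "-1" "f k" ?h] k by simp
      also have "\<dots> = (\<Sum>i<m. (g k i - f k i) * Det m (?h(k := unit i)))"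
        by (rule Det_column_expansion) (use k in auto)
      also have "\<dots> = (\<Sum>i\<in>{..<m} - J. (g k i - f k i) * Det m (?h(k := unit i)))"
        by (rule sum.mono_neutral_right) (use k fg in auto)
      finally show ?thesis by (simp only: diff_eq_eq add.commute)
    qed
    also have "(\<Sum>i\<in>{..<m} - J. (g k i - f k i) * Det m (?h(k := unit i))) = 0"
    proof (rule sum.neutral, safe)
      fix i assume i: "i < m" "i \<notin> J"
      have "Det m (?h(k := unit i)) = 0"
        by (rule Det_equal_columns[of i m k]) (use i k in auto)
      then show "(g k i - f k i) * Det m (?h(k := unit i)) = 0" by simp
    qed
    also have "?h(k := f k) = ?h" using k by auto
    also have "?h(k := g k) = (\<lambda>j. if j \<in> J then if j \<in> insert k K then g j else f j else unit j)"
      using k by auto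
    finally have "Det m ?h = minor m J (\<lambda>j. if j \<in> insert k K then g j else f j)"
      by (simp only: minor_def add_0_right)
    moreover have "minor m J f = Det m ?h"
      using insert.IH insert.prems by (simp only: minor_def insert_subset)
    ultimately show ?case by (simp only:)
  qed
  from this[of J] have "minor m J f = minor m J (\<lambda>j. if j \<in> J then g j else f j)"
    using J finite_subset by blast
  also have "\<dots> = minor m J g" by (rule minor_cong_fun) simp
  finally show ?thesis .
qed

lemma minor_empty [simp]: "minor m {} f = 1"
  by (simp add: minor_def Det_unit)

lemma minor_sum:
  assumes J: "J \<subseteq> {..<m}" "k \<in> J" and "\<And>i. i \<in> J \<Longrightarrow> a i = (\<Sum>l\<in>K. c l * g l i)"
  shows "minor m J (f(k := a)) = (\<Sum>l\<in>K. c l * minor m J (f(k := g l)))"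
proof -
  have k: "k < m" using J by auto
  have "minor m J (f(k := a)) = minor m J (f(k := \<lambda>i. \<Sum>l\<in>K. c l * g l i))"
    by (rule minor_cong[OF J(1)]) (use assms in auto)
  also have "\<dots> = (\<Sum>l\<in>K. c l * minor m J (f(k := g l)))"
    using J(2) Det_sum[OF k, where a = "\<lambda>i. \<Sum>l\<in>K. c l * g l i" and K = K and c = c and g = g and f = "\<lambda>j. if j \<in> J then f j else unit j"]
    by (simp add: minor_upd)
  finally show ?thesis .
qed

lemma minor_add:
  assumes J: "J \<subseteq> {..<m}" "k \<in> J" and "\<And>i. i \<in> J \<Longrightarrow> a i = c * g i + d * h i"
  shows "minor m J (f(k := a)) = c * minor m J (f(k := g)) + d * minor m J (f(k := h))"
  using minor_sum[OF J, where K = "{True, False}" and a = a and c = "\<lambda>l. if l then c else d" and g = "\<lambda>l. if l then g else h" and f = f] assms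
  by simp

lemma minor_equal_columns:
  assumes "J \<subseteq> {..<m}" "j \<in> J" "k \<in> J" "j \<noteq> k" "\<And>i. i \<in> J \<Longrightarrow> f j i = f k i"
  shows "minor m J f = 0"
proof -
  have "minor m J f = minor m J (f(j := f k))"
    by (rule minor_cong) (use assms in auto)
  also have "\<dots> = 0" unfolding minor_def
    by (rule Det_equal_columns[of j m k]) (use assms in auto)
  finally show ?thesis .
qed

lemma minor_swap:
  assumes "J \<subseteq> {..<m}" "j \<in> J" "k \<in> J" "j \<noteq> k"
  shows "minor m J (f(j := a, k := b)) = - minor m J (f(j := b, k := a))"
proof -
  let ?h = "\<lambda>j. if j \<in> J then f j else unit j"
  have "minor m J (f(j := c, k := d)) = Det m (?h(j := c, k := d))" for c d
    unfolding minor_def by (rule Det_cong) (use assms in auto)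
  then show ?thesis using Det_swap[of j m k ?h a b] assms by auto
qed

text \<open>Laplace expansion of a bordered minor along the new row. The minus sign comes from swapping the new column with the
column that it replaces.\<close>

lemma minor_insert:
  assumes J: "J \<subseteq> {..<m}" and y: "y < m" "y \<notin> J"
  shows "minor m (insert y J) (f(y := a)) = a y * minor m J f - (\<Sum>j\<in>J. f j y * minor m J (f(j := a)))"
proof -
  let ?F = "\<lambda>j. if j \<in> insert y J then (f(y := a)) j else unit j"
  have fin: "finite J" using J finite_subset by blast
  have "minor m (insert y J) (f(y := a)) = (\<Sum>j<m. ?F j y * Det m (?F(j := unit y)))"
    unfolding minor_def by (rule Det_row_expansion[OF y(1)])
  also have "\<dots> = (\<Sum>j\<in>insert y J. ?F j y * Det m (?F(j := unit y)))"
    by (rule sum.mono_neutral_right) (use J y in \<open>auto simp: unit_def\<close>)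
  also have "\<dots> = a y * Det m (?F(y := unit y)) + (\<Sum>j\<in>J. f j y * Det m (?F(j := unit y)))"
    using y fin by (auto intro!: sum.cong)
  also have "Det m (?F(y := unit y)) = minor m J f"
    unfolding minor_def by (rule Det_cong) (use y in auto)
  also have "(\<Sum>j\<in>J. f j y * Det m (?F(j := unit y))) = (\<Sum>j\<in>J. - (f j y * minor m J (f(j := a))))"
  proof (rule sum.cong[OF refl])
    fix j assume j: "j \<in> J"
    have jy: "j < m" "j \<noteq> y" using j J y by auto
    have "Det m (?F(j := unit y)) = Det m (?F(j := unit y, y := a))"
      by (rule Det_cong) (use jy in auto)
    also have "\<dots> = - Det m (?F(j := a, y := unit y))"
      by (rule Det_swap) (use jy y in auto)
    also have "Det m (?F(j := a, y := unit y)) = minor m J (f(j := a))"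
      unfolding minor_def by (rule Det_cong) (use j jy y in auto)
    finally show "f j y * Det m (?F(j := unit y)) = - (f j y * minor m J (f(j := a)))"
      by (simp only: mult_minus_right)
  qed
  finally show ?thesis by (simp only: sum_negf diff_conv_add_uminus)
qed

lemma minor_cramer:
  assumes J: "J \<subseteq> {..<m}" and i: "i \<in> J"
  shows "minor m J f * a i = (\<Sum>j\<in>J. minor m J (f(j := a)) * f j i)"
proof -
  let ?F = "\<lambda>j. if j \<in> J then f j else unit j"
  have "minor m J f * a i = (\<Sum>j<m. Det m (?F(j := a)) * ?F j i)"
    unfolding minor_def by (rule Det_cramer) (use J i in auto)
  also have "\<dots> = (\<Sum>j\<in>J. Det m (?F(j := a)) * ?F j i)"
    by (rule sum.mono_neutral_right) (use J i in \<open>auto simp: unit_def\<close>)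
  also have "\<dots> = (\<Sum>j\<in>J. minor m J (f(j := a)) * f j i)"
    by (rule sum.cong) (auto simp: minor_upd)
  finally show ?thesis .
qed

text \<open>If \<open>J\<close> is as large as possible, every minor on \<open>insert i J\<close> vanishes, and expanding it along
row \<open>i\<close> extends Cramer's rule from the rows in \<open>J\<close> to row \<open>i\<close>. The rule is stated for all
columns from \<open>Y\<close> and not just for the chosen ones, since vectors are exchanged later.\<close>

lemma maximal_minor:
  fixes Y :: "(nat \<Rightarrow> 'a::idom) set"
  assumes R: "R \<subseteq> {..<m}"
  obtains J f where "J \<subseteq> R" "\<forall>j\<in>J. f j \<in> Y" "minor m J f \<noteq> 0"
    "\<forall>g. (\<forall>j\<in>J. g j \<in> Y) \<longrightarrow> (\<forall>u\<in>Y. \<forall>i\<in>R.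
      minor m J g * u i = (\<Sum>j\<in>J. minor m J (g(j := u)) * g j i))"
proof -
  define P where "P J = (\<exists>f. J \<subseteq> R \<and> (\<forall>j\<in>J. f j \<in> Y) \<and> minor m J f \<noteq> 0)" for J
  have finR: "finite R" using R finite_subset by blast
  have "P {}" by (auto simp: P_def)
  moreover have "\<forall>J. P J \<longrightarrow> card J \<le> card R" using finR by (auto simp: P_def intro!: card_mono)
  ultimately have "\<exists>J. P J \<and> (\<forall>K. P K \<longrightarrow> card K \<le> card J)"
    by (intro ex_has_greatest_nat[of P "{}" card "Suc (card R)"]) (auto simp: less_Suc_eq_le)
  then obtain J where J: "P J" "\<And>K. P K \<Longrightarrow> card K \<le> card J" by blast
  then obtain f where f: "J \<subseteq> R" "\<forall>j\<in>J. f j \<in> Y" "minor m J f \<noteq> 0" by (auto simp: P_def)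
  have Jm: "J \<subseteq> {..<m}" and finJ: "finite J" using f R finR finite_subset by auto
  have span: "minor m J g * u i = (\<Sum>j\<in>J. minor m J (g(j := u)) * g j i)"
    if g: "\<And>j. j \<in> J \<Longrightarrow> g j \<in> Y" and that: "u \<in> Y" "i \<in> R" for g u i
  proof (cases "i \<in> J")
    case True
    then show ?thesis using minor_cramer[OF Jm] by blast
  next
    case False
    have "\<not> P (insert i J)" using J(2)[of "insert i J"] False finJ by auto
    moreover have "insert i J \<subseteq> R" "\<forall>j\<in>insert i J. (g(i := u)) j \<in> Y" using f(1) that g by auto
    ultimately have "minor m (insert i J) (g(i := u)) = 0" unfolding P_def by blast
    then show ?thesis using minor_insert[OF Jm _ False, of g u] that R
      by (auto simp: mult.commute)
  qed
  show ?thesis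
    by (rule that[OF f]) (use span in blast)
qed

lemma minor_zero_column:
  assumes "J \<subseteq> {..<m}" "j \<in> J" "\<And>i. i \<in> J \<Longrightarrow> f j i = 0"
  shows "minor m J f = 0"
  using minor_sum[OF assms(1,2), where a = "f j" and K = "{}" and f = f] assms(3) by simp

lemma minor_column_operations:
  assumes J: "J \<subseteq> {..<m}" "k \<in> J" and K: "finite K" "K \<subseteq> J" "k \<notin> K"
  shows "minor m J (\<lambda>j. if j \<in> K then (\<lambda>i. f j i + c * f k i) else f j) = minor m J f"
  using K
proof (induction K rule: finite_induct)
  case empty
  then show ?case by simp
next
  case (insert l K)
  let ?h = "\<lambda>j. if j \<in> K then (\<lambda>i. f j i + c * f k i) else f j"
  have lk: "l \<noteq> k" "l \<in> J" using insert by auto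
  have "(\<lambda>j. if j \<in> insert l K then (\<lambda>i. f j i + c * f k i) else f j)
      = ?h(l := \<lambda>i. f l i + c * f k i)"
    using insert by auto
  then have "minor m J (\<lambda>j. if j \<in> insert l K then (\<lambda>i. f j i + c * f k i) else f j)
      = minor m J (?h(l := \<lambda>i. f l i + c * f k i))" by (simp only:)
  also have "\<dots> = 1 * minor m J (?h(l := f l)) + c * minor m J (?h(l := f k))"
    by (rule minor_add[OF J(1) lk(2)]) simp
  also have "minor m J (?h(l := f k)) = 0"
    by (rule minor_equal_columns[OF J(1) lk(2) J(2) lk(1)]) (use lk insert in auto)
  also have "?h(l := f l) = ?h" using insert by auto
  finally show ?case using insert by simp
qed

text \<open>Bordering by two rows and two columns, one of which vanishes on \<open>J\<close>.\<close>

lemma minor_insert_two: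
  assumes J: "J \<subseteq> {..<m}" and xy: "x < m" "y < m" "x \<noteq> y" "x \<notin> J" "y \<notin> J"
    and a: "\<And>i. i \<in> J \<Longrightarrow> a i = 0"
  shows "minor m (insert x (insert y J)) (z(y := w, x := a)) =
    a x * (w y * minor m J z - (\<Sum>j\<in>J. z j y * minor m J (z(j := w)))) -
    a y * (w x * minor m J z - (\<Sum>j\<in>J. z j x * minor m J (z(j := w))))"
proof -
  have fin: "finite J" using J finite_subset by blast
  let ?f = "z(y := w)"
  have 0: "minor m J (g(j := a)) = 0" if "j \<in> J" for g j
    by (rule minor_zero_column[OF J that]) (simp add: a)
  have 1: "minor m (insert y J) ?f = w y * minor m J z - (\<Sum>j\<in>J. z j y * minor m J (z(j := w)))"
    by (rule minor_insert[OF J xy(2,5)])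
  have 2: "minor m (insert y J) (?f(y := a)) = a y * minor m J z"
    using minor_insert[OF J xy(2,5), of z a] 0 by simp
  have 3: "minor m (insert y J) (?f(j := a)) = - (a y * minor m J (z(j := w)))" if j: "j \<in> J" for j
  proof -
    have jy: "j \<noteq> y" using j xy by auto
    have "minor m (insert y J) (?f(j := a)) = minor m (insert y J) ((z(j := a))(y := w))"
      using jy by (simp add: fun_upd_twist)
    also have "\<dots> = w y * minor m J (z(j := a)) - (\<Sum>l\<in>J. (z(j := a)) l y * minor m J (z(j := a, l := w)))"
      by (rule minor_insert[OF J xy(2,5)])
    also have "(\<Sum>l\<in>J. (z(j := a)) l y * minor m J (z(j := a, l := w)))
        = (\<Sum>l\<in>J. if l = j then a y * minor m J (z(j := w)) else 0)"
    proof (rule sum.cong[OF refl])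
      fix l assume l: "l \<in> J"
      show "(z(j := a)) l y * minor m J (z(j := a, l := w)) = (if l = j then a y * minor m J (z(j := w)) else 0)"
      proof (cases "l = j")
        case False
        then have "minor m J (z(j := a, l := w)) = minor m J ((z(l := w))(j := a))"
          by (simp add: fun_upd_twist)
        then show ?thesis using 0[OF j, of "z(l := w)"] False by simp
      qed auto
    qed
    also have "\<dots> = a y * minor m J (z(j := w))" using fin j by simp
    finally show ?thesis using 0[OF j] by (simp only: mult_zero_right diff_0)
  qed
  have "minor m (insert x (insert y J)) (?f(x := a)) =
      a x * minor m (insert y J) ?f - (\<Sum>j\<in>insert y J. ?f j x * minor m (insert y J) (?f(j := a)))"
    by (rule minor_insert) (use J xy in auto)
  also have "(\<Sum>j\<in>insert y J. ?f j x * minor m (insert y J) (?f(j := a)))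
      = w x * (a y * minor m J z) + (\<Sum>j\<in>J. - (a y * (z j x * minor m J (z(j := w)))))"
    unfolding sum.insert[OF fin xy(5)]
  proof (rule arg_cong2[where f = "(+)"])
    show "?f y x * minor m (insert y J) (?f(y := a)) = w x * (a y * minor m J z)"
      unfolding 2 by simp
    show "(\<Sum>j\<in>J. ?f j x * minor m (insert y J) (?f(j := a)))
        = (\<Sum>j\<in>J. - (a y * (z j x * minor m J (z(j := w)))))"
    proof (rule sum.cong[OF refl])
      fix j assume j: "j \<in> J"
      then have "?f j x = z j x" using xy(5) by auto
      then show "?f j x * minor m (insert y J) (?f(j := a)) = - (a y * (z j x * minor m J (z(j := w))))"
        unfolding 3[OF j] by simp
    qed
  qed
  finally have F: "minor m (insert x (insert y J)) (?f(x := a)) = a x * minor m (insert y J) ?f -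
    (w x * (a y * minor m J z) + (\<Sum>j\<in>J. - (a y * (z j x * minor m J (z(j := w))))))" .
  show ?thesis
    unfolding F 1 by (simp add: sum_negf sum_distrib_left algebra_simps)
qed

section \<open>Families doubled in two directions\<close>

definition bounded_minors :: "nat \<Rightarrow> nat set \<Rightarrow> (nat \<Rightarrow> real) set \<Rightarrow> bool" where
  "bounded_minors m R X \<longleftrightarrow> (\<forall>J\<subseteq>R. \<forall>f. (\<forall>j\<in>J. f j \<in> X) \<longrightarrow> \<bar>minor m J f\<bar> \<le> 1)"

lemma bounded_minorsD:
  "bounded_minors m R X \<Longrightarrow> J \<subseteq> R \<Longrightarrow> (\<And>j. j \<in> J \<Longrightarrow> f j \<in> X) \<Longrightarrow> \<bar>minor m J f\<bar> \<le> 1"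
  unfolding bounded_minors_def by blast

text \<open>The vectors \<open>v i\<close>, \<open>i \<in> J\<close>, together with \<open>v y\<close> span a simplex in the rows
\<open>J\<close>. The numbers below are, up to a common factor, the signed volumes of the simplices obtained by replacing the
vertex \<open>v i\<close> by the origin. Divided by their sum, which stands for the volume of the simplex
(\<open>sum_facet\<close>), they are the barycentric coordinates of the origin.\<close>

definition facet :: "nat \<Rightarrow> nat set \<Rightarrow> nat \<Rightarrow> (nat \<Rightarrow> nat \<Rightarrow> real) \<Rightarrow> nat \<Rightarrow> real" where
  "facet m J y v i = (if i = y then minor m J v else - minor m J (v(i := v y)))"

text \<open>Both sides equal the determinant with columns \<open>v i\<close> and an additional row of ones.\<close>

lemma sum_facet:
  assumes J: "J \<subseteq> {..<m}" and y: "y < m" "y \<notin> J"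
  shows "(\<Sum>i\<in>insert y J. facet m J y v i) = minor m J (\<lambda>j i. v j i - v y i)"
proof -
  have fin: "finite J" using J finite_subset by blast
  let ?f = "(\<lambda>j. (v j)(y := 1))(y := (v y)(y := 1))"
  let ?g = "\<lambda>j. if j \<in> J then (\<lambda>i. ?f j i + (-1) * ?f y i) else ?f j"
  have J': "insert y J \<subseteq> {..<m}" using J y by auto
  have cong1: "minor m J (\<lambda>j. (v j)(y := 1)) = minor m J v"
    by (rule minor_cong[OF J]) (use y in auto)
  have cong2: "minor m J ((\<lambda>j. (v j)(y := 1))(j := (v y)(y := 1))) = minor m J (v(j := v y))" for j
    by (rule minor_cong[OF J]) (use y in auto)
  have "(\<Sum>i\<in>insert y J. facet m J y v i) = minor m J v - (\<Sum>j\<in>J. minor m J (v(j := v y)))"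
    using fin y by (auto simp: facet_def sum_negf[symmetric] intro!: sum.cong)
  also have "\<dots> = minor m (insert y J) ?f"
    using minor_insert[OF J y, of "\<lambda>j. (v j)(y := 1)" "(v y)(y := 1)"] by (simp add: cong1 cong2)
  also have "\<dots> = minor m (insert y J) ?g"
    by (rule minor_column_operations[symmetric]) (use J' fin y in auto)
  also have "\<dots> = minor m (insert y J) (?g(y := (v y)(y := 1)))"
    by (rule arg_cong[where f = "minor m _"]) (use y in auto)
  also have "\<dots> = minor m J ?g"
  proof -
    have "(\<Sum>j\<in>J. ?g j y * minor m J (?g(j := (v y)(y := 1)))) = 0"
      by (rule sum.neutral) (use y in auto)
    then show ?thesis using minor_insert[OF J y, of ?g "(v y)(y := 1)"] by simp
  qed
  also have "\<dots> = minor m J (\<lambda>j i. v j i - v y i)"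
    by (rule minor_cong[OF J]) (use y in auto)
  finally show ?thesis .
qed

text \<open>The vertices of the simplex receive arbitrary admissible entries \<open>p\<close> and \<open>q\<close> in the two
extra rows. The point over \<open>v k\<close> may be moved by \<open>d\<close> in direction \<open>x\<close> and by \<open>s
e\<close> in direction \<open>y\<close> at the same time, which yields one further vector of the family. The minor formed by all
these vectors is the displayed sum, because the displacement vanishes on \<open>J\<close>.\<close>

lemma doubled_simplex_minor:
  assumes R: "R \<subseteq> {..<m}" and xy: "x < m" "y < m" "x \<noteq> y" "x \<notin> R" "y \<notin> R"
    and good: "bounded_minors m (insert x (insert y R))
        {w(x := p, y := q) |w p q. w \<in> W \<and> p \<in> {a, a + d} \<and> q \<in> {b, b + e}}"
    and J: "J \<subseteq> R" and v: "\<And>i. i \<in> insert y J \<Longrightarrow> v i \<in> W"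
    and pq: "\<And>i. i \<in> insert y J \<Longrightarrow> p i \<in> {a, a + d} \<and> q i \<in> {b, b + e}"
    and k: "k \<in> insert y J" "p k = a" "q k = (if s = 1 then b else b + e)" and s: "s = 1 \<or> s = -1"
  shows "\<bar>\<Sum>i\<in>insert y J. (d * q i - s * e * p i) * facet m J y v i\<bar> \<le> 1"
proof -
  let ?K = "insert x (insert y J)"
  have Jm: "J \<subseteq> {..<m}" and fin: "finite J" using J R finite_subset[of J "{..<m}"] by auto
  have xyJ: "x \<notin> J" "y \<notin> J" using xy J by auto
  have Km: "?K \<subseteq> {..<m}" using Jm xy by auto
  define z where "z i = (v i)(x := p i, y := q i)" for i
  define zz where "zz = (v k)(x := a + d, y := q k + s * e)"
  define u where "u i = (if i = x then d else if i = y then s * e else 0)" for i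
  have "\<bar>minor m ?K (z(x := zz))\<bar> \<le> 1"
  proof -
    have "(z(x := zz)) j \<in> {w(x := p, y := q) |w p q. w \<in> W \<and> p \<in> {a, a + d} \<and> q \<in> {b, b + e}}"
      if "j \<in> ?K" for j
    proof (cases "j = x")
      case True
      have "zz = (v k)(x := a + d, y := q k + s * e)" "v k \<in> W" "q k + s * e \<in> {b, b + e}"
        using k v s by (auto simp: zz_def)
      then show ?thesis using True by auto
    next
      case False
      then show ?thesis using that v[of j] pq[of j] unfolding z_def by auto
    qed
    moreover have "?K \<subseteq> insert x (insert y R)" using J by auto
    ultimately show ?thesis by (intro bounded_minorsD[OF good])
  qed
  also have "minor m ?K (z(x := zz)) = 1 * minor m ?K (z(x := u)) + 1 * minor m ?K (z(x := z k))"
  proof (rule minor_add[OF Km])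
    have kq: "p k = a" "q k + s * e = s * e + q k" using k by auto
    show "zz i = 1 * u i + 1 * z k i" for i
      using xy(3) kq by (auto simp: zz_def u_def z_def)
  qed simp
  also have "minor m ?K (z(x := z k)) = 0"
    by (rule minor_equal_columns[OF Km, of x k]) (use k xy xyJ in auto)
  also have "z(x := u) = z(y := z y, x := u)" by simp
  also have "minor m ?K (z(y := z y, x := u)) =
     u x * (z y y * minor m J z - (\<Sum>j\<in>J. z j y * minor m J (z(j := z y)))) -
     u y * (z y x * minor m J z - (\<Sum>j\<in>J. z j x * minor m J (z(j := z y))))"
    by (rule minor_insert_two[OF Jm xy(1-3) xyJ]) (use xyJ in \<open>auto simp: u_def\<close>)
  also have "minor m J z = minor m J v"
    by (rule minor_cong[OF Jm]) (use xyJ in \<open>auto simp: z_def\<close>)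
  also have "(\<lambda>j. minor m J (z(j := z y))) = (\<lambda>j. minor m J (v(j := v y)))"
    by (rule ext, rule minor_cong[OF Jm]) (use xyJ in \<open>auto simp: z_def\<close>)
  finally have "\<bar>u x * (z y y * minor m J v - (\<Sum>j\<in>J. z j y * minor m J (v(j := v y)))) -
     u y * (z y x * minor m J v - (\<Sum>j\<in>J. z j x * minor m J (v(j := v y))))\<bar> \<le> 1" by simp
  also have "u x * (z y y * minor m J v - (\<Sum>j\<in>J. z j y * minor m J (v(j := v y)))) -
     u y * (z y x * minor m J v - (\<Sum>j\<in>J. z j x * minor m J (v(j := v y)))) =
     d * (q y * minor m J v - (\<Sum>j\<in>J. q j * minor m J (v(j := v y)))) -
     s * e * (p y * minor m J v - (\<Sum>j\<in>J. p j * minor m J (v(j := v y))))"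
    using xy by (simp add: u_def z_def)
  also have "\<dots> = (\<Sum>i\<in>insert y J. (d * q i - s * e * p i) * facet m J y v i)"
  proof -
    have "(\<Sum>i\<in>J. (d * q i - s * e * p i) * facet m J y v i)
       = (\<Sum>i\<in>J. s * e * (p i * minor m J (v(i := v y))) - d * (q i * minor m J (v(i := v y))))"
      using xyJ by (intro sum.cong) (auto simp: facet_def algebra_simps)
    then show ?thesis using fin xyJ
      by (simp add: facet_def sum_subtractf sum_distrib_left algebra_simps)
  qed
  finally show ?thesis .
qed

lemma minor_Ints:
  fixes f :: "nat \<Rightarrow> nat \<Rightarrow> real"
  assumes J: "J \<subseteq> {..<m}" and f: "\<And>i j. i \<in> J \<Longrightarrow> j \<in> J \<Longrightarrow> f j i \<in> \<int>"
  shows "minor m J f \<in> \<int>"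
proof -
  have "minor m J f = minor m J (\<lambda>j i. if i \<in> J then f j i else 0)"
    by (rule minor_cong[OF J]) simp
  also have "\<dots> \<in> \<int>"
    unfolding minor_def by (rule Det_Ints) (auto simp: unit_def f)
  finally show ?thesis .
qed

lemma abs_diff_opposite: "u * v \<le> 0 \<Longrightarrow> \<bar>u - v\<bar> = \<bar>u\<bar> + \<bar>v :: real\<bar>"
  unfolding mult_le_0_iff by auto

text \<open>In the sum of \<open>doubled_simplex_minor\<close> the entries \<open>p\<close> and \<open>q\<close> of the vertices
other than \<open>k\<close> are still free. Choosing them such that no cancellation occurs bounds the volumes of all facets other
than the \<open>k\<close>-th one. The volume \<open>\<nu>\<close> of the simplex is a nonzero integer, so \<open>|\<nu>| \<ge>
1\<close>, and the barycentric coordinate at \<open>k\<close>, which is one minus the sum of the others, cannot be small.\<close>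

lemma barycentric_coordinate_ge:
  assumes R: "R \<subseteq> {..<m}" and xy: "x < m" "y < m" "x \<noteq> y" "x \<notin> R" "y \<notin> R"
    and good: "bounded_minors m (insert x (insert y R))
        {w(x := p, y := q) |w p q. w \<in> W \<and> p \<in> {a, a + d} \<and> q \<in> {b, b + e}}"
    and de: "d > 0" "e > 0"
    and int: "\<forall>w\<in>W. \<forall>w'\<in>W. \<forall>i\<in>R. w i - w' i \<in> \<int>"
    and J: "J \<subseteq> R" and v: "\<And>i. i \<in> insert y J \<Longrightarrow> v i \<in> W"
    and nz: "minor m J (\<lambda>j i. v j i - v y i) \<noteq> 0" and k: "k \<in> insert y J"
  shows "facet m J y v k / minor m J (\<lambda>j i. v j i - v y i)
    \<ge> 1 - 1 / (d * e) + \<bar>a + d / 2\<bar> / d + \<bar>b + e / 2\<bar> / e"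
proof -
  let ?I = "insert y J" and ?l = "facet m J y v"
  define nu where "nu = minor m J (\<lambda>j i. v j i - v y i)"
  have Jm: "J \<subseteq> {..<m}" and fin: "finite J" using J R finite_subset[of J "{..<m}"] by auto
  have yJ: "y \<notin> J" using J xy by auto
  have nu: "nu = (\<Sum>i\<in>?I. ?l i)" unfolding nu_def by (rule sum_facet[symmetric]) (use Jm yJ xy in auto)
  have "nu \<in> \<int>"
  proof -
    have "(\<lambda>j i. v j i - v y i) j i \<in> \<int>" if "i \<in> J" "j \<in> J" for i j
      using that v J int by auto
    then show ?thesis unfolding nu_def by (intro minor_Ints[OF Jm]) auto
  qed
  then have nu1: "\<bar>nu\<bar> \<ge> 1" using nz Ints_nonzero_abs_ge1 unfolding nu_def by blast
  \<comment> \<open>The sign is chosen such that the absolute values of the midpoints of both intervals add up.\<close>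
  obtain s :: real where s: "s = 1 \<or> s = -1"
    and sc: "\<bar>d * (b + e / 2) - s * e * (a + d / 2)\<bar> = d * \<bar>b + e / 2\<bar> + e * \<bar>a + d / 2\<bar>"
  proof (cases "(b + e / 2) * (a + d / 2) \<le> 0")
    case True
    have "(d * (b + e / 2)) * (e * (a + d / 2)) \<le> 0"
      using mult_nonneg_nonpos[OF _ True, of "d * e"] de by (simp add: mult_ac)
    then have "\<bar>d * (b + e / 2) - 1 * e * (a + d / 2)\<bar> = \<bar>d * (b + e / 2)\<bar> + \<bar>e * (a + d / 2)\<bar>"
      using abs_diff_opposite by simp
    then show ?thesis using that[of 1] de by (simp add: abs_mult)
  next
    case False
    have "(d * (b + e / 2)) * (e * (a + d / 2)) \<ge> 0"
      using mult_nonneg_nonneg[of "d * e" "(b + e / 2) * (a + d / 2)"] False de by (simp add: mult_ac)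
    then have "\<bar>d * (b + e / 2) - (-1) * e * (a + d / 2)\<bar> = \<bar>d * (b + e / 2)\<bar> + \<bar>e * (a + d / 2)\<bar>"
      using abs_diff_opposite[of "d * (b + e / 2)" "- (e * (a + d / 2))"] by simp
    then show ?thesis using that[of "-1"] de by (simp add: abs_mult)
  qed
  \<comment> \<open>The coefficient of a vertex is \<open>c\<close> plus \<open>d e\<close> or \<open>- d e\<close> (and \<open>c\<close> at \<open>k\<close>); \<open>t\<close> selects the sign.\<close>
  define c where "c = d * (b + e / 2) - s * e * (a + d / 2)"
  define r where "r = (if c * nu \<ge> 0 then 1 else - 1 :: real)"
  define t where "t i = r * (if ?l i \<ge> 0 then 1 else - 1)" for i
  have t1: "t i = 1 \<or> t i = -1" for i by (auto simp: t_def r_def)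
  define q where "q i = (if i = k then (if s = 1 then b else b + e) else if t i = 1 then b + e else b)" for i
  define p where "p i = (if i = k then a else if t i = s then a else a + d)" for i
  have pq: "d * q i - s * e * p i = c + (if i = k then 0 else d * e * t i)" for i
    using s t1[of i] by (auto simp: p_def q_def c_def field_simps)
  have "\<bar>\<Sum>i\<in>?I. (d * q i - s * e * p i) * ?l i\<bar> \<le> 1"
    by (rule doubled_simplex_minor[OF R xy good J v, where k = k]) (use k s in \<open>auto simp: p_def q_def\<close>)
  also have "(\<Sum>i\<in>?I. (d * q i - s * e * p i) * ?l i)
      = c * nu + d * e * (\<Sum>i\<in>?I - {k}. t i * ?l i)"
  proof -
    have "(\<Sum>i\<in>?I. (d * q i - s * e * p i) * ?l i)
        = (\<Sum>i\<in>?I. c * ?l i) + (\<Sum>i\<in>?I. if i = k then 0 else d * e * (t i * ?l i))"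
      unfolding pq sum.distrib[symmetric] by (intro sum.cong) (auto simp: algebra_simps)
    also have "(\<Sum>i\<in>?I. if i = k then 0 else d * e * (t i * ?l i)) = (\<Sum>i\<in>?I - {k}. d * e * (t i * ?l i))"
      by (rule sum.mono_neutral_cong_right) (use fin in auto)
    finally show ?thesis by (simp add: nu sum_distrib_left)
  qed
  finally have le1: "\<bar>c * nu + d * e * (\<Sum>i\<in>?I - {k}. t i * ?l i)\<bar> \<le> 1" .
  define Sg where "Sg = (\<Sum>i\<in>?I - {k}. \<bar>?l i\<bar>)"
  have "(\<Sum>i\<in>?I - {k}. t i * ?l i) = (\<Sum>i\<in>?I - {k}. r * \<bar>?l i\<bar>)"
    by (rule sum.cong) (auto simp: t_def)
  then have "(\<Sum>i\<in>?I - {k}. t i * ?l i) = r * Sg" by (simp add: Sg_def sum_distrib_left)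
  moreover have "0 \<le> d * e * Sg" using de by (auto simp: Sg_def intro!: mult_nonneg_nonneg sum_nonneg)
  ultimately have le2: "\<bar>c * nu\<bar> + d * e * Sg \<le> 1"
    using le1 by (auto simp: r_def split: if_splits)
  have "(\<Sum>i\<in>?I. ?l i) = ?l k + (\<Sum>i\<in>?I - {k}. ?l i)"
    using fin k by (intro sum.remove) auto
  then have "nu - ?l k = (\<Sum>i\<in>?I - {k}. ?l i)" using nu by simp
  then have "\<bar>nu - ?l k\<bar> \<le> Sg" unfolding Sg_def by (metis sum_abs)
  then have "d * e * \<bar>nu - ?l k\<bar> + \<bar>c\<bar> * \<bar>nu\<bar> \<le> 1"
    using le2 mult_left_mono[of "\<bar>nu - ?l k\<bar>" Sg "d * e"] mult_pos_pos[OF de]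
    unfolding abs_mult by linarith
  then have "(d * e * \<bar>nu - ?l k\<bar> + \<bar>c\<bar> * \<bar>nu\<bar>) / \<bar>nu\<bar> \<le> 1 / \<bar>nu\<bar>"
    by (rule divide_right_mono) simp
  also have "\<dots> \<le> 1" using nu1 by simp
  finally have "d * e * (\<bar>nu - ?l k\<bar> / \<bar>nu\<bar>) + \<bar>c\<bar> \<le> 1"
    using nu1 by (simp add: add_divide_distrib)
  then have "\<bar>nu - ?l k\<bar> / \<bar>nu\<bar> \<le> (1 - \<bar>c\<bar>) / (d * e)"
    using de by (simp add: pos_le_divide_eq mult.commute)
  moreover have "\<bar>nu - ?l k\<bar> / \<bar>nu\<bar> = \<bar>1 - ?l k / nu\<bar>"
  proof -
    have "1 - ?l k / nu = (nu - ?l k) / nu" using nu1 by (simp add: diff_divide_distrib)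
    then show ?thesis by (simp only: abs_divide)
  qed
  ultimately have le3: "1 - ?l k / nu \<le> (1 - \<bar>c\<bar>) / (d * e)" by linarith
  have eq3: "(1 - \<bar>c\<bar>) / (d * e) = 1 / (d * e) - \<bar>a + d / 2\<bar> / d - \<bar>b + e / 2\<bar> / e"
  proof -
    have "(1 - (d * B + e * A)) / (d * e) = 1 / (d * e) - A / d - B / e" for A B
      using de by (simp add: field_simps)
    then show ?thesis unfolding c_def sc .
  qed
  have "1 - t \<le> X \<Longrightarrow> X = Y - A - B \<Longrightarrow> 1 - Y + A + B \<le> t" for t X Y A B :: real
    by simp
  from this[OF le3 eq3] show ?thesis unfolding nu_def .
qed

lemma pos_divisor: "t / a > 0 \<Longrightarrow> t > 0 \<Longrightarrow> a > (0 :: real)"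
  by (simp add: zero_less_divide_iff)

lemma pos_dividend: "t / a > 0 \<Longrightarrow> a > 0 \<Longrightarrow> t > (0 :: real)"
  by (simp add: zero_less_divide_iff)

text \<open>Take a simplex of maximal dimension with vertices in \<open>W\<close>. By \<open>barycentric_coordinate_ge\<close>,
the origin has barycentric coordinates at least \<open>eps\<close> with respect to it and to every nondegenerate simplex that
arises by exchanging a vertex. Let \<open>w \<in> W\<close> and let \<open>k\<close> be a vertex at which \<open>w\<close> has a
nonzero coordinate. If \<open>w\<close> is exchanged for \<open>k\<close>, the new coordinates of the origin can only be positive
if the coordinate of \<open>w\<close> at \<open>k\<close> is positive and the ratio of the coordinates of the origin and of
\<open>w\<close> is strictly smaller at \<open>k\<close> than at every other vertex where \<open>w\<close> has a positive
coordinate. This can happen for one \<open>k\<close> only, so \<open>w\<close> has just one nonzero coordinate and is a vertex.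
Hence \<open>W\<close> is the vertex set, and the coordinates, which sum to 1, are all at least \<open>eps\<close>.\<close>

lemma twice_doubled_card:
  assumes R: "R \<subseteq> {..<m}" and xy: "x < m" "y < m" "x \<noteq> y" "x \<notin> R" "y \<notin> R"
    and good: "bounded_minors m (insert x (insert y R))
        {w(x := p, y := q) |w p q. w \<in> W \<and> p \<in> {a, a + d} \<and> q \<in> {b, b + e}}"
    and de: "d > 0" "e > 0"
    and int: "\<forall>w\<in>W. \<forall>w'\<in>W. \<forall>i\<in>R. w i - w' i \<in> \<int>"
    and supp: "\<And>w i. w \<in> W \<Longrightarrow> i \<notin> R \<Longrightarrow> w i = 0"
    and eps: "eps \<le> 1 - 1 / (d * e) + \<bar>a + d / 2\<bar> / d + \<bar>b + e / 2\<bar> / e" "eps > 0"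
  shows "real (card W) * eps \<le> 1"
proof (cases "W = {}")
  case False
  then obtain w0 where w0: "w0 \<in> W" by blast
  obtain J g where J: "J \<subseteq> R" and g: "\<forall>j\<in>J. g j \<in> (\<lambda>w i. w i - w0 i) ` W"
    and nz: "minor m J g \<noteq> 0"
    and span': "\<forall>g. (\<forall>j\<in>J. g j \<in> (\<lambda>w i. w i - w0 i) ` W) \<longrightarrow>
      (\<forall>u\<in>(\<lambda>w i. w i - w0 i) ` W. \<forall>i\<in>R. minor m J g * u i = (\<Sum>j\<in>J. minor m J (g(j := u)) * g j i))"
    by (rule maximal_minor[OF R, of "(\<lambda>w i. w i - w0 i) ` W"])
  have span: "minor m J g * u i = (\<Sum>j\<in>J. minor m J (g(j := u)) * g j i)"
    if "u \<in> (\<lambda>w i. w i - w0 i) ` W" "i \<in> R" for u i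
    using span'[rule_format, of g u i] g that by blast
  have Jm: "J \<subseteq> {..<m}" and fin: "finite J" using J R finite_subset[of J "{..<m}"] by auto
  have yJ: "y \<notin> J" using J xy by auto
  have "\<forall>j\<in>J. \<exists>w\<in>W. g j = (\<lambda>i. w i - w0 i)" using g by blast
  then obtain v' where v': "\<And>j. j \<in> J \<Longrightarrow> v' j \<in> W" "\<And>j. j \<in> J \<Longrightarrow> g j = (\<lambda>i. v' j i - w0 i)"
    by metis
  define v where "v = v'(y := w0)"
  let ?I = "insert y J"
  have vW: "v i \<in> W" if "i \<in> ?I" for i using that v' w0 by (auto simp: v_def)
  have vy: "v y = w0" by (simp add: v_def)
  have gv: "g j = (\<lambda>i. v j i - w0 i)" if "j \<in> J" for j using v'(2)[OF that] that yJ by (auto simp: v_def)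
  define nu where "nu = minor m J g"
  have nu_diff: "minor m J (\<lambda>j i. v j i - v y i) = nu"
    unfolding nu_def by (rule minor_cong_fun) (simp add: gv vy)
  let ?l = "facet m J y v"
  have sum_l: "(\<Sum>i\<in>?I. ?l i) = nu"
    using sum_facet[OF Jm xy(2) yJ, of v] nu_diff by simp
  have bary: "facet m J y u k / minor m J (\<lambda>j i. u j i - u y i) \<ge> eps"
    if "\<And>i. i \<in> ?I \<Longrightarrow> u i \<in> W" "minor m J (\<lambda>j i. u j i - u y i) \<noteq> 0" "k \<in> ?I" for u k
    using barycentric_coordinate_ge[OF R xy good de int J, of u k, OF that] eps(1) by linarith
  have tau: "?l k / nu \<ge> eps" if "k \<in> ?I" for k
    using bary[of v k] vW that nz nu_diff nu_def by simp
  have "W \<subseteq> v ` ?I"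
  proof
    fix w assume w: "w \<in> W"
    show "w \<in> v ` ?I"
    proof (rule ccontr)
      assume nw: "w \<notin> v ` ?I"
      \<comment> \<open>Barycentric coordinates of \<open>w\<close>; \<open>ao\<close> belongs to the vertex \<open>w0 = v y\<close>.\<close>
      define al where "al j = minor m J (g(j := \<lambda>i. w i - w0 i)) / nu" for j
      define ao where "ao = 1 - (\<Sum>j\<in>J. al j)"
      have wsum: "w i - w0 i = (\<Sum>j\<in>J. al j * (v j i - w0 i))" if i: "i \<in> R" for i
      proof -
        have "nu * (w i - w0 i) = (\<Sum>j\<in>J. minor m J (g(j := \<lambda>i. w i - w0 i)) * g j i)"
          unfolding nu_def using span[of "\<lambda>i. w i - w0 i" i] i w by blast
        also have "\<dots> = (\<Sum>j\<in>J. nu * (al j * (v j i - w0 i)))"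
          by (rule sum.cong) (use nz in \<open>auto simp: al_def gv nu_def\<close>)
        finally show ?thesis using nz by (simp add: sum_distrib_left[symmetric] nu_def)
      qed
      have wsum': "w i = (\<Sum>j\<in>?I. (if j = y then ao else al j) * v j i)" if i: "i \<in> R" for i
      proof -
        have "(\<Sum>j\<in>J. (if j = y then ao else al j) * v j i) = (\<Sum>j\<in>J. al j * v j i)"
          by (rule sum.cong) (use yJ in auto)
        then show ?thesis using wsum[OF i] fin yJ
          by (simp add: ao_def vy right_diff_distrib sum_subtractf sum_distrib_right left_diff_distrib)
      qed
      have expand: "minor m J (f(k := w)) = (\<Sum>j\<in>?I. (if j = y then ao else al j) * minor m J (f(k := v j)))"
        if "k \<in> J" for f k
        by (rule minor_sum[OF Jm that]) (use wsum' J in auto)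
      have repl: "minor m J (v(k := w)) = al k * ?l y - ao * ?l k" if k: "k \<in> J" for k
      proof -
        have "(if j = y then ao else al j) * minor m J (v(k := v j))
            = (if j = k then al k * ?l y else 0) - (if j = y then ao * ?l k else 0)" if j: "j \<in> ?I" for j
        proof -
          consider "j = y" | "j = k" | "j \<in> J" "j \<noteq> k" using j by blast
          then show ?thesis
          proof cases
            case 3
            have "minor m J (v(k := v j)) = 0"
              by (rule minor_equal_columns[OF Jm k 3(1)]) (use 3 in auto)
            then show ?thesis using 3 yJ by auto
          qed (use k yJ in \<open>auto simp: facet_def\<close>)
        qed
        then have "minor m J (v(k := w)) = (\<Sum>j\<in>?I. (if j = k then al k * ?l y else 0) - (if j = y then ao * ?l k else 0))"
          unfolding expand[OF k] by (intro sum.cong) auto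
        also have "\<dots> = al k * ?l y - ao * ?l k"
          using fin k by (simp add: sum_subtractf)
        finally show ?thesis .
      qed
      \<comment> \<open>Exchanging \<open>w\<close> for \<open>v k\<close> multiplies the volume by \<open>al k\<close>.\<close>
      have exch: "al k > 0 \<and> ?l y / nu * al k > ao * (?l k / nu) \<and>
          (\<forall>l\<in>J - {k}. ?l l / nu * al k > al l * (?l k / nu))" if k: "k \<in> J" "al k \<noteq> 0" for k
      proof -
        let ?v = "v(k := w)"
        have ky: "k \<noteq> y" using k yJ by auto
        have "minor m J (\<lambda>j i. ?v j i - ?v y i) = minor m J (g(k := \<lambda>i. w i - w0 i))"
          by (rule minor_cong_fun) (use ky vy gv in auto)
        then have nu': "minor m J (\<lambda>j i. ?v j i - ?v y i) = al k * nu"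
          using nz by (simp add: al_def nu_def)
        have b: "facet m J y ?v i / (al k * nu) \<ge> eps" if "i \<in> ?I" for i
          using bary[of ?v i] that vW w k nz ky unfolding nu' nu_def by auto
        have fk: "facet m J y ?v k = ?l k" using ky by (simp add: facet_def)
        have fy: "facet m J y ?v y = al k * ?l y - ao * ?l k"
          using repl[OF k(1)] ky by (simp add: facet_def)
        have fl: "facet m J y ?v l = al k * ?l l - al l * ?l k" if l: "l \<in> J" "l \<noteq> k" for l
        proof -
          have ly: "l \<noteq> y" using l yJ by auto
          let ?f = "v(l := v y)"
          have "minor m J (?v(l := v y)) = minor m J (?f(k := w))"
            using l by (simp add: fun_upd_twist)
          also have "\<dots> = (\<Sum>j\<in>?I. (if j = y then ao else al j) * minor m J (?f(k := v j)))"
            by (rule expand[OF k(1)])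
          also have "\<dots> = (\<Sum>j\<in>?I. (if j = k then - (al k * ?l l) else 0) + (if j = l then al l * ?l k else 0))"
          proof (rule sum.cong[OF refl])
            fix j assume j: "j \<in> ?I"
            consider "j = y" | "j = k" | "j = l" | "j \<in> J" "j \<noteq> k" "j \<noteq> l" using j by blast
            then show "(if j = y then ao else al j) * minor m J (?f(k := v j))
                = (if j = k then - (al k * ?l l) else 0) + (if j = l then al l * ?l k else 0)"
            proof cases
              case 1
              have "minor m J (?f(k := v j)) = 0"
                by (rule minor_equal_columns[OF Jm k(1) l(1)]) (use l 1 in auto)
              then show ?thesis using 1 ky ly by auto
            next
              case 2
              have "?f(k := v j) = ?f" using 2 l by auto
              then show ?thesis using 2 ky ly l by (simp add: facet_def)
            next
              case 3
              have "minor m J (?f(k := v j)) = - minor m J (v(l := v l, k := v y))"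
                unfolding 3 by (rule minor_swap[OF Jm l(1) k(1) l(2)])
              then show ?thesis using 3 ky ly l by (simp add: facet_def)
            next
              case 4
              have "minor m J (?f(k := v j)) = 0"
                by (rule minor_equal_columns[OF Jm k(1) 4(1)]) (use 4 in auto)
              then show ?thesis using 4 by auto
            qed
          qed
          also have "\<dots> = al l * ?l k - al k * ?l l"
            using fin k l by (simp add: sum.distrib)
          finally show ?thesis using ly ky by (simp add: facet_def)
        qed
        have dv: "?l k / (al k * nu) = (?l k / nu) / al k" by simp
        have "eps \<le> (?l k / nu) / al k" using b[of k] k(1) unfolding fk dv by blast
        then have "(?l k / nu) / al k > 0" using eps(2) by linarith
        moreover have "?l k / nu > 0" using tau[of k] eps(2) k(1) by force
        ultimately have 1: "al k > 0" by (rule pos_divisor)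
        have pos: "X / nu * al k > Y * (?l k / nu)" if "(al k * X - Y * ?l k) / (al k * nu) > 0" for X Y
        proof -
          have "(al k * X - Y * ?l k) / (al k * nu) = (X / nu * al k - Y * (?l k / nu)) / al k"
            using nz k by (simp add: nu_def field_simps)
          then have "(X / nu * al k - Y * (?l k / nu)) / al k > 0" using that by (simp only:)
          then show ?thesis using pos_dividend[OF _ 1] by fastforce
        qed
        have 2: "?l y / nu * al k > ao * (?l k / nu)"
          using pos[of "?l y" ao] b[of y] eps(2) unfolding fy by force
        have "?l l / nu * al k > al l * (?l k / nu)" if "l \<in> J - {k}" for l
          using pos[of "?l l" "al l"] b[of l] eps(2) fl[of l] that by force
        then show ?thesis using 1 2 by blast
      qed
      have "w \<noteq> w0" using nw vy by auto
      then obtain i where i: "w i \<noteq> w0 i" by auto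
      then have iR: "i \<in> R" using supp[OF w] supp[OF w0] by metis
      have "\<exists>k\<in>J. al k \<noteq> 0"
      proof (rule ccontr)
        assume "\<not> (\<exists>k\<in>J. al k \<noteq> 0)"
        then have "(\<Sum>j\<in>J. al j * (v j i - w0 i)) = 0" by (intro sum.neutral) auto
        then show False using wsum[OF iR] i by linarith
      qed
      then obtain k where k: "k \<in> J" "al k \<noteq> 0" by blast
      have others: "al l = 0" if "l \<in> J" "l \<noteq> k" for l
      proof (rule ccontr)
        assume "al l \<noteq> 0"
        then have "?l k / nu * al l > al k * (?l l / nu)" using exch[of l] that k by blast
        moreover have "?l l / nu * al k > al l * (?l k / nu)" using exch[OF k] that by blast
        ultimately show False by (simp add: mult.commute)
      qed
      have ao: "ao = 1 - al k"
      proof -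
        have "(\<Sum>j\<in>J. al j) = (\<Sum>j\<in>J. if j = k then al k else 0)"
          by (rule sum.cong) (use others in auto)
        then show ?thesis using fin k by (simp add: ao_def)
      qed
      show False
      proof (cases "ao = 0")
        case True
        have "w j = v k j" for j
        proof (cases "j \<in> R")
          case jR: True
          have "(\<Sum>l\<in>J. al l * (v l j - w0 j)) = (\<Sum>l\<in>J. if l = k then v k j - w0 j else 0)"
            by (rule sum.cong) (use others True ao in auto)
          then show ?thesis using wsum[OF jR] fin k by simp
        next
          case False
          then show ?thesis using supp[OF w] supp[OF vW] k by auto
        qed
        then show False using nw k by auto
      next
        case False
        \<comment> \<open>The remaining exchange of \<open>w\<close> for \<open>w0\<close> contradicts the one for \<open>v k\<close>.\<close>
        let ?v = "v(y := w)"
        have keep: "minor m J ?v = minor m J v" by (rule minor_cong_fun) (use yJ in auto)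
        have upd: "minor m J (?v(j := w)) = minor m J (v(j := w))" if "j \<in> J" for j
          by (rule minor_cong_fun) (use yJ in auto)
        have fy: "facet m J y ?v y = ?l y" by (simp add: facet_def keep)
        have fl: "facet m J y ?v l = ao * ?l l - al l * ?l y" if "l \<in> J" for l
          using repl[OF that] upd[OF that] that yJ by (auto simp: facet_def)
        have "minor m J (\<lambda>j i. ?v j i - ?v y i) = (\<Sum>i\<in>?I. facet m J y ?v i)"
          by (rule sum_facet[OF Jm xy(2) yJ, symmetric])
        also have "\<dots> = ?l y + (\<Sum>l\<in>J. ao * ?l l - al l * ?l y)"
          using fin yJ by (auto simp: fy fl intro!: sum.cong)
        also have "(\<Sum>l\<in>J. ao * ?l l - al l * ?l y) = ao * (\<Sum>l\<in>J. ?l l) - (\<Sum>l\<in>J. al l) * ?l y"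
          by (simp add: sum_subtractf sum_distrib_left sum_distrib_right)
        also have "?l y + (ao * (\<Sum>l\<in>J. ?l l) - (\<Sum>l\<in>J. al l) * ?l y) = ao * nu"
          using sum_l fin yJ unfolding ao_def by (simp add: algebra_simps flip: sum_l)
        finally have nu': "minor m J (\<lambda>j i. ?v j i - ?v y i) = ao * nu" .
        have b: "facet m J y ?v i / (ao * nu) \<ge> eps" if "i \<in> ?I" for i
        proof -
          have v'W: "?v i \<in> W" if "i \<in> ?I" for i
            using that vW[of i] w by (cases "i = y") auto
          have "ao * nu \<noteq> 0" using False nz by (simp add: nu_def)
          then show ?thesis using bary[of ?v i, OF v'W _ that] unfolding nu' by blast
        qed
        have dv: "?l y / (ao * nu) = (?l y / nu) / ao" by simp
        have "eps \<le> (?l y / nu) / ao" using b[of y] unfolding fy dv by blast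
        then have "(?l y / nu) / ao > 0" using eps(2) by linarith
        moreover have "?l y / nu > 0" using tau[of y] eps(2) by force
        ultimately have 1: "ao > 0" by (rule pos_divisor)
        have "(ao * ?l k - al k * ?l y) / (ao * nu) = (ao * (?l k / nu) - al k * (?l y / nu)) / ao"
          using nz False by (simp add: nu_def field_simps)
        moreover have "eps \<le> (ao * ?l k - al k * ?l y) / (ao * nu)"
          using b[of k] k(1) unfolding fl[OF k(1)] by blast
        ultimately have "(ao * (?l k / nu) - al k * (?l y / nu)) / ao > 0"
          using eps(2) by linarith
        then have "ao * (?l k / nu) > al k * (?l y / nu)" using pos_dividend[OF _ 1] by fastforce
        then show False using exch[OF k] by (simp add: mult.commute)
      qed
    qed
  qed
  then have "card W \<le> card ?I" using fin surj_card_le[of ?I W v] by auto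
  then have "real (card W) * eps \<le> real (card ?I) * eps" using eps by (simp add: mult_right_mono)
  also have "\<dots> = (\<Sum>k\<in>?I. eps)" by simp
  also have "\<dots> \<le> (\<Sum>k\<in>?I. ?l k / nu)" by (rule sum_mono) (rule tau)
  also have "\<dots> = 1" using sum_l nz by (simp add: sum_divide_distrib[symmetric] nu_def)
  finally show ?thesis .
qed simp

section \<open>Half-integral families\<close>

text \<open>The sum modulo 2 of the members of a subfamily determines the subfamily: its members are the sets that meet the sum in
an odd number of elements. So there are at most as many subfamilies of \<open>F\<close> as subsets of \<open>J\<close>.\<close>

lemma oddtown:
  fixes F :: "'a set set"
  assumes J: "finite J" "F \<subseteq> Pow J"
    and odd: "\<And>T. T \<in> F \<Longrightarrow> odd (card T)"
    and even: "\<And>T U. T \<in> F \<Longrightarrow> U \<in> F \<Longrightarrow> T \<noteq> U \<Longrightarrow> even (card (T \<inter> U))"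
  shows "card F \<le> card J"
proof -
  have finF: "finite F" using J finite_subset by blast
  \<comment> \<open>The sum of the sets in \<open>G\<close> modulo 2.\<close>
  define s where "s G = {x\<in>J. odd (card {T\<in>G. x \<in> T})}" for G :: "'a set set"
  have parity: "T \<in> G \<longleftrightarrow> odd (card (T \<inter> s G))" if G: "G \<subseteq> F" and T: "T \<in> F" for G T
  proof -
    have finG: "finite G" using G finF finite_subset by blast
    have TJ: "T \<subseteq> J" using T J by blast
    have finT: "finite T" using TJ J finite_subset by blast
    have "(\<Sum>x\<in>T. card {U\<in>G. x \<in> U}) = (\<Sum>x\<in>T. \<Sum>U\<in>G. if x \<in> U then 1 else 0)"
      using finG by (simp add: sum.If_cases Int_def)
    also have "\<dots> = (\<Sum>U\<in>G. \<Sum>x\<in>T. if x \<in> U then 1 else 0)" by (rule sum.swap)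
    also have "\<dots> = (\<Sum>U\<in>G. card (T \<inter> U))"
      using finT by (simp add: sum.If_cases Int_def)
    finally have "odd (\<Sum>U\<in>G. card (T \<inter> U)) \<longleftrightarrow> odd (card {x\<in>T. odd (card {U\<in>G. x \<in> U})})"
      using even_sum_iff[OF finT, of "\<lambda>x. card {U\<in>G. x \<in> U}"] by simp
    also have "{x\<in>T. odd (card {U\<in>G. x \<in> U})} = T \<inter> s G" using TJ by (auto simp: s_def)
    finally have "odd (card (T \<inter> s G)) \<longleftrightarrow> odd (card {U\<in>G. odd (card (T \<inter> U))})"
      using even_sum_iff[OF finG, of "\<lambda>U. card (T \<inter> U)"] by simp
    moreover have "odd (card (T \<inter> U)) \<longleftrightarrow> U = T" if "U \<in> G" for U
    proof (cases "U = T")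
      case True
      then show ?thesis using odd[OF T] by simp
    next
      case False
      then show ?thesis using even[OF T, of U] that G by blast
    qed
    then have "{U\<in>G. odd (card (T \<inter> U))} = {U\<in>G. U = T}" by blast
    moreover have "card {U\<in>G. U = T} = (if T \<in> G then 1 else 0)"
    proof (cases "T \<in> G")
      case True
      then have "{U\<in>G. U = T} = {T}" by blast
      then show ?thesis using True by simp
    next
      case False
      then have "{U\<in>G. U = T} = {}" by blast
      then show ?thesis using False by simp
    qed
    ultimately show ?thesis by (cases "T \<in> G") (simp_all only: if_True if_False odd_one even_zero simp_thms)
  qed
  have "inj_on s (Pow F)"
  proof (rule inj_onI)
    fix G H assume GH: "G \<in> Pow F" "H \<in> Pow F" "s G = s H"
    have "T \<in> G \<longleftrightarrow> T \<in> H" if "T \<in> F" for T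
      using parity[of G T] parity[of H T] GH that by simp
    then show "G = H" using GH(1,2) by blast
  qed
  moreover have "s ` Pow F \<subseteq> Pow J" by (auto simp: s_def)
  ultimately have "card (Pow F) \<le> card (Pow J)" using J(1) by (intro card_inj_on_le[of s]) auto
  then show ?thesis using finF J(1) by (simp add: card_Pow)
qed

lemma abs_eq_half: "\<bar>a\<bar> = 1/2 \<longleftrightarrow> a = 1/2 \<or> a = -1/2" for a :: real by auto

text \<open>The family \<open>V\<close> has entries \<open>1/2\<close> and \<open>- 1/2\<close> in the rows \<open>R\<close>, and
its minors stay bounded by 1 when any of these two values is added in the row \<open>x\<close>.\<close>

locale half_rows =
  fixes m x R and V :: "(nat \<Rightarrow> real) set"
  assumes R: "R \<subseteq> {..<m}" and x: "x < m" "x \<notin> R"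
    and good: "bounded_minors m (insert x R) {v(x := p) |v p. v \<in> V \<and> p \<in> {-1/2, 1/2}}"
    and half: "\<And>v i. v \<in> V \<Longrightarrow> i \<in> R \<Longrightarrow> \<bar>v i\<bar> = 1/2"
    and supp: "\<And>v i. v \<in> V \<Longrightarrow> i \<notin> R \<Longrightarrow> v i = 0"
begin

lemma finV: "finite V"
proof -
  have "finite R" using R finite_subset by blast
  then have "finite {f. \<forall>i. (i \<in> R \<longrightarrow> f i \<in> {1/2, -1/2 :: real}) \<and> (i \<notin> R \<longrightarrow> f i = 0)}"
    by (rule finite_set_of_finite_funs) simp
  moreover have "V \<subseteq> {f. \<forall>i. (i \<in> R \<longrightarrow> f i \<in> {1/2, -1/2 :: real}) \<and> (i \<notin> R \<longrightarrow> f i = 0)}"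
    using half supp unfolding abs_eq_half by blast
  ultimately show ?thesis by (rule rev_finite_subset)
qed

text \<open>The entries in row \<open>x\<close> can be chosen such that all terms of the expansion along \<open>x\<close> have the
same sign; each term has absolute value half of a minor.\<close>

lemma minors_sum:
  assumes J: "J \<subseteq> R" and v: "\<And>j. j \<in> J \<Longrightarrow> v j \<in> V" and u: "u \<in> V"
  shows "\<bar>minor m J v\<bar> + (\<Sum>j\<in>J. \<bar>minor m J (v(j := u))\<bar>) \<le> 2"
proof -
  have Jm: "J \<subseteq> {..<m}" and xJ: "x \<notin> J" using J R x by auto
  define p where "p j = (if minor m J (v(j := u)) \<ge> 0 then -1/2 else 1/2 :: real)" for j
  define q where "q = (if minor m J v \<ge> 0 then 1/2 else -1/2 :: real)"
  define f where "f = (\<lambda>j. (v j)(x := p j))"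
  define D where "D j = minor m J (v(j := u))" for j
  have "\<bar>minor m (insert x J) (f(x := u(x := q)))\<bar> \<le> 1"
  proof (rule bounded_minorsD[OF good])
    show "insert x J \<subseteq> insert x R" using J by auto
    show "(f(x := u(x := q))) j \<in> {v(x := p) |v p. v \<in> V \<and> p \<in> {-1/2, 1/2}}" if "j \<in> insert x J" for j
    proof (cases "j = x")
      case True
      have "q \<in> {-1/2, 1/2}" by (auto simp: q_def)
      then show ?thesis using True u by auto
    next
      case False
      have "p j \<in> {-1/2, 1/2}" by (auto simp: p_def)
      then show ?thesis using False that v[of j] unfolding f_def by auto
    qed
  qed
  also have "minor m (insert x J) (f(x := u(x := q)))
      = q * minor m J f - (\<Sum>j\<in>J. f j x * minor m J (f(j := u(x := q))))"
    using minor_insert[OF Jm x(1) xJ, of f "u(x := q)"] by simp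
  also have "minor m J f = minor m J v"
    by (rule minor_cong[OF Jm]) (use xJ in \<open>auto simp: f_def\<close>)
  also have "(\<Sum>j\<in>J. f j x * minor m J (f(j := u(x := q)))) = (\<Sum>j\<in>J. - (\<bar>D j\<bar> / 2))"
  proof (rule sum.cong[OF refl])
    fix j assume "j \<in> J"
    have "minor m J (f(j := u(x := q))) = minor m J (v(j := u))"
      by (rule minor_cong[OF Jm]) (use xJ in \<open>auto simp: f_def\<close>)
    then show "f j x * minor m J (f(j := u(x := q))) = - (\<bar>D j\<bar> / 2)"
      by (auto simp: f_def p_def D_def)
  qed
  also have "q * minor m J v = \<bar>minor m J v\<bar> / 2" by (auto simp: q_def)
  finally have "\<bar>\<bar>minor m J v\<bar> / 2 + (\<Sum>j\<in>J. \<bar>D j\<bar>) / 2\<bar> \<le> 1"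
    by (simp add: sum_negf sum_divide_distrib)
  then have "\<bar>minor m J v\<bar> + (\<Sum>j\<in>J. \<bar>D j\<bar>) \<le> 2" by simp
  then show ?thesis by (simp only: D_def)
qed

text \<open>Subtracting one column from all others makes the others integral.\<close>

lemma minor_half_Ints:
  assumes J: "J \<subseteq> R" "J \<noteq> {}" and v: "\<And>j. j \<in> J \<Longrightarrow> v j \<in> V"
  shows "2 * minor m J v \<in> \<int>"
proof -
  obtain k where k: "k \<in> J" using J by blast
  have Jm: "J \<subseteq> {..<m}" and fin: "finite J" using J R finite_subset[of J "{..<m}"] by auto
  have "minor m J v = minor m J (\<lambda>j. if j \<in> J - {k} then (\<lambda>i. v j i + (-1) * v k i) else v j)"
    by (rule minor_column_operations[symmetric]) (use Jm k fin in auto)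
  also have "\<dots> = minor m J ((\<lambda>j. if j \<in> J - {k} then (\<lambda>i. v j i + (-1) * v k i) else v j)(k := v k))"
    by (rule arg_cong[where f = "minor m J"]) auto
  finally have "2 * minor m J v =
      minor m J ((\<lambda>j. if j \<in> J - {k} then (\<lambda>i. v j i + (-1) * v k i) else v j)(k := \<lambda>i. 2 * v k i))"
    (is "_ = minor m J ?g")
    using minor_add[OF Jm k, of "\<lambda>i. 2 * v k i" 2 "v k" 0 "v k"
       "\<lambda>j. if j \<in> J - {k} then (\<lambda>i. v j i + (-1) * v k i) else v j"] by simp
  also have "\<dots> \<in> \<int>"
  proof (rule minor_Ints[OF Jm])
    fix i j assume ij: "i \<in> J" "j \<in> J"
    have hi: "\<bar>v j i\<bar> = 1/2" "\<bar>v k i\<bar> = 1/2" using ij k J half[OF v] by auto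
    have "v j i + (-1) * v k i \<in> {0, 1, -1}" "2 * v k i \<in> {1, -1}"
      using hi unfolding abs_eq_half by auto
    then show "?g j i \<in> \<int>" using ij by (cases "j = k") auto
  qed
  finally show ?thesis .
qed

lemma proportional_eq_or_uminus:
  assumes u: "u \<in> V" "w \<in> V" and c: "\<And>i. i \<in> R \<Longrightarrow> u i = c * w i"
  shows "u = w \<or> u = (\<lambda>i. - w i)"
proof (cases "R = {}")
  case True
  then have "u i = w i" for i using supp[OF u(1)] supp[OF u(2)] by simp
  then show ?thesis by auto
next
  case False
  then obtain r where r: "r \<in> R" by blast
  have "\<bar>c\<bar> = 1" using c[OF r] half[OF u(1) r] half[OF u(2) r] by (simp add: abs_mult)
  then consider "c = 1" | "c = -1" by linarith
  then show ?thesis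
  proof cases
    case 1
    have "u i = w i" for i using c[of i] 1 supp[OF u(1), of i] supp[OF u(2), of i] by (cases "i \<in> R") auto
    then show ?thesis by auto
  next
    case 2
    have "u i = - w i" for i using c[of i] 2 supp[OF u(1), of i] supp[OF u(2), of i] by (cases "i \<in> R") auto
    then show ?thesis by auto
  qed
qed

text \<open>By Cramer's rule, \<open>N u = \<Sum>n\<^sub>j v\<^sub>j\<close> with integers \<open>N\<close>,
\<open>n\<^sub>j\<close> that are twice a minor, and \<open>|N| + \<Sum>|n\<^sub>j| \<le> 4\<close> by \<open>minors_sum\<close>.
As all entries are \<open>\<plusminus>1/2\<close>, with one or two terms \<open>u\<close> is proportional to some
\<open>v\<^sub>j\<close>. So there are three terms, and their coefficients and \<open>N\<close> are
\<open>\<plusminus>1\<close>.\<close>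

lemma combination_of_three:
  assumes J: "J \<subseteq> R" "J \<noteq> {}" and v: "\<And>j. j \<in> J \<Longrightarrow> v j \<in> V" and u: "u \<in> V"
    and nz: "minor m J v \<noteq> 0"
    and span: "\<And>i. i \<in> R \<Longrightarrow> minor m J v * u i = (\<Sum>j\<in>J. minor m J (v(j := u)) * v j i)"
    and new: "\<And>j. j \<in> J \<Longrightarrow> u \<noteq> v j \<and> u \<noteq> (\<lambda>i. - v j i)"
  shows "\<bar>minor m J v\<bar> = 1/2" "\<And>j. j \<in> J \<Longrightarrow> \<bar>minor m J (v(j := u))\<bar> \<in> {0, 1/2}"
    "card {j\<in>J. minor m J (v(j := u)) \<noteq> 0} = 3"
proof -
  have Jm: "J \<subseteq> {..<m}" and fin: "finite J" using J R finite_subset[of J "{..<m}"] by auto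
  have "\<exists>N::int. 2 * minor m J v = of_int N"
    using minor_half_Ints[OF J, of v] v by (auto elim: Ints_cases)
  then obtain N :: int where N: "2 * minor m J v = of_int N" by blast
  have "\<exists>n::int. 2 * minor m J (v(j := u)) = of_int n" if "j \<in> J" for j
  proof -
    have "(v(j := u)) l \<in> V" if "l \<in> J" for l using v[OF that] u by auto
    then have "2 * minor m J (v(j := u)) \<in> \<int>" by (intro minor_half_Ints[OF J])
    then show ?thesis by (elim Ints_cases) blast
  qed
  then have "\<forall>j\<in>J. \<exists>n::int. 2 * minor m J (v(j := u)) = of_int n" by blast
  from bchoice[OF this] obtain n :: "nat \<Rightarrow> int" where "\<forall>j\<in>J. 2 * minor m J (v(j := u)) = of_int (n j)" by blast
  then have n': "2 * minor m J (v(j := u)) = of_int (n j)" if "j \<in> J" for j using that by blast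
  define D where "D j = minor m J (v(j := u))" for j
  note n = n'[folded D_def] and span = span[folded D_def]
  define T where "T = {j\<in>J. n j \<noteq> 0}"
  have finT: "finite T" and TJ: "T \<subseteq> J" using fin by (auto simp: T_def)
  have comb: "of_int N * u i = (\<Sum>j\<in>T. of_int (n j) * v j i)" if "i \<in> R" for i
  proof -
    have "of_int N * u i = (\<Sum>j\<in>J. 2 * D j * v j i)"
      unfolding N[symmetric] using span[OF that] by (simp add: sum_distrib_left mult.assoc)
    also have "\<dots> = (\<Sum>j\<in>J. of_int (n j) * v j i)" using n by (intro sum.cong) auto
    also have "\<dots> = (\<Sum>j\<in>T. of_int (n j) * v j i)"
      by (rule sum.mono_neutral_right) (use fin in \<open>auto simp: T_def\<close>)
    finally show ?thesis .
  qed
  have bound: "\<bar>N\<bar> + (\<Sum>j\<in>T. \<bar>n j\<bar>) \<le> 4"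
  proof -
    have "(\<Sum>j\<in>J. \<bar>D j\<bar>) = (\<Sum>j\<in>J. real_of_int \<bar>n j\<bar> / 2)"
    proof (rule sum.cong[OF refl])
      fix j assume "j \<in> J"
      then have "D j = of_int (n j) / 2" using n by force
      then show "\<bar>D j\<bar> = real_of_int \<bar>n j\<bar> / 2" by simp
    qed
    also have "\<dots> = (\<Sum>j\<in>T. real_of_int \<bar>n j\<bar> / 2)"
      by (rule sum.mono_neutral_right) (use fin in \<open>auto simp: T_def\<close>)
    also have "\<dots> = real_of_int (\<Sum>j\<in>T. \<bar>n j\<bar>) / 2" by (simp add: sum_divide_distrib)
    finally have D: "(\<Sum>j\<in>J. \<bar>D j\<bar>) = real_of_int (\<Sum>j\<in>T. \<bar>n j\<bar>) / 2" .
    have "\<bar>minor m J v\<bar> + (\<Sum>j\<in>J. \<bar>D j\<bar>) \<le> 2"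
      using minors_sum[of J v u, OF J(1) _ u] v unfolding D_def by blast
    moreover have "minor m J v = of_int N / 2" using N by simp
    ultimately have "real_of_int \<bar>N\<bar> / 2 + real_of_int (\<Sum>j\<in>T. \<bar>n j\<bar>) / 2 \<le> 2"
      using D by simp
    then have "real_of_int (\<bar>N\<bar> + (\<Sum>j\<in>T. \<bar>n j\<bar>)) \<le> 4" by simp
    then show ?thesis by linarith
  qed
  have N0: "N \<noteq> 0" using N nz by auto
  have n1: "\<bar>n j\<bar> \<ge> 1" if "j \<in> T" for j using that by (auto simp: T_def)
  have no_multiple: False if "j \<in> J" "\<And>i. i \<in> R \<Longrightarrow> u i = c * v j i" for j c
    using proportional_eq_or_uminus[OF u v[OF that(1)] that(2)] new[OF that(1)] by blast
  obtain r where r: "r \<in> R" using J by blast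
  have "int (card T) \<le> (\<Sum>j\<in>T. \<bar>n j\<bar>)" using sum_mono[of T "\<lambda>_. 1" "\<lambda>j. \<bar>n j\<bar>"] n1 by simp
  then have "card T \<le> 3" using bound N0 by linarith
  moreover have "card T \<noteq> 0"
  proof
    assume "card T = 0"
    then have "of_int N * u r = 0" using comb[OF r] finT by simp
    then show False using N0 half[OF u r] by simp
  qed
  moreover have "card T \<noteq> 1"
  proof
    assume "card T = 1"
    then obtain j where j: "T = {j}" by (auto simp: card_1_singleton_iff)
    have "u i = of_int (n j) / of_int N * v j i" if "i \<in> R" for i
      using comb[OF that] N0 by (simp add: j field_simps)
    then show False using no_multiple j TJ by blast
  qed
  moreover have "card T \<noteq> 2"
  proof
    assume "card T = 2"
    then obtain j k where jk: "T = {j, k}" "j \<noteq> k" by (auto simp: card_2_iff)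
    have jkJ: "j \<in> J" "k \<in> J" using jk TJ by auto
    have c: "of_int N * u i = of_int (n j) * v j i + of_int (n k) * v k i" if "i \<in> R" for i
      using comb[OF that] jk by simp
    have b: "\<bar>N\<bar> + \<bar>n j\<bar> + \<bar>n k\<bar> \<le> 4" "\<bar>n j\<bar> \<ge> 1" "\<bar>n k\<bar> \<ge> 1" using bound n1 jk by auto
    have hj: "\<bar>v j i\<bar> = 1/2" and hk: "\<bar>v k i\<bar> = 1/2" and hu: "\<bar>u i\<bar> = 1/2" if "i \<in> R" for i
      using half[OF v[OF jkJ(1)] that] half[OF v[OF jkJ(2)] that] half[OF u that] by auto
    have cases: "\<bar>N\<bar> = 2 \<and> \<bar>n j\<bar> = 1 \<and> \<bar>n k\<bar> = 1 \<or> \<bar>N\<bar> = 1 \<and> \<bar>n j\<bar> = 2 \<and> \<bar>n k\<bar> = 1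
      \<or> \<bar>N\<bar> = 1 \<and> \<bar>n j\<bar> = 1 \<and> \<bar>n k\<bar> = 2"
    proof -
      have "\<exists>a::int. 2 * u r = of_int a \<and> (a = 1 \<or> a = -1)" "\<exists>a::int. 2 * v j r = of_int a \<and> (a = 1 \<or> a = -1)"
        "\<exists>a::int. 2 * v k r = of_int a \<and> (a = 1 \<or> a = -1)"
        using hj[OF r] hk[OF r] hu[OF r] unfolding abs_eq_half
        by (auto intro: exI[of _ "1::int"] exI[of _ "-1::int"])
      then obtain a a' a'' :: int where a: "2 * u r = of_int a" "a = 1 \<or> a = -1"
        "2 * v j r = of_int a'" "a' = 1 \<or> a' = -1" "2 * v k r = of_int a''" "a'' = 1 \<or> a'' = -1" by auto
      have "of_int N * (2 * u r) = of_int (n j) * (2 * v j r) + of_int (n k) * (2 * v k r)"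
        using c[OF r] by simp
      then have "real_of_int (N * a) = real_of_int (n j * a' + n k * a'')" unfolding a by simp
      then have "N * a = n j * a' + n k * a''" by linarith
      \<comment> \<open>Modulo 2 the signs do not matter, so the sum of the absolute values is even, hence equal to 4.\<close>
      then have "even (N + n j + n k)" using a by auto presburger+
      then have "even (\<bar>N\<bar> + \<bar>n j\<bar> + \<bar>n k\<bar>)" by simp
      moreover have "\<bar>N\<bar> \<ge> 1" using N0 by simp
      ultimately show ?thesis using b by presburger
    qed
    have two: "\<bar>P\<bar> = 1/2 \<Longrightarrow> \<bar>Q\<bar> = 1 \<Longrightarrow> \<bar>S\<bar> = 1/2 \<Longrightarrow> P = Q + S \<Longrightarrow> P = - S" for P Q S :: real
      by (auto simp: abs_if split: if_splits)
    have one: "\<bar>P\<bar> = 1 \<Longrightarrow> \<bar>Q\<bar> = 1/2 \<Longrightarrow> \<bar>S\<bar> = 1/2 \<Longrightarrow> P = Q + S \<Longrightarrow> P = 2 * Q" for P Q S :: real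
      by (auto simp: abs_if split: if_splits)
    from cases show False
    proof (elim disjE)
      assume h: "\<bar>N\<bar> = 2 \<and> \<bar>n j\<bar> = 1 \<and> \<bar>n k\<bar> = 1"
      have "of_int N * u i = 2 * (of_int (n j) * v j i)" if "i \<in> R" for i
        by (rule one[OF _ _ _ c[OF that]])
           (use h hu[OF that] hj[OF that] hk[OF that] in \<open>simp_all add: abs_mult flip: of_int_abs\<close>)
      then have "u i = 2 * of_int (n j) / of_int N * v j i" if "i \<in> R" for i
        using that N0 by (simp add: field_simps)
      then show False using no_multiple[OF jkJ(1)] by blast
    next
      assume h: "\<bar>N\<bar> = 1 \<and> \<bar>n j\<bar> = 2 \<and> \<bar>n k\<bar> = 1"
      have "of_int N * u i = - (of_int (n k) * v k i)" if "i \<in> R" for i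
        by (rule two[OF _ _ _ c[OF that]])
           (use h hu[OF that] hj[OF that] hk[OF that] in \<open>simp_all add: abs_mult flip: of_int_abs\<close>)
      then have "u i = - of_int (n k) / of_int N * v k i" if "i \<in> R" for i
        using that N0 by (simp add: field_simps)
      then show False using no_multiple[OF jkJ(2)] by blast
    next
      assume h: "\<bar>N\<bar> = 1 \<and> \<bar>n j\<bar> = 1 \<and> \<bar>n k\<bar> = 2"
      have c': "of_int N * u i = of_int (n k) * v k i + of_int (n j) * v j i" if "i \<in> R" for i
        using c[OF that] by simp
      have "of_int N * u i = - (of_int (n j) * v j i)" if "i \<in> R" for i
        by (rule two[OF _ _ _ c'[OF that]])
           (use h hu[OF that] hj[OF that] hk[OF that] in \<open>simp_all add: abs_mult flip: of_int_abs\<close>)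
      then have "u i = - of_int (n j) / of_int N * v j i" if "i \<in> R" for i
        using that N0 by (simp add: field_simps)
      then show False using no_multiple[OF jkJ(1)] by blast
    qed
  qed
  ultimately have T3: "card T = 3" by linarith
  have "(\<Sum>j\<in>T. \<bar>n j\<bar> - 1) = (\<Sum>j\<in>T. \<bar>n j\<bar>) - 3" using T3 by (simp add: sum_subtractf)
  then have s0: "(\<Sum>j\<in>T. \<bar>n j\<bar> - 1) + \<bar>N\<bar> \<le> 1" using bound by linarith
  have "(\<Sum>j\<in>T. \<bar>n j\<bar> - 1) \<ge> 0" by (rule sum_nonneg) (use n1 in force)
  then have N1: "\<bar>N\<bar> = 1" and "(\<Sum>j\<in>T. \<bar>n j\<bar> - 1) = 0" using s0 N0 by linarith+
  then have nT: "\<bar>n j\<bar> = 1" if "j \<in> T" for j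
    using sum_nonneg_eq_0_iff[OF finT, of "\<lambda>j. \<bar>n j\<bar> - 1"] n1 that by fastforce
  show "\<bar>minor m J v\<bar> = 1/2" using N N1 by auto
  show "\<bar>minor m J (v(j := u))\<bar> \<in> {0, 1/2}" if "j \<in> J" for j
    using n[OF that] nT[of j] that unfolding D_def[symmetric] by (cases "n j = 0") (auto simp: T_def)
  have "{j\<in>J. minor m J (v(j := u)) \<noteq> 0} = T"
    using n unfolding T_def D_def[symmetric] by force
  then show "card {j\<in>J. minor m J (v(j := u)) \<noteq> 0} = 3" using T3 by simp
qed

text \<open>Fix a maximal basis \<open>f\<close> among the vectors. At most \<open>2 |J|\<close> of the vectors are basis vectors
up to sign. Every other \<open>u\<close> is a signed sum of three basis vectors with indices \<open>T u\<close>. If \<open>T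
u\<close> and \<open>T w\<close> share an index \<open>a\<close>, then \<open>w\<close> is also a combination of three vectors of
the basis in which \<open>u\<close> replaces \<open>f a\<close>; comparing coefficients shows that \<open>T u\<close> and \<open>T
w\<close> share exactly two indices unless \<open>w = \<plusminus>u\<close>. So oddtown applies, and each set \<open>T u\<close>
belongs to at most two vectors.\<close>

lemma card_le: "card V \<le> 4 * card R + 1"
proof (cases "R = {}")
  case True
  then have "V \<subseteq> {\<lambda>i. 0}" using supp by blast
  then have "card V \<le> 1" using card_mono[of "{\<lambda>i. 0}" V] by simp
  then show ?thesis by simp
next
  case False
  then obtain r where r: "r \<in> R" by blast
  obtain J f where J: "J \<subseteq> R" and f: "\<forall>j\<in>J. f j \<in> V" and nz: "minor m J f \<noteq> 0"
    and span': "\<forall>g. (\<forall>j\<in>J. g j \<in> V) \<longrightarrow>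
      (\<forall>u\<in>V. \<forall>i\<in>R. minor m J g * u i = (\<Sum>j\<in>J. minor m J (g(j := u)) * g j i))"
    by (rule maximal_minor[OF R, of V])
  have span: "minor m J g * u i = (\<Sum>j\<in>J. minor m J (g(j := u)) * g j i)"
    if "\<And>j. j \<in> J \<Longrightarrow> g j \<in> V" "u \<in> V" "i \<in> R" for g u i
    using span'[rule_format, of g u i] that by blast
  have finR: "finite R" using R finite_subset by blast
  have Jm: "J \<subseteq> {..<m}" and fin: "finite J" using J R finR finite_subset[of J R] by auto
  define M where "M = minor m J f"
  define D where "D u j = minor m J (f(j := u))" for u j
  define old where "old = {u\<in>V. \<exists>j\<in>J. u = f j \<or> u = (\<lambda>i. - f j i)}"
  define T where "T u = {j\<in>J. D u j \<noteq> 0}" for u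
  have TJ: "T u \<subseteq> J" and finT: "finite (T u)" for u using fin by (auto simp: T_def)
  have ne: "J \<noteq> {}" if "u \<in> V" for u
  proof
    assume "J = {}"
    then have "u r = 0" using span[of f u r] that r by simp
    then show False using half[OF that r] by simp
  qed
  have new: "\<bar>M\<bar> = 1/2" "\<And>j. j \<in> J \<Longrightarrow> \<bar>D u j\<bar> \<in> {0, 1/2}" "card (T u) = 3" if u: "u \<in> V - old" for u
  proof -
    have uV: "u \<in> V" and un: "\<And>j. j \<in> J \<Longrightarrow> u \<noteq> f j \<and> u \<noteq> (\<lambda>i. - f j i)" using u by (auto simp: old_def)
    have fV: "\<And>j. j \<in> J \<Longrightarrow> f j \<in> V" using f by blast
    note F = combination_of_three[of J f u, OF J ne[OF uV] fV uV nz span[OF fV uV] un]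
    show "\<bar>M\<bar> = 1/2" unfolding M_def by (rule F(1))
    show "\<And>j. j \<in> J \<Longrightarrow> \<bar>D u j\<bar> \<in> {0, 1/2}" unfolding D_def by (rule F(2))
    show "card (T u) = 3" unfolding T_def D_def by (rule F(3))
  qed
  have pair: "card (T u \<inter> T w) = 0 \<or> card (T u \<inter> T w) = 2"
    if u: "u \<in> V - old" and w: "w \<in> V - old" and uw: "w \<noteq> u" "w \<noteq> (\<lambda>i. - u i)" for u w
  proof (cases "T u \<inter> T w = {}")
    case False
    then obtain a where a: "a \<in> T u" "a \<in> T w" by blast
    have aJ: "a \<in> J" using a TJ by blast
    define g where "g = f(a := u)"
    have gV: "g j \<in> V" if "j \<in> J" for j using f that u by (auto simp: g_def)
    have gnz: "minor m J g \<noteq> 0" using a by (auto simp: g_def T_def D_def)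
    have wn: "w \<noteq> g j \<and> w \<noteq> (\<lambda>i. - g j i)" if "j \<in> J" for j
      using that w uw by (cases "j = a") (auto simp: g_def old_def)
    have uV: "u \<in> V" "w \<in> V" using u w by auto
    note F = combination_of_three[of J g w, OF J ne[OF uV(1)] gV uV(2) gnz span[OF gV uV(2)] wn]
    define X where "X j = minor m J (g(j := w))" for j
    have Xa: "X a = D w a" by (simp add: X_def g_def D_def)
    \<comment> \<open>Coefficients of \<open>w\<close> in the exchanged basis, as two-by-two determinants of the old ones.\<close>
    have Xj: "M * X j = D u a * D w j - D u j * D w a" if j: "j \<in> J" "j \<noteq> a" for j
    proof -
      have "M * minor m J (g(j := w)) = minor m J (g(j := \<lambda>i. M * w i))"
        using minor_add[OF Jm j(1), of "\<lambda>i. M * w i" M w 0 w g] by simp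
      also have "\<dots> = (\<Sum>l\<in>J. D w l * minor m J (g(j := f l)))"
        by (rule minor_sum[OF Jm j(1)])
           (use span[of f w] f uV J in \<open>auto simp: M_def D_def\<close>)
      also have "\<dots> = (\<Sum>l\<in>J. (if l = j then D w j * D u a else 0) + (if l = a then - (D w a * D u j) else 0))"
      proof (rule sum.cong[OF refl])
        fix l assume l: "l \<in> J"
        consider "l = j" | "l = a" | "l \<noteq> j" "l \<noteq> a" by blast
        then show "D w l * minor m J (g(j := f l))
            = (if l = j then D w j * D u a else 0) + (if l = a then - (D w a * D u j) else 0)"
        proof cases
          case 1
          have "g(j := f j) = f(a := u)" using j by (auto simp: g_def)
          then have "minor m J (g(j := f j)) = D u a" unfolding D_def by (simp only:)
          then show ?thesis using 1 j by simp
        next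
          case 2
          have "minor m J (g(j := f a)) = - minor m J (f(a := f a, j := u))"
            unfolding g_def by (rule minor_swap[OF Jm aJ j(1)]) (use j in auto)
          then have "minor m J (g(j := f a)) = - D u j" by (simp add: D_def)
          then show ?thesis using 2 j by simp
        next
          case 3
          have "minor m J (g(j := f l)) = 0"
            by (rule minor_equal_columns[OF Jm j(1) l]) (use 3 in \<open>auto simp: g_def\<close>)
          then show ?thesis using 3 by simp
        qed
      qed
      also have "\<dots> = D w j * D u a - D w a * D u j"
        using fin j aJ by (simp add: sum.distrib)
      finally show ?thesis by (simp add: X_def mult.commute)
    qed
    have X3: "card {j\<in>J. X j \<noteq> 0} = 3" unfolding X_def by (rule F(3))
    have Xhalf: "\<bar>X j\<bar> \<in> {0, 1/2}" if "j \<in> J" for j unfolding X_def by (rule F(2)) (use that in auto)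
    have M0: "\<bar>M\<bar> = 1/2" by (rule new(1)[OF u])
    have sub: "insert a ((T u - T w) \<union> (T w - T u)) \<subseteq> {j\<in>J. X j \<noteq> 0}"
    proof
      fix j assume "j \<in> insert a ((T u - T w) \<union> (T w - T u))"
      then consider "j = a" | "j \<in> T u - T w" | "j \<in> T w - T u" by blast
      then show "j \<in> {j\<in>J. X j \<noteq> 0}"
      proof cases
        case 1
        then show ?thesis using a Xa aJ by (auto simp: T_def)
      next
        case 2
        then have "j \<in> J" "j \<noteq> a" "D w j = 0" "D u j \<noteq> 0" "D w a \<noteq> 0" using a by (auto simp: T_def)
        then show ?thesis using Xj[of j] by auto
      next
        case 3
        then have "j \<in> J" "j \<noteq> a" "D u j = 0" "D w j \<noteq> 0" "D u a \<noteq> 0" using a by (auto simp: T_def)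
        then show ?thesis using Xj[of j] by auto
      qed
    qed
    have "card (insert a ((T u - T w) \<union> (T w - T u))) \<le> 3"
      using card_mono[OF _ sub] fin X3 by simp
    moreover have "card (insert a ((T u - T w) \<union> (T w - T u))) = 1 + (card (T u - T w) + card (T w - T u))"
    proof -
      have "card ((T u - T w) \<union> (T w - T u)) = card (T u - T w) + card (T w - T u)"
        by (rule card_Un_disjoint) (use finT in auto)
      then show ?thesis using a finT by simp
    qed
    moreover have "card (T u - T w) = 3 - card (T u \<inter> T w)" "card (T w - T u) = 3 - card (T u \<inter> T w)"
      using new(3)[OF u] new(3)[OF w] finT card_Diff_subset_Int[of "T u" "T w"] card_Diff_subset_Int[of "T w" "T u"]
      by (auto simp: Int_commute)
    moreover have "card (T u \<inter> T w) \<le> 3" using card_mono[of "T u" "T u \<inter> T w"] new(3)[OF u] finT by simp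
    moreover have "card (T u \<inter> T w) \<noteq> 3"
    proof
      assume c: "card (T u \<inter> T w) = 3"
      have "T u \<inter> T w = T u" by (rule card_subset_eq) (use finT c new(3)[OF u] in auto)
      moreover have "T u \<inter> T w = T w" by (rule card_subset_eq) (use finT c new(3)[OF w] in auto)
      ultimately have Teq: "T u = T w" by simp
      have "{j\<in>J. X j \<noteq> 0} \<noteq> {a}"
      proof
        assume "{j\<in>J. X j \<noteq> 0} = {a}"
        then show False using X3 by simp
      qed
      then obtain j where j: "j \<in> J" "j \<noteq> a" "X j \<noteq> 0" using sub by blast
      have Dj: "\<bar>D u j\<bar> \<in> {0, 1/2}" "\<bar>D w j\<bar> \<in> {0, 1/2}" using new(2)[OF u j(1)] new(2)[OF w j(1)] by auto
      have Da: "\<bar>D u a\<bar> = 1/2" "\<bar>D w a\<bar> = 1/2"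
        using new(2)[OF u aJ] new(2)[OF w aJ] a by (auto simp: T_def)
      have "D u j = 0 \<longleftrightarrow> D w j = 0" using Teq j(1) by (auto simp: T_def)
      then have Dj': "\<bar>D u j\<bar> = 1/2" "\<bar>D w j\<bar> = 1/2" using Dj Xj[OF j(1,2)] j(3) M0 by auto
      have "\<bar>D u a * D w j\<bar> = 1/4" "\<bar>D u j * D w a\<bar> = 1/4" by (simp_all add: abs_mult Da Dj')
      then have "\<bar>D u a * D w j - D u j * D w a\<bar> = 0 \<or> \<bar>D u a * D w j - D u j * D w a\<bar> = 1/2" by linarith
      then have "\<bar>M * X j\<bar> = 0 \<or> \<bar>M * X j\<bar> = 1/2" using Xj[OF j(1,2)] by simp
      moreover have "\<bar>M * X j\<bar> = \<bar>X j\<bar> / 2" by (simp add: abs_mult M0)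
      ultimately show False using Xhalf[OF j(1)] j(3) by auto
    qed
    ultimately show ?thesis by linarith
  qed simp
  have fibre: "w = u \<or> w = (\<lambda>i. - u i)" if "u \<in> V - old" "w \<in> V - old" "T u = T w" for u w
    using pair[OF that(1,2)] that new(3) by (auto)
  have "card (T ` (V - old)) \<le> card J"
  proof (rule oddtown[OF fin])
    show "T ` (V - old) \<subseteq> Pow J" using TJ by blast
    show "odd (card S)" if "S \<in> T ` (V - old)" for S using that new(3) by auto
    show "even (card (S \<inter> S'))" if S: "S \<in> T ` (V - old)" "S' \<in> T ` (V - old)" "S \<noteq> S'" for S S'
    proof -
      obtain u w where uw: "u \<in> V - old" "w \<in> V - old" "S = T u" "S' = T w" using S by blast
      have "D (\<lambda>i. - u i) j = - D u j" if "j \<in> J" for j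
        unfolding D_def using minor_add[OF Jm that, of "\<lambda>i. - u i" "-1" u 0 u f] by simp
      then have "T (\<lambda>i. - u i) = T u" by (auto simp: T_def)
      then have "w \<noteq> u" "w \<noteq> (\<lambda>i. - u i)" using S(3) uw by auto
      then show ?thesis using pair[OF uw(1,2)] uw by auto
    qed
  qed
  moreover have "card (V - old) \<le> 2 * card (T ` (V - old))"
  proof -
    have fV: "finite (V - old)" using finV by simp
    have "V - old = (\<Union>S\<in>T ` (V - old). {u\<in>V - old. T u = S})" by blast
    then have "card (V - old) \<le> (\<Sum>S\<in>T ` (V - old). card {u\<in>V - old. T u = S})"
      using card_UN_le[of "T ` (V - old)" "\<lambda>S. {u\<in>V - old. T u = S}"] fV by simp
    also have "\<dots> \<le> (\<Sum>S\<in>T ` (V - old). 2)"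
    proof (rule sum_mono)
      fix S assume "S \<in> T ` (V - old)"
      then obtain u where u: "u \<in> V - old" "S = T u" by blast
      have "{w\<in>V - old. T w = S} \<subseteq> {u, \<lambda>i. - u i}" using fibre[OF u(1)] u(2) by auto
      then have "card {w\<in>V - old. T w = S} \<le> card {u, \<lambda>i. - u i}" by (intro card_mono) auto
      also have "\<dots> \<le> 2" by (simp add: card_insert_le_m1)
      finally show "card {w\<in>V - old. T w = S} \<le> 2" .
    qed
    finally show ?thesis by simp
  qed
  moreover have "card old \<le> 2 * card J"
  proof -
    have "old \<subseteq> f ` J \<union> (\<lambda>j i. - f j i) ` J" by (auto simp: old_def)
    then have "card old \<le> card (f ` J \<union> (\<lambda>j i. - f j i) ` J)" using fin by (intro card_mono) auto
    also have "\<dots> \<le> card (f ` J) + card ((\<lambda>j i. - f j i) ` J)" by (rule card_Un_le)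
    also have "\<dots> \<le> card J + card J" using fin by (intro add_mono card_image_le)
    finally show ?thesis by simp
  qed
  moreover have "card V = card old + card (V - old)"
    using card_Un_disjoint[of old "V - old"] finV by (auto simp: old_def Un_absorb1)
  moreover have "card J \<le> card R" using J finR by (rule card_mono[rotated])
  ultimately show ?thesis by linarith
qed

end

section \<open>Counting a class by deleting rows\<close>

definition drop_rows :: "nat set \<Rightarrow> (nat \<Rightarrow> real) \<Rightarrow> nat \<Rightarrow> real" where
  "drop_rows R v i = (if i \<in> R then v i else 0)"

text \<open>Over such a vector, \<open>X\<close> contains both entries \<open>a\<close> and \<open>a + d\<close> in row
\<open>x\<close>, and one of them is lost when the row is deleted. The entry in row \<open>x\<close> is set to 0 to obtain a
family in the remaining rows.\<close>

definition layer :: "nat \<Rightarrow> real \<Rightarrow> real \<Rightarrow> (nat \<Rightarrow> real) set \<Rightarrow> (nat \<Rightarrow> real) set" where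
  "layer x a d X = {v. v x = 0 \<and> v(x := a) \<in> X \<and> v(x := a + d) \<in> X}"

definition lift :: "nat \<Rightarrow> real \<Rightarrow> real \<Rightarrow> (nat \<Rightarrow> real) set \<Rightarrow> (nat \<Rightarrow> real) set" where
  "lift x a d V = {v(x := p) |v p. v \<in> V \<and> p \<in> {a, a + d}}"

text \<open>The rows in \<open>R\<close> have prescribed fractional parts, given by \<open>t\<close>.\<close>

definition in_coset :: "nat set \<Rightarrow> (nat \<Rightarrow> real) \<Rightarrow> (nat \<Rightarrow> real) set \<Rightarrow> bool" where
  "in_coset R t X \<longleftrightarrow> (\<forall>v\<in>X. (\<forall>i\<in>R. v i - t i \<in> \<int>) \<and> (\<forall>i. i \<notin> R \<longrightarrow> v i = 0))"

lemma finite_layer: "finite X \<Longrightarrow> finite (layer x a d X)"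
proof -
  assume "finite X"
  moreover have "layer x a d X \<subseteq> (\<lambda>v. v(x := 0)) ` X"
  proof
    fix v assume "v \<in> layer x a d X"
    then have "v(x := a) \<in> X" "v = (v(x := a))(x := 0)" by (auto simp: layer_def fun_eq_iff)
    then show "v \<in> (\<lambda>v. v(x := 0)) ` X" by blast
  qed
  ultimately show ?thesis using finite_surj by blast
qed

text \<open>Vectors that agree outside row \<open>x\<close> are identified when this row is deleted. If every fibre has at most
one element more than it contains pairs from \<open>P\<close>, the pairs account for the loss.\<close>

lemma fibre_count:
  assumes X: "finite X" "\<And>v i. v \<in> X \<Longrightarrow> i \<notin> insert x R \<Longrightarrow> v i = 0" and x: "x \<notin> R" and P: "finite P"
    and fib: "\<And>v. v x = 0 \<Longrightarrow> card {p. v(x := p) \<in> X} \<le> 1 + card {(a, d) \<in> P. v(x := a) \<in> X \<and> v(x := a + d) \<in> X}"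
  shows "card X \<le> card (drop_rows R ` X) + (\<Sum>(a, d)\<in>P. card (layer x a d X))"
proof -
  let ?Q = "\<lambda>v r. v(x := fst r) \<in> X \<and> v(x := fst r + snd r) \<in> X"
  have fib': "card {p. v(x := p) \<in> X} \<le> 1 + card {r \<in> P. ?Q v r}" if "v x = 0" for v
  proof -
    have "{(a, d) \<in> P. v(x := a) \<in> X \<and> v(x := a + d) \<in> X} = {r \<in> P. ?Q v r}" by auto
    then show ?thesis using fib[of v] that by simp
  qed
  have restore: "(drop_rows R v)(x := v x) = v" if "v \<in> X" for v
    using X(2)[OF that] x by (auto simp: drop_rows_def)
  have zero: "v x = 0" if "v \<in> drop_rows R ` X" for v using that x by (auto simp: drop_rows_def)
  have finp: "finite {p. v(x := p) \<in> X}" for v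
  proof -
    have "{p. v(x := p) \<in> X} \<subseteq> (\<lambda>w. w x) ` X"
    proof
      fix p assume "p \<in> {p. v(x := p) \<in> X}"
      then show "p \<in> (\<lambda>w. w x) ` X" by (intro image_eqI[of _ _ "v(x := p)"]) auto
    qed
    then show ?thesis using X(1) finite_surj by blast
  qed
  have "X \<subseteq> (\<lambda>(v, p). v(x := p)) ` (SIGMA v:drop_rows R ` X. {p. v(x := p) \<in> X})"
  proof
    fix v assume v: "v \<in> X"
    then have "(drop_rows R v, v x) \<in> (SIGMA v:drop_rows R ` X. {p. v(x := p) \<in> X})"
      using restore[OF v] by auto
    then show "v \<in> (\<lambda>(v, p). v(x := p)) ` (SIGMA v:drop_rows R ` X. {p. v(x := p) \<in> X})"
      by (rule rev_image_eqI) (simp add: restore[OF v])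
  qed
  moreover have fin: "finite (SIGMA v:drop_rows R ` X. {p. v(x := p) \<in> X})"
    using X(1) finp by (intro finite_SigmaI) auto
  ultimately have "card X \<le> card (SIGMA v:drop_rows R ` X. {p. v(x := p) \<in> X})"
    by (rule surj_card_le[rotated])
  also have "\<dots> = (\<Sum>v\<in>drop_rows R ` X. card {p. v(x := p) \<in> X})"
    using X(1) finp by (intro card_SigmaI) auto
  also have "\<dots> \<le> (\<Sum>v\<in>drop_rows R ` X. 1 + card {r \<in> P. ?Q v r})"
    by (intro sum_mono fib' zero)
  also have "\<dots> = card (drop_rows R ` X) + (\<Sum>v\<in>drop_rows R ` X. card {r \<in> P. ?Q v r})"
    by (simp only: sum.distrib sum_constant mult_1_right of_nat_id)
  also have "(\<Sum>v\<in>drop_rows R ` X. card {r \<in> P. ?Q v r})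
      = (\<Sum>v\<in>drop_rows R ` X. \<Sum>r\<in>P. if ?Q v r then 1 else 0)"
    using P by (intro sum.cong refl) (simp only: card_eq_sum sum.inter_filter)
  also have "\<dots> = (\<Sum>r\<in>P. \<Sum>v\<in>drop_rows R ` X. if ?Q v r then 1 else 0)"
    by (rule sum.swap)
  also have "\<dots> = (\<Sum>r\<in>P. card {v\<in>drop_rows R ` X. ?Q v r})"
    using X(1) by (intro sum.cong refl) (simp only: card_eq_sum sum.inter_filter finite_imageI)
  also have "\<dots> \<le> (\<Sum>r\<in>P. card (layer x (fst r) (snd r) X))"
  proof (rule sum_mono)
    fix r
    show "card {v\<in>drop_rows R ` X. ?Q v r} \<le> card (layer x (fst r) (snd r) X)"
      by (rule card_mono) (use zero X(1) finite_layer in \<open>auto simp: layer_def\<close>)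
  qed
  finally show ?thesis by (simp add: case_prod_beta)
qed

text \<open>Pairs of a value and an increment, for entries in \<open>[-1, 1]\<close> with fractional part \<open>tau\<close>. In
the integral case the long jump from \<open>-1\<close> to \<open>1\<close> is needed for fibres that miss the value 0.\<close>

definition jumps :: "real \<Rightarrow> (real \<times> real) set" where
  "jumps tau = (if tau = 0 then {(-1, 1), (0, 1), (-1, 2)} else {(tau - 1, 1)})"

lemma finite_jumps [simp]: "finite (jumps tau)" by (simp add: jumps_def)

lemma coset_values:
  fixes tau p :: real
  assumes "0 \<le> tau" "tau < 1" "p - tau \<in> \<int>" "\<bar>p\<bar> \<le> 1"
  shows "p \<in> (if tau = 0 then {-1, 0, 1} else {tau - 1, tau})"
proof -
  obtain k :: int where k: "p - tau = of_int k" using assms(3) by (auto elim: Ints_cases)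
  have "real_of_int k \<le> 1" "real_of_int k > -3" using k assms by linarith+
  then have "k \<in> {-2, -1, 0, 1}" by (simp; linarith)
  then show ?thesis using k assms by auto
qed

lemma card_values_jumps:
  assumes tau: "0 \<le> tau" "tau < 1" and S: "\<And>p. p \<in> S \<Longrightarrow> p - tau \<in> \<int> \<and> \<bar>p\<bar> \<le> 1"
  shows "card S \<le> 1 + card {(a, d) \<in> jumps tau. a \<in> S \<and> a + d \<in> S}"
proof (cases "tau = 0")
  case False
  have sub: "S \<subseteq> {tau - 1, tau}"
  proof
    fix p assume "p \<in> S"
    then show "p \<in> {tau - 1, tau}" using coset_values[OF tau, of p] S[of p] False by simp
  qed
  show ?thesis
  proof (cases "S = {tau - 1, tau}")
    case True
    then have "{(a, d) \<in> jumps tau. a \<in> S \<and> a + d \<in> S} = {(tau - 1, 1)}"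
      using False by (auto simp: jumps_def)
    then show ?thesis using True by simp
  next
    case ne: False
    then have "S \<subset> {tau - 1, tau}" using sub by blast
    then have "card S < card {tau - 1, tau}" by (intro psubset_card_mono) auto
    then show ?thesis by simp
  qed
next
  case True
  have sub: "S \<subseteq> {-1, 0, 1}"
  proof
    fix p assume "p \<in> S"
    then show "p \<in> {-1, 0, 1}" using coset_values[OF tau, of p] S[of p] True by simp
  qed
  have eq: "{(a, d) \<in> jumps tau. a \<in> S \<and> a + d \<in> S} =
     (if -1 \<in> S \<and> 0 \<in> S then {(-1, 1)} else {}) \<union> (if 0 \<in> S \<and> 1 \<in> S then {(0, 1)} else {}) \<union>
     (if -1 \<in> S \<and> 1 \<in> S then {(-1, 2)} else {})"
    using True by (auto simp: jumps_def)
  have "card S = card (S \<inter> {-1, 0, 1})" using sub by (simp only: Int_absorb2)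
  then show ?thesis unfolding eq
    by (cases "-1 \<in> S"; cases "0 \<in> S"; cases "1 \<in> S") (simp_all add: Int_insert_right)
qed

lemma minor_singleton: "i < m \<Longrightarrow> minor m {i} f = f i i"
  using minor_insert[of "{}" m i f "f i"] by simp

lemma minor_pair:
  assumes "x < m" "y < m" "x \<noteq> y"
  shows "minor m {x, y} f = f x x * f y y - f y x * f x y"
proof -
  have "minor m (insert x {y}) (f(x := f x)) = f x x * minor m {y} f - (\<Sum>j\<in>{y}. f j x * minor m {y} (f(j := f x)))"
    by (rule minor_insert) (use assms in auto)
  moreover have "minor m {y} f = f y y" "minor m {y} (f(y := f x)) = f x y"
    using minor_singleton[OF assms(2), of f] minor_singleton[OF assms(2), of "f(y := f x)"] by simp_all
  ultimately show ?thesis by simp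
qed

lemma bounded_minors_subset:
  assumes "bounded_minors m R X" and R: "R \<subseteq> {..<m}" "R' \<subseteq> R" and X: "\<And>v. v \<in> X' \<Longrightarrow> \<exists>u\<in>X. \<forall>i\<in>R'. v i = u i"
  shows "bounded_minors m R' X'"
  unfolding bounded_minors_def
proof (intro allI impI)
  fix J f assume J: "J \<subseteq> R'" and f: "\<forall>j\<in>J. f j \<in> X'"
  have "\<forall>j\<in>J. \<exists>u. u \<in> X \<and> (\<forall>i\<in>R'. f j i = u i)"
  proof
    fix j assume "j \<in> J"
    then have "f j \<in> X'" using f by simp
    from X[OF this] show "\<exists>u. u \<in> X \<and> (\<forall>i\<in>R'. f j i = u i)" by auto
  qed
  from bchoice[OF this] obtain g where g: "\<forall>j\<in>J. g j \<in> X \<and> (\<forall>i\<in>R'. f j i = g j i)" by (elim exE)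
  have "minor m J f = minor m J g" by (rule minor_cong) (use g J R in auto)
  also have "\<bar>minor m J g\<bar> \<le> 1" by (rule bounded_minorsD[OF assms(1)]) (use g J R in auto)
  finally show "\<bar>minor m J f\<bar> \<le> 1" .
qed

lemma bounded_entry:
  assumes "bounded_minors m R X" "R \<subseteq> {..<m}" "v \<in> X" "i \<in> R"
  shows "\<bar>v i\<bar> \<le> 1"
  using bounded_minorsD[OF assms(1), of "{i}" "\<lambda>_. v"] assms minor_singleton[of i m "\<lambda>_. v"] by auto

lemma bounded_pair:
  assumes "bounded_minors m R X" "R \<subseteq> {..<m}" "v \<in> X" "w \<in> X" "x \<in> R" "y \<in> R" "x \<noteq> y"
  shows "\<bar>v x * w y - w x * v y\<bar> \<le> 1"
proof -
  have "\<bar>minor m {x, y} ((\<lambda>_. w)(x := v))\<bar> \<le> 1"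
    by (rule bounded_minorsD[OF assms(1)]) (use assms in auto)
  moreover have "x < m" "y < m" using assms by auto
  ultimately show ?thesis using minor_pair[of x m y "(\<lambda>_. w)(x := v)"] assms(7) by simp
qed

text \<open>The vectors in \<open>V\<close> may be given any of the entries \<open>a\<close> and \<open>a + d\<close> in the row
\<open>x\<close> without violating the bound on the minors. Layers have this property (\<open>doubled_layer\<close>).\<close>

definition doubled :: "nat \<Rightarrow> (nat \<Rightarrow> real) \<Rightarrow> nat \<Rightarrow> real \<Rightarrow> real \<Rightarrow> nat set \<Rightarrow> (nat \<Rightarrow> real) set \<Rightarrow> bool" where
  "doubled m t x a d R V \<longleftrightarrow> finite V \<and> in_coset R t V \<and> bounded_minors m (insert x R) (lift x a d V) \<and>
     R \<subseteq> {..<m} \<and> x < m \<and> x \<notin> R \<and> d > 0"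

lemma in_coset_drop: "in_coset R t X \<Longrightarrow> R' \<subseteq> R \<Longrightarrow> in_coset R' t (drop_rows R' ` X)"
  unfolding in_coset_def drop_rows_def by auto

lemma doubled_drop:
  assumes "doubled m t x a d (insert y R) V"
  shows "doubled m t x a d R (drop_rows R ` V)"
  unfolding doubled_def
proof (intro conjI)
  note V = assms[unfolded doubled_def]
  show "in_coset R t (drop_rows R ` V)" using V in_coset_drop by blast
  show "bounded_minors m (insert x R) (lift x a d (drop_rows R ` V))"
  proof (rule bounded_minors_subset[of m "insert x (insert y R)" "lift x a d V"])
    fix v assume "v \<in> lift x a d (drop_rows R ` V)"
    then obtain u p where "v = (drop_rows R u)(x := p)" "u \<in> V" "p \<in> {a, a + d}" by (auto simp: lift_def)
    then have "u(x := p) \<in> lift x a d V" "\<forall>i\<in>insert x R. v i = (u(x := p)) i"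
      by (auto simp: lift_def drop_rows_def)
    then show "\<exists>u\<in>lift x a d V. \<forall>i\<in>insert x R. v i = u i" by blast
  qed (use V in auto)
qed (use assms in \<open>auto simp: doubled_def\<close>)

lemma doubled_layer:
  assumes X: "finite X" "in_coset (insert x R) t X" "bounded_minors m (insert x R) X"
    and R: "R \<subseteq> {..<m}" "x < m" "x \<notin> R" and d: "d > 0"
  shows "doubled m t x a d R (layer x a d X)"
  unfolding doubled_def
proof (intro conjI)
  show "in_coset R t (layer x a d X)"
    unfolding in_coset_def
  proof (intro ballI conjI allI impI)
    fix v i assume v: "v \<in> layer x a d X"
    then have u: "v(x := a) \<in> X" "v x = 0" by (auto simp: layer_def)
    show "v i - t i \<in> \<int>" if "i \<in> R"
      using X(2)[unfolded in_coset_def, rule_format, OF u(1)] that R by (metis fun_upd_other insert_iff)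
    show "v i = 0" if "i \<notin> R"
      using X(2)[unfolded in_coset_def, rule_format, OF u(1)] that u(2) by (metis fun_upd_other insert_iff)
  qed
  show "bounded_minors m (insert x R) (lift x a d (layer x a d X))"
    by (rule bounded_minors_subset[OF X(3)]) (use R in \<open>auto simp: lift_def layer_def\<close>)
qed (use R d X finite_layer in auto)

text \<open>A layer of a doubled family is doubled in two directions.\<close>

lemma layer_card_eps:
  assumes V: "doubled m t x a d (insert y R) V" and y: "y \<notin> R" and e: "e > 0"
    and eps: "eps \<le> 1 - 1 / (d * e) + \<bar>a + d / 2\<bar> / d + \<bar>b + e / 2\<bar> / e" "eps > 0"
  shows "real (card (layer y b e V)) * eps \<le> 1"
proof (rule twice_doubled_card[where R = R and x = x and y = y and m = m and d = d and e = e and a = a and b = b, OF _ _ _ _ _ _ _ _ _ _ _ eps])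
  note V' = V[unfolded doubled_def]
  show "R \<subseteq> {..<m}" "x < m" "y < m" "x \<noteq> y" "x \<notin> R" "y \<notin> R" "0 < d" "0 < e" using V' y e by auto
  have in_V: "w(y := q) \<in> V" if "w \<in> layer y b e V" "q \<in> {b, b + e}" for w q using that by (auto simp: layer_def)
  show "bounded_minors m (insert x (insert y R))
     {w(x := p, y := q) |w p q. w \<in> layer y b e V \<and> p \<in> {a, a + d} \<and> q \<in> {b, b + e}}"
  proof (rule bounded_minors_subset[of m "insert x (insert y R)" "lift x a d V"])
    fix v assume "v \<in> {w(x := p, y := q) |w p q. w \<in> layer y b e V \<and> p \<in> {a, a + d} \<and> q \<in> {b, b + e}}"
    then obtain w p q where w: "v = w(x := p, y := q)" "w \<in> layer y b e V" "p \<in> {a, a + d}" "q \<in> {b, b + e}" by blast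
    have "v = (w(y := q))(x := p)" using w(1) V' by (auto simp: fun_upd_twist)
    then have "v \<in> lift x a d V" using in_V[OF w(2,4)] w(3) unfolding lift_def by blast
    then show "\<exists>u\<in>lift x a d V. \<forall>i\<in>insert x (insert y R). v i = u i" by blast
  qed (use V' in auto)
  have yin: "b \<in> {b, b + e}" by simp
  show "\<forall>w\<in>layer y b e V. \<forall>w'\<in>layer y b e V. \<forall>i\<in>R. w i - w' i \<in> \<int>"
  proof (intro ballI)
    fix w w' i assume w: "w \<in> layer y b e V" "w' \<in> layer y b e V" and i: "i \<in> R"
    have iy: "i \<noteq> y" using i y by blast
    have "(w(y := b)) i - t i \<in> \<int>" "(w'(y := b)) i - t i \<in> \<int>"
      using V' in_V[OF w(1) yin] in_V[OF w(2) yin] i unfolding in_coset_def by blast+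
    then have "w i - t i \<in> \<int>" "w' i - t i \<in> \<int>" using iy by simp_all
    then have "(w i - t i) - (w' i - t i) \<in> \<int>" by (rule Ints_diff)
    then show "w i - w' i \<in> \<int>" by simp
  qed
  show "w i = 0" if "w \<in> layer y b e V" "i \<notin> R" for w i
  proof (cases "i = y")
    case True
    then show ?thesis using that by (simp add: layer_def)
  next
    case False
    then have "(w(y := b)) i = 0" using V' in_V[OF that(1) yin] that(2) unfolding in_coset_def by blast
    then show ?thesis using False by simp
  qed
qed

lemma layer_card:
  assumes V: "doubled m t x a d (insert y R) V" and y: "y \<notin> R" and e: "e > 0" and n: "n > (0::nat)"
    and eps: "1 / real n \<le> 1 - 1 / (d * e) + \<bar>a + d / 2\<bar> / d + \<bar>b + e / 2\<bar> / e"
  shows "card (layer y b e V) \<le> n"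
proof -
  have "real (card (layer y b e V)) * (1 / real n) \<le> 1"
    by (rule layer_card_eps[OF V y e eps]) (use n in simp)
  then show ?thesis using n by (simp add: field_simps)
qed

lemma doubled_fibre:
  assumes V: "doubled m t x a d (insert y R) V" and y: "y \<notin> R" and tau: "0 \<le> t y" "t y < 1"
  shows "card V \<le> card (drop_rows R ` V) + (\<Sum>(b, e)\<in>jumps (t y). card (layer y b e V))"
proof (rule fibre_count[OF _ _ y])
  note V' = V[unfolded doubled_def]
  show "finite V" using V' by blast
  show "v i = 0" if "v \<in> V" "i \<notin> insert y R" for v i using V' that unfolding in_coset_def by blast
  show "card {p. v(y := p) \<in> V} \<le> 1 + card {(b, e) \<in> jumps (t y). v(y := b) \<in> V \<and> v(y := b + e) \<in> V}" for v
  proof -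
    have "p - t y \<in> \<int> \<and> \<bar>p\<bar> \<le> 1" if "p \<in> {p. v(y := p) \<in> V}" for p
    proof
      have p: "v(y := p) \<in> V" using that by simp
      then have "(v(y := p)) y - t y \<in> \<int>" using V' unfolding in_coset_def by blast
      then show "p - t y \<in> \<int>" by simp
      have "v(y := p, x := a) \<in> lift x a d V" using p unfolding lift_def by blast
      then have "\<bar>(v(y := p, x := a)) y\<bar> \<le> 1"
        using bounded_entry[of m "insert x (insert y R)" "lift x a d V" "v(y := p, x := a)" y] V' by auto
      then show "\<bar>p\<bar> \<le> 1" using V' by (auto split: if_splits)
    qed
    then show ?thesis using card_values_jumps[OF tau, of "{p. v(y := p) \<in> V}"] by simp
  qed
qed simp

text \<open>Deletes the rows in \<open>S\<close>, each at cost at most \<open>K\<close>, until only the rows in \<open>H\<close>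
are left.\<close>

lemma doubled_eliminate:
  assumes "finite S" "S \<inter> H = {}" "doubled m t x a d (S \<union> H) V" "\<forall>y\<in>S. 0 \<le> t y \<and> t y < 1"
    and base: "\<And>V. doubled m t x a d H V \<Longrightarrow> card V \<le> c"
    and cost: "\<And>y R V. y \<in> S \<Longrightarrow> y \<notin> R \<Longrightarrow> doubled m t x a d (insert y R) V \<Longrightarrow>
      (\<Sum>(b, e)\<in>jumps (t y). card (layer y b e V)) \<le> K"
  shows "card V \<le> c + K * card S"
  using assms(1-4) cost
proof (induction S arbitrary: V rule: finite_induct)
  case empty
  then show ?case using base by simp
next
  case (insert y S)
  have V: "doubled m t x a d (insert y (S \<union> H)) V" using insert.prems(2) by simp
  have y: "y \<notin> S \<union> H" using insert.hyps insert.prems(1) by blast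
  have ty: "0 \<le> t y" "t y < 1" using insert.prems(3) by auto
  have "card (drop_rows (S \<union> H) ` V) \<le> c + K * card S"
  proof (rule insert.IH)
    show "S \<inter> H = {}" "\<forall>y\<in>S. 0 \<le> t y \<and> t y < 1" using insert.prems by auto
    show "doubled m t x a d (S \<union> H) (drop_rows (S \<union> H) ` V)" by (rule doubled_drop[OF V])
    show "(\<Sum>(b, e)\<in>jumps (t y'). card (layer y' b e V')) \<le> K"
      if "y' \<in> S" "y' \<notin> R'" "doubled m t x a d (insert y' R') V'" for y' R' V'
      using insert.prems(4)[of y' R' V'] that by simp
  qed
  moreover have "(\<Sum>(b, e)\<in>jumps (t y). card (layer y b e V)) \<le> K"
    using insert.prems(4)[of y "S \<union> H" V] y V by simp
  ultimately have "card V \<le> c + K * card S + K" using doubled_fibre[OF V y ty] by linarith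
  then show ?case using insert.hyps by simp
qed

lemma doubled_no_rows:
  assumes "doubled m t x a d {} V"
  shows "card V \<le> 1"
proof -
  have "V \<subseteq> {\<lambda>_. 0}" using assms unfolding doubled_def in_coset_def by auto
  then show ?thesis using card_mono[of "{\<lambda>_. 0}" V] by simp
qed

text \<open>If \<open>tau\<close> has denominator dividing \<open>D\<close>, then \<open>tau - 1/2\<close> has denominator
dividing \<open>2 D\<close>.\<close>

lemma half_gap:
  assumes D: "D > 0" and tau: "real D * tau \<in> \<int>" "tau \<noteq> 1/2"
  shows "1 / (2 * real D) \<le> \<bar>tau - 1/2\<bar>"
proof -
  have "2 * real D * (tau - 1/2) = 2 * (real D * tau) - real D" by (simp add: algebra_simps)
  then have "2 * real D * (tau - 1/2) \<in> \<int>" using tau(1) by simp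
  moreover have "2 * real D * (tau - 1/2) \<noteq> 0" using D tau(2) by simp
  ultimately have "1 \<le> \<bar>2 * real D * (tau - 1/2)\<bar>" by (rule Ints_nonzero_abs_ge1)
  also have "\<bar>2 * real D * (tau - 1/2)\<bar> = \<bar>tau - 1/2\<bar> * (2 * real D)"
    unfolding abs_mult[of "2 * real D"] by simp
  finally show ?thesis using D by (subst pos_divide_le_eq) simp_all
qed

lemma sum_jumps_0: "(\<Sum>(b, e)\<in>jumps 0. f b e) = f (-1) 1 + f 0 1 + (f (-1) 2 :: nat)"
  by (simp add: jumps_def)

lemma sum_jumps: "tau \<noteq> 0 \<Longrightarrow> (\<Sum>(b, e)\<in>jumps tau. f b e) = (f (tau - 1) 1 :: nat)"
  by (simp add: jumps_def)

text \<open>The next four lemmas estimate the cost of deleting the row \<open>y\<close> from a family doubled in direction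
\<open>x\<close>. The names tell first the kind of the entries in row \<open>x\<close>, then of those in row \<open>y\<close>. All
but the last follow by inserting the jumps into \<open>layer_card\<close>.\<close>

lemma cost_fractional_integral:
  assumes V: "doubled m t x a 1 (insert y R) V" "y \<notin> R"
  shows "(\<Sum>(b, e)\<in>jumps 0. card (layer y b e V)) \<le> 6"
proof -
  have "card (layer y (-1) 1 V) \<le> 2" by (rule layer_card[OF V]) simp_all
  moreover have "card (layer y 0 1 V) \<le> 2" by (rule layer_card[OF V]) simp_all
  moreover have "card (layer y (-1) 2 V) \<le> 2" by (rule layer_card[OF V]) simp_all
  ultimately show ?thesis unfolding sum_jumps_0 by linarith
qed

text \<open>Here \<open>eps = |sg - 1/2| + |tau - 1/2|\<close>, which is at least \<open>1 / (2 D)\<close> unless both fractional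
parts are one half.\<close>

lemma cost_fractional_fractional:
  assumes V: "doubled m t x (sg - 1) 1 (insert y R) V" "y \<notin> R" and tau: "tau \<noteq> 0"
    and D: "D > 0" "real D * sg \<in> \<int>" "real D * tau \<in> \<int>" and ne: "\<not> (sg = 1/2 \<and> tau = 1/2)"
  shows "(\<Sum>(b, e)\<in>jumps tau. card (layer y b e V)) \<le> 2 * D"
proof -
  have "1 / real (2 * D) \<le> \<bar>sg - 1/2\<bar> + \<bar>tau - 1/2\<bar>"
  proof (cases "sg = 1/2")
    case True
    then show ?thesis using half_gap[OF D(1,3)] ne by simp
  next
    case False
    then have "1 / (2 * real D) \<le> \<bar>sg - 1/2\<bar>" using half_gap[OF D(1,2)] by simp
    then show ?thesis using abs_ge_zero[of "tau - 1/2"] by (simp only: of_nat_mult of_nat_numeral)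
  qed
  moreover have "\<bar>sg - 1 + 1 / 2\<bar> = \<bar>sg - 1/2\<bar>" "\<bar>tau - 1 + 1 / 2\<bar> = \<bar>tau - 1/2\<bar>" by simp_all
  ultimately have "card (layer y (tau - 1) 1 V) \<le> 2 * D"
    by (intro layer_card[OF V]) (use D in simp_all)
  then show ?thesis unfolding sum_jumps[OF tau] .
qed

lemma cost_integral_fractional:
  assumes V: "doubled m t x a d (insert y R) V" "y \<notin> R" and ad: "(a, d) \<in> jumps 0" and tau: "tau \<noteq> 0"
  shows "(\<Sum>(b, e)\<in>jumps tau. card (layer y b e V)) \<le> 2"
proof -
  have "1 / real 2 \<le> 1 - 1 / (d * 1) + \<bar>a + d / 2\<bar> / d + \<bar>tau - 1 + 1 / 2\<bar> / 1"
    using ad by (auto simp: jumps_def)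
  then have "card (layer y (tau - 1) 1 V) \<le> 2" by (intro layer_card[OF V]) simp_all
  then show ?thesis unfolding sum_jumps[OF tau] .
qed

text \<open>At most one of the three layers is nonempty: the two-by-two minors in the rows \<open>x\<close> and \<open>y\<close>
rule out that both \<open>(p, 1)\<close> and \<open>(p, -1)\<close>, or both \<open>(1, p)\<close> and \<open>(-1, p)\<close>,
occur as entries in these rows for \<open>p = \<plusminus>1\<close>. If one is nonempty, \<open>layer_card\<close> applies with
\<open>eps = 1\<close>.\<close>

lemma cost_integral_integral:
  assumes V: "doubled m t x a d (insert y R) V" "y \<notin> R" and ad: "(a, d) \<in> jumps 0"
  shows "(\<Sum>(b, e)\<in>jumps 0. card (layer y b e V)) \<le> 1"
proof -
  note V' = V(1)[unfolded doubled_def]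
  have xy: "x \<noteq> y" using V' by auto
  have cross: "\<bar>p * q' - p' * q\<bar> \<le> 1"
    if "w \<in> layer y b e V" "w' \<in> layer y b' e' V" "q \<in> {b, b + e}" "q' \<in> {b', b' + e'}" "p \<in> {a, a + d}" "p' \<in> {a, a + d}"
    for w w' b e b' e' p p' q q'
  proof -
    have "w(y := q) \<in> V" "w'(y := q') \<in> V" using that by (auto simp: layer_def)
    then have "w(y := q, x := p) \<in> lift x a d V" "w'(y := q', x := p') \<in> lift x a d V"
      using that(5,6) unfolding lift_def by blast+
    then have "\<bar>(w(y := q, x := p)) x * (w'(y := q', x := p')) y - (w'(y := q', x := p')) x * (w(y := q, x := p)) y\<bar> \<le> 1"
      using bounded_pair[of m "insert x (insert y R)" "lift x a d V" "w(y := q, x := p)" "w'(y := q', x := p')" x y]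
        V' by simp
    then show ?thesis using xy by simp
  qed
  consider "d = 1" "a = -1 \<or> a = 0" | "a = -1" "d = 2" using ad by (auto simp: jumps_def)
  then show ?thesis
  proof cases
    case 1
    have c1: "card (layer y (-1) 1 V) \<le> 1" by (rule layer_card[OF V]) (use 1 in auto)
    have c2: "card (layer y 0 1 V) \<le> 1" by (rule layer_card[OF V]) (use 1 in auto)
    define p where "p = (if a = 0 then 1 else -1 :: real)"
    have p: "p \<in> {a, a + d}" "\<bar>p\<bar> = 1" using 1 by (auto simp: p_def)
    have no: False if "w \<in> layer y b e V" "w' \<in> layer y b' e' V" "-1 \<in> {b, b + e}" "1 \<in> {b', b' + e'}" for w w' b e b' e'
    proof -
      have "\<bar>p * 1 - p * (-1)\<bar> \<le> 1" by (rule cross[OF that p(1) p(1)])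
      then show False using p(2) by simp
    qed
    have "layer y (-1) 2 V = {}"
    proof (rule ccontr)
      assume "layer y (-1) 2 V \<noteq> {}"
      then obtain w where "w \<in> layer y (-1) 2 V" by blast
      from no[OF this this] show False by simp
    qed
    moreover have "layer y (-1) 1 V = {} \<or> layer y 0 1 V = {}"
    proof (rule ccontr)
      assume "\<not> (layer y (-1) 1 V = {} \<or> layer y 0 1 V = {})"
      then obtain w w' where "w \<in> layer y (-1) 1 V" "w' \<in> layer y 0 1 V" by blast
      from no[OF this] show False by simp
    qed
    ultimately show ?thesis unfolding sum_jumps_0 using c1 c2 by auto
  next
    case 2
    have empty: "layer y b e V = {}" if "q \<in> {b, b + e}" "\<bar>q\<bar> = 1" for b e q
    proof (rule ccontr)
      assume "layer y b e V \<noteq> {}"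
      then obtain w where w: "w \<in> layer y b e V" by blast
      have "\<bar>1 * q - (-1) * q\<bar> \<le> 1" by (rule cross[OF w w that(1) that(1)]) (use 2 in auto)
      then show False using that(2) by simp
    qed
    have "layer y (-1) 1 V = {}" by (rule empty[of "-1"]) simp_all
    moreover have "layer y 0 1 V = {}" by (rule empty[of 1]) simp_all
    moreover have "layer y (-1) 2 V = {}" by (rule empty[of 1]) simp_all
    ultimately show ?thesis unfolding sum_jumps_0 by simp
  qed
qed

lemma doubled_half:
  assumes V: "doubled m t x (-1/2) 1 R V" and half: "\<And>y. y \<in> R \<Longrightarrow> t y = 1/2"
  shows "card V \<le> 4 * card R + 1"
proof -
  note V' = V[unfolded doubled_def]
  have "half_rows m x R V"
  proof
    show "R \<subseteq> {..<m}" "x < m" "x \<notin> R" using V' by auto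
    have "lift x (-1/2) 1 V = {v(x := p) |v p. v \<in> V \<and> p \<in> {-1/2, 1/2}}" by (simp add: lift_def)
    then show "bounded_minors m (insert x R) {v(x := p) |v p. v \<in> V \<and> p \<in> {-1/2, 1/2}}" using V' by simp
    show "v i = 0" if "v \<in> V" "i \<notin> R" for v i using V' that unfolding in_coset_def by blast
    show "\<bar>v i\<bar> = 1/2" if v: "v \<in> V" "i \<in> R" for v i
    proof -
      have "v(x := -1/2) \<in> lift x (-1/2) 1 V" using v unfolding lift_def by blast
      then have "\<bar>(v(x := -1/2)) i\<bar> \<le> 1"
        using bounded_entry[of m "insert x R" "lift x (-1/2) 1 V" "v(x := -1/2)" i] V' v by auto
      then have "\<bar>v i\<bar> \<le> 1" using V' v by (auto split: if_splits)
      moreover have "v i - 1/2 \<in> \<int>" using V' v half unfolding in_coset_def by metis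
      ultimately have "v i \<in> (if (1/2::real) = 0 then {-1, 0, 1} else {1/2 - 1, 1/2})"
        by (intro coset_values) auto
      then show ?thesis by auto
    qed
  qed
  then show ?thesis by (rule half_rows.card_le)
qed

text \<open>The rows in \<open>H\<close>, where both fractional parts are one half, are left to \<open>half_rows.card_le\<close>;
every other row is deleted at cost at most \<open>2 D\<close> or 6, hence at most \<open>2 D + 2\<close>.\<close>

lemma fractional_layer_card:
  assumes V: "doubled m t x (sg - 1) 1 R V" and sg: "real D * sg \<in> \<int>"
    and t: "\<And>y. y \<in> R \<Longrightarrow> 0 \<le> t y \<and> t y < 1 \<and> real D * t y \<in> \<int>" and D: "D \<ge> 2"
  shows "card V \<le> (2 * D + 2) * card R + 1"
proof -
  define H where "H = {y\<in>R. sg = 1/2 \<and> t y = 1/2}"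
  define S where "S = R - H"
  have R: "R = S \<union> H" "S \<inter> H = {}" by (auto simp: S_def H_def)
  have fin: "finite R" using V finite_subset unfolding doubled_def by blast
  have finSH: "finite S" "finite H" using fin R(1) by auto
  have "card V \<le> (4 * card H + 1) + (2 * D + 2) * card S"
  proof (rule doubled_eliminate[OF finSH(1) R(2)])
    show "doubled m t x (sg - 1) 1 (S \<union> H) V" using V R(1) by simp
    show "\<forall>y\<in>S. 0 \<le> t y \<and> t y < 1" using t by (auto simp: S_def)
    show "card V' \<le> 4 * card H + 1" if V': "doubled m t x (sg - 1) 1 H V'" for V'
    proof (cases "H = {}")
      case True
      then show ?thesis using doubled_no_rows V' by auto
    next
      case False
      then have "sg - 1 = -1/2" by (auto simp: H_def)
      then have "doubled m t x (-1/2) 1 H V'" using V' by simp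
      then show ?thesis by (rule doubled_half) (simp add: H_def)
    qed
    show "(\<Sum>(b, e)\<in>jumps (t y). card (layer y b e V')) \<le> 2 * D + 2"
      if y: "y \<in> S" "y \<notin> R'" "doubled m t x (sg - 1) 1 (insert y R') V'" for y R' V'
    proof (cases "t y = 0")
      case True
      then have "(\<Sum>(b, e)\<in>jumps (t y). card (layer y b e V')) \<le> 6"
        using cost_fractional_integral[OF y(3,2)] by simp
      then show ?thesis using D by linarith
    next
      case False
      have "(\<Sum>(b, e)\<in>jumps (t y). card (layer y b e V')) \<le> 2 * D"
        by (rule cost_fractional_fractional[OF y(3,2) False]) (use D sg t y(1) in \<open>auto simp: S_def H_def\<close>)
      then show ?thesis by linarith
    qed
  qed
  also have "\<dots> \<le> ((2 * D + 2) * card H + 1) + (2 * D + 2) * card S" using D by simp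
  also have "\<dots> = (2 * D + 2) * card R + 1"
    using card_Un_disjoint[OF finSH R(2)] R(1) by (simp add: algebra_simps)
  finally show ?thesis .
qed

lemma integral_layer_card:
  assumes V: "doubled m t x a d R V" and ad: "(a, d) \<in> jumps 0"
    and t: "\<And>y. y \<in> R \<Longrightarrow> 0 \<le> t y \<and> t y < 1"
    and K: "K = (if \<forall>y\<in>R. t y = 0 then 1 else 2)"
  shows "card V \<le> K * card R + 1"
proof -
  have fin: "finite R" using V finite_subset unfolding doubled_def by blast
  have "card V \<le> 1 + K * card R"
  proof (rule doubled_eliminate[where H = "{}", OF fin])
    show "doubled m t x a d (R \<union> {}) V" using V by simp
    show "\<forall>y\<in>R. 0 \<le> t y \<and> t y < 1" using t by blast
    show "card V' \<le> 1" if "doubled m t x a d {} V'" for V' by (rule doubled_no_rows[OF that])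
    show "(\<Sum>(b, e)\<in>jumps (t y). card (layer y b e V')) \<le> K"
      if y: "y \<in> R" "y \<notin> R'" "doubled m t x a d (insert y R') V'" for y R' V'
    proof (cases "t y = 0")
      case True
      then have "(\<Sum>(b, e)\<in>jumps (t y). card (layer y b e V')) \<le> 1"
        using cost_integral_integral[OF y(3,2) ad] by simp
      then show ?thesis using K by (simp split: if_splits)
    next
      case False
      then show ?thesis using cost_integral_fractional[OF y(3,2) ad False] K y(1) by auto
    qed
  qed simp
  then show ?thesis by simp
qed

text \<open>\<open>Q\<close> is an invariant of the deletion process, and \<open>P\<close> the set of jumps by which the losses
are accounted for. The bound \<open>g\<close> on the loss depends on the number of remaining rows, which accounts for the
sum.\<close>

lemma coset_eliminate:
  assumes "finite R" and "R \<subseteq> {..<m}" "finite X" "in_coset R t X" "bounded_minors m R X" "Q R X"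
    and t: "\<And>y. y \<in> R \<Longrightarrow> 0 \<le> t y \<and> t y < 1"
    and step: "\<And>y R' X'. y \<notin> R' \<Longrightarrow> insert y R' \<subseteq> R \<Longrightarrow> finite X' \<Longrightarrow> in_coset (insert y R') t X' \<Longrightarrow>
      bounded_minors m (insert y R') X' \<Longrightarrow> Q (insert y R') X' \<Longrightarrow>
      Q R' (drop_rows R' ` X') \<and> (\<exists>P. finite P \<and>
        (\<forall>v. v y = 0 \<longrightarrow> card {p. v(y := p) \<in> X'} \<le> 1 + card {(a, d) \<in> P. v(y := a) \<in> X' \<and> v(y := a + d) \<in> X'}) \<and>
        (\<Sum>(a, d)\<in>P. card (layer y a d X')) \<le> g (card R'))"
  shows "card X \<le> 1 + (\<Sum>n<card R. g n)"
  using assms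
proof (induction R arbitrary: X rule: finite_induct)
  case empty
  then have "X \<subseteq> {\<lambda>_. 0}" unfolding in_coset_def by auto
  then show ?case using card_mono[of "{\<lambda>_. 0}" X] by simp
next
  case (insert y R)
  note step = insert.prems(7)[OF insert.hyps(2) subset_refl insert.prems(2-5)]
  have "card (drop_rows R ` X) \<le> 1 + (\<Sum>n<card R. g n)"
  proof (rule insert.IH)
    show "R \<subseteq> {..<m}" "finite (drop_rows R ` X)" using insert.prems by auto
    show "in_coset R t (drop_rows R ` X)" using in_coset_drop insert.prems(3) by blast
    show "bounded_minors m R (drop_rows R ` X)"
    proof (rule bounded_minors_subset[OF insert.prems(4,1)])
      fix v assume "v \<in> drop_rows R ` X"
      then show "\<exists>u\<in>X. \<forall>i\<in>R. v i = u i" by (auto simp: drop_rows_def)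
    qed auto
    show "Q R (drop_rows R ` X)" using step by blast
    show "0 \<le> t y \<and> t y < 1" if "y \<in> R" for y using insert.prems(6) that by blast
    show "Q R' (drop_rows R' ` X') \<and> (\<exists>P. finite P \<and>
        (\<forall>v. v z = 0 \<longrightarrow> card {p. v(z := p) \<in> X'} \<le> 1 + card {(a, d) \<in> P. v(z := a) \<in> X' \<and> v(z := a + d) \<in> X'}) \<and>
        (\<Sum>(a, d)\<in>P. card (layer z a d X')) \<le> g (card R'))"
      if "z \<notin> R'" "insert z R' \<subseteq> R" "finite X'" "in_coset (insert z R') t X'"
      "bounded_minors m (insert z R') X'" "Q (insert z R') X'" for z R' X'
      by (rule insert.prems(7)) (use that in auto)
  qed
  moreover obtain P where P: "finite P"
    "\<forall>v. v y = 0 \<longrightarrow> card {p. v(y := p) \<in> X} \<le> 1 + card {(a, d) \<in> P. v(y := a) \<in> X \<and> v(y := a + d) \<in> X}"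
    "(\<Sum>(a, d)\<in>P. card (layer y a d X)) \<le> g (card R)"
    using step by (elim conjE exE)
  moreover have "card X \<le> card (drop_rows R ` X) + (\<Sum>(a, d)\<in>P. card (layer y a d X))"
  proof (rule fibre_count[OF insert.prems(2) _ insert.hyps(2) P(1)])
    show "v i = 0" if "v \<in> X" "i \<notin> insert y R" for v i
      using insert.prems(3) that unfolding in_coset_def by blast
    show "card {p. v(y := p) \<in> X} \<le> 1 + card {(a, d) \<in> P. v(y := a) \<in> X \<and> v(y := a + d) \<in> X}" if "v y = 0" for v
      using P(2) that by blast
  qed
  ultimately have "card X \<le> 1 + (\<Sum>n<card R. g n) + g (card R)" by linarith
  then show ?case using insert.hyps by simp
qed

lemma coset_fibre:
  assumes X: "in_coset (insert y R) t X" "bounded_minors m (insert y R) X" and R: "insert y R \<subseteq> {..<m}"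
    and t: "0 \<le> t y" "t y < 1"
  shows "card {p. v(y := p) \<in> X} \<le> 1 + card {(a, d) \<in> jumps (t y). v(y := a) \<in> X \<and> v(y := a + d) \<in> X}"
proof -
  have "p - t y \<in> \<int> \<and> \<bar>p\<bar> \<le> 1" if "p \<in> {p. v(y := p) \<in> X}" for p
  proof
    have p: "v(y := p) \<in> X" using that by simp
    then have "(v(y := p)) y - t y \<in> \<int>" using X(1) unfolding in_coset_def by blast
    then show "p - t y \<in> \<int>" by simp
    show "\<bar>p\<bar> \<le> 1" using bounded_entry[OF X(2) R p, of y] by simp
  qed
  then show ?thesis using card_values_jumps[OF t, of "{p. v(y := p) \<in> X}"] by simp
qed

text \<open>Deleting a row with \<open>n\<close> other rows left costs one layer if the row is fractional and three layers if it
is integral; since \<open>D \<ge> 2\<close>, both are at most \<open>2 (D + 1) n + 2 D + 1\<close>.\<close>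

lemma coset_card:
  assumes R: "R \<subseteq> {..<m}" "R \<noteq> {}" and X: "finite X" "in_coset R t X" "bounded_minors m R X"
    and t: "\<And>y. y \<in> R \<Longrightarrow> 0 \<le> t y \<and> t y < 1 \<and> real D * t y \<in> \<int>" and D: "D \<ge> 2"
  shows "card X \<le> (D + 1) * (card R * (card R + 1))"
proof -
  have fin: "finite R" using R finite_subset by blast
  have "card X \<le> 1 + (\<Sum>n<card R. 2 * (D + 1) * n + (2 * D + 1))"
  proof (rule coset_eliminate[where Q = "\<lambda>R X. True", OF fin R(1) X])
    show "0 \<le> t y \<and> t y < 1" if "y \<in> R" for y using t that by blast
    fix y R' X' assume y: "y \<notin> R'" "insert y R' \<subseteq> R" and X': "finite X'" "in_coset (insert y R') t X'"
      "bounded_minors m (insert y R') X'"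
    have ty: "0 \<le> t y" "t y < 1" "real D * t y \<in> \<int>" using t y by auto
    have Rm: "R' \<subseteq> {..<m}" "y < m" using y R by auto
    have layer: "doubled m t y a d R' (layer y a d X')" if "d > 0" for a d
      by (rule doubled_layer[OF X' Rm y(1) that])
    have tR': "0 \<le> t z \<and> t z < 1 \<and> real D * t z \<in> \<int>" if "z \<in> R'" for z using t y that by auto
    have "(\<Sum>(a, d)\<in>jumps (t y). card (layer y a d X')) \<le> 2 * (D + 1) * card R' + (2 * D + 1)"
    proof (cases "t y = 0")
      case False
      have "card (layer y (t y - 1) 1 X') \<le> (2 * D + 2) * card R' + 1"
        by (rule fractional_layer_card[OF layer ty(3) tR' D]) simp_all
      then show ?thesis unfolding sum_jumps[OF False] by simp
    next
      case True
      define K :: nat where "K = (if \<forall>z\<in>R'. t z = 0 then 1 else 2)"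
      have c: "card (layer y a d X') \<le> K * card R' + 1" if "(a, d) \<in> jumps 0" for a d
      proof -
        have "d > 0" using that by (auto simp: jumps_def)
        from integral_layer_card[OF layer[OF this] that _ K_def] tR' show ?thesis by blast
      qed
      have "K * card R' \<le> 2 * card R'" by (simp add: K_def)
      moreover have "(- 1, 1) \<in> jumps 0" "(0, 1) \<in> jumps 0" "(- 1, 2) \<in> jumps 0" by (simp_all add: jumps_def)
      ultimately have "(\<Sum>(a, d)\<in>jumps (t y). card (layer y a d X')) \<le> 6 * card R' + 3"
        unfolding True sum_jumps_0 using c[of "-1" 1] c[of 0 1] c[of "-1" 2] by linarith
      also have "\<dots> \<le> 2 * (D + 1) * card R' + (2 * D + 1)" using D by (intro add_mono mult_right_mono) auto
      finally show ?thesis .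
    qed
    then show "True \<and> (\<exists>P. finite P \<and>
        (\<forall>v. v y = 0 \<longrightarrow> card {p. v(y := p) \<in> X'} \<le> 1 + card {(a, d) \<in> P. v(y := a) \<in> X' \<and> v(y := a + d) \<in> X'}) \<and>
        (\<Sum>(a, d)\<in>P. card (layer y a d X')) \<le> 2 * (D + 1) * card R' + (2 * D + 1))"
      using coset_fibre[OF X'(2,3) _ ty(1,2)] y R(1) by (intro conjI TrueI exI[of _ "jumps (t y)"]) auto
  qed simp
  moreover have "(\<Sum>n<k. 2 * (D + 1) * n + (2 * D + 1)) + k = (D + 1) * (k * (k + 1))" for k
    by (induction k) (auto simp: algebra_simps)
  moreover have "card R \<ge> 1" using R fin by (simp add: Suc_le_eq card_gt_0_iff)
  ultimately show ?thesis by (metis (no_types, lifting) add.commute add_le_mono le_refl le_trans)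
qed

text \<open>The long jump can be left out as long as the origin belongs to the family: if both \<open>-1\<close> and
\<open>1\<close> occur over a vector \<open>v\<close>, the two-by-two minors force \<open>v = 0\<close>, and then the value 0
occurs as well.\<close>

lemma trivial_coset_card:
  assumes R: "R \<subseteq> {..<m}" and X: "finite X" "in_coset R (\<lambda>_. 0) X" "bounded_minors m R X" and zero: "(\<lambda>_. 0) \<in> X"
  shows "card X \<le> 1 + card R * (card R + 1)"
proof -
  have fin: "finite R" using R finite_subset by blast
  have "card X \<le> 1 + (\<Sum>n<card R. 2 * (n + 1))"
  proof (rule coset_eliminate[where Q = "\<lambda>R X. (\<lambda>_. 0) \<in> X", OF fin R X zero])
    show "0 \<le> (0::real) \<and> (0::real) < 1" by simp
    fix y R' X' assume y: "y \<notin> R'" "insert y R' \<subseteq> R" and X': "finite X'" "in_coset (insert y R') (\<lambda>_. 0) X'"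
      "bounded_minors m (insert y R') X'" and z: "(\<lambda>_. 0) \<in> X'"
    have Rm: "R' \<subseteq> {..<m}" "y < m" "insert y R' \<subseteq> {..<m}" using y R by auto
    have c: "card (layer y a d X') \<le> 1 * card R' + 1" if "(a, d) \<in> jumps 0" for a d
    proof -
      have "d > 0" using that by (auto simp: jumps_def)
      from integral_layer_card[OF doubled_layer[OF X' Rm(1,2) y(1) this] that] show ?thesis by simp
    qed
    have "(- 1, 1) \<in> jumps 0" "(0, 1) \<in> jumps 0" by (simp_all add: jumps_def)
    then have "(\<Sum>(a, d)\<in>{(- 1, 1), (0, 1)}. card (layer y a d X')) \<le> 2 * (card R' + 1)"
      using c[of "-1" 1] c[of 0 1] by simp
    moreover have "card {p. v(y := p) \<in> X'} \<le>
        1 + card {(a, d) \<in> {(- 1, 1), (0, 1)}. v(y := a) \<in> X' \<and> v(y := a + d) \<in> X'}" if vy: "v y = 0" for v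
    proof -
      have fib: "card {p. v(y := p) \<in> X'} \<le> 1 + card {(a, d) \<in> jumps 0. v(y := a) \<in> X' \<and> v(y := a + d) \<in> X'}"
        using coset_fibre[OF X'(2,3) Rm(3)] by simp
      show ?thesis
      proof (cases "v(y := -1) \<in> X' \<and> v(y := 1) \<in> X'")
        case False
        then have "{(a, d) \<in> jumps 0. v(y := a) \<in> X' \<and> v(y := a + d) \<in> X'}
            = {(a, d) \<in> {(- 1, 1), (0, 1)}. v(y := a) \<in> X' \<and> v(y := a + d) \<in> X'}"
          by (auto simp: jumps_def)
        then show ?thesis using fib by simp
      next
        case True
        have "v i = 0" for i
        proof (cases "i \<in> R'")
          case iR: True
          have iy: "i \<noteq> y" using iR y by blast
          have "\<bar>(v(y := 1)) y * (v(y := -1)) i - (v(y := -1)) y * (v(y := 1)) i\<bar> \<le> 1"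
            using bounded_pair[OF X'(3) Rm(3), of "v(y := 1)" "v(y := -1)" y i] True iR iy by simp
          then have "\<bar>v i\<bar> < 1" using iy by simp
          moreover have "(v(y := 1)) i - 0 \<in> \<int>" using X'(2) True iR unfolding in_coset_def by blast
          then have "v i \<in> \<int>" using iy by simp
          ultimately show ?thesis using Ints_nonzero_abs_less1 by blast
        next
          case iR: False
          then show ?thesis
          proof (cases "i = y")
            case False
            then have "(v(y := 1)) i = 0" using X'(2) True iR unfolding in_coset_def by blast
            then show ?thesis using False by simp
          qed (use vy in simp)
        qed
        then have v0: "v = (\<lambda>_. 0)" by auto
        have sub: "{p. v(y := p) \<in> X'} \<subseteq> {-1, 0, 1}"
        proof
          fix p assume "p \<in> {p. v(y := p) \<in> X'}"
          then have p: "v(y := p) \<in> X'" by simp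
          have "(v(y := p)) y - 0 \<in> \<int>" using p X'(2) unfolding in_coset_def by blast
          then show "p \<in> {-1, 0, 1}"
            using coset_values[of 0 p] bounded_entry[OF X'(3) Rm(3) p, of y] by simp
        qed
        have "v(y := 0) \<in> X'" using z v0 by (simp add: fun_upd_idem)
        then have "{(a, d) \<in> {(- 1, 1), (0, 1)}. v(y := a) \<in> X' \<and> v(y := a + d) \<in> X'} = {(- 1, 1), (0, 1)}"
          using True by auto
        then show ?thesis using card_mono[OF _ sub] by simp
      qed
    qed
    moreover have "(\<lambda>_. 0) \<in> drop_rows R' ` X'"
      using z by (intro image_eqI[of _ _ "\<lambda>_. 0"]) (auto simp: drop_rows_def)
    ultimately show "(\<lambda>_. 0) \<in> drop_rows R' ` X' \<and> (\<exists>P. finite P \<and>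
        (\<forall>v. v y = 0 \<longrightarrow> card {p. v(y := p) \<in> X'} \<le> 1 + card {(a, d) \<in> P. v(y := a) \<in> X' \<and> v(y := a + d) \<in> X'}) \<and>
        (\<Sum>(a, d)\<in>P. card (layer y a d X')) \<le> 2 * (card R' + 1))"
      by (intro conjI exI[of _ "{(- 1, 1), (0, 1)}"]) auto
  qed
  moreover have "(\<Sum>n<k. 2 * (n + 1)) = k * (k + 1)" for k :: nat
    by (induction k) auto
  ultimately show ?thesis by simp
qed

section \<open>Coordinates with respect to a basis of maximal determinant\<close>

definition coord :: "nat \<Rightarrow> (nat \<Rightarrow> nat \<Rightarrow> real) \<Rightarrow> (nat \<Rightarrow> real) \<Rightarrow> nat \<Rightarrow> real" where
  "coord m B z j = (if j < m then Det m (B(j := z)) / Det m B else 0)"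

definition int_vecs :: "nat \<Rightarrow> (nat \<Rightarrow> real) set" where
  "int_vecs m = {z. (\<forall>i<m. z i \<in> \<int>) \<and> (\<forall>i\<ge>m. z i = 0)}"

lemma coord_combination:
  assumes "Det m B \<noteq> 0" "i < m"
  shows "z i = (\<Sum>j<m. coord m B z j * B j i)"
proof -
  have "Det m B * z i = (\<Sum>j<m. Det m (B(j := z)) * B j i)" by (rule Det_cramer[OF assms(2)])
  also have "\<dots> = (\<Sum>j<m. Det m B * (coord m B z j * B j i))"
    using assms(1) by (intro sum.cong) (auto simp: coord_def)
  finally show ?thesis using assms(1) by (simp add: sum_distrib_left[symmetric])
qed

lemma coord_unique:
  assumes "Det m B \<noteq> 0" "\<And>i. i < m \<Longrightarrow> z i = (\<Sum>j<m. y j * B j i)" "l < m"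
  shows "coord m B z l = y l"
proof -
  have "Det m (B(l := z)) = (\<Sum>j<m. y j * Det m (B(l := B j)))"
    by (rule Det_sum[OF assms(3,2)])
  also have "\<dots> = (\<Sum>j<m. if j = l then y l * Det m B else 0)"
  proof (rule sum.cong[OF refl])
    fix j assume j: "j \<in> {..<m}"
    show "y j * Det m (B(l := B j)) = (if j = l then y l * Det m B else 0)"
    proof (cases "j = l")
      case False
      have "Det m (B(l := B j)) = 0"
        by (rule Det_equal_columns[OF assms(3), of j]) (use j False in auto)
      then show ?thesis using False by simp
    qed simp
  qed
  also have "\<dots> = y l * Det m B" using assms(3) by simp
  finally show ?thesis using assms(1,3) by (simp add: coord_def)
qed

lemma coord_linear:
  assumes "Det m B \<noteq> 0"
  shows "coord m B (\<lambda>i. c * z i + d * w i) l = c * coord m B z l + d * coord m B w l"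
proof (cases "l < m")
  case True
  then show ?thesis using Det_add[OF True, of "\<lambda>i. c * z i + d * w i" c z d w B] assms
    by (simp add: coord_def add_divide_distrib)
qed (simp add: coord_def)

lemma coord_basis: "Det m B \<noteq> 0 \<Longrightarrow> k < m \<Longrightarrow> coord m B (B k) l = (if l = k then 1 else 0)"
proof (cases "l < m")
  case True
  assume B: "Det m B \<noteq> 0" and k: "k < m"
  show ?thesis
  proof (cases "l = k")
    case False
    have "Det m (B(l := B k)) = 0"
      by (rule Det_equal_columns[OF True k]) (use False in auto)
    then show ?thesis using True False by (simp add: coord_def)
  qed (use True B in \<open>simp add: coord_def\<close>)
qed (auto simp: coord_def)

lemma Det_coord_Ints:
  assumes "\<And>j. j < m \<Longrightarrow> B j \<in> int_vecs m" "z \<in> int_vecs m" "Det m B \<noteq> 0"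
  shows "\<bar>Det m B\<bar> * coord m B z j \<in> \<int>"
proof (cases "j < m")
  case True
  have "Det m (B(j := z)) \<in> \<int>"
    by (rule Det_Ints) (use assms in \<open>auto simp: int_vecs_def\<close>)
  moreover have "\<bar>Det m B\<bar> * coord m B z j = (if Det m B < 0 then - 1 else 1) * Det m (B(j := z))"
    using True assms(3) by (simp add: coord_def)
  ultimately show ?thesis by simp
qed (simp add: coord_def)

lemma frac_eq_iff_Ints: "frac x = frac y \<longleftrightarrow> x - y \<in> \<int>" for x y :: real
proof
  assume "frac x = frac y"
  then have "x - y = of_int (\<lfloor>x\<rfloor> - \<lfloor>y\<rfloor>)" by (simp add: frac_def)
  then show "x - y \<in> \<int>" by (metis Ints_of_int)
next
  assume "x - y \<in> \<int>"
  then obtain k where "x = y + of_int k" by (metis Ints_cases add.commute diff_add_cancel)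
  then show "frac x = frac y" by (simp add: frac_def)
qed

lemma card_image_le_image:
  assumes "finite Z" "\<And>z w. z \<in> Z \<Longrightarrow> w \<in> Z \<Longrightarrow> h z = h w \<Longrightarrow> f z = f w"
  shows "card (f ` Z) \<le> card (h ` Z)"
proof -
  have "f ` Z \<subseteq> (\<lambda>y. f (SOME z. z \<in> Z \<and> h z = y)) ` (h ` Z)"
  proof
    fix u assume "u \<in> f ` Z"
    then obtain z where z: "z \<in> Z" "u = f z" by blast
    define w where "w = (SOME w. w \<in> Z \<and> h w = h z)"
    have "w \<in> Z \<and> h w = h z" unfolding w_def by (rule someI[of _ z]) (use z in simp)
    then have "u = f w" using assms(2)[of z w] z by simp
    then show "u \<in> (\<lambda>y. f (SOME z. z \<in> Z \<and> h z = y)) ` (h ` Z)" using z unfolding w_def by blast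
  qed
  then show ?thesis using assms(1) by (intro surj_card_le) auto
qed

text \<open>The classes of integer vectors modulo the lattice spanned by \<open>B\<close> are recognised by the fractional parts
of their coordinates; there are at most \<open>|det B|\<close> of them. If the lattice is not everything, there is a vector of
prime order \<open>p\<close> modulo the lattice, and a multiple of it can be corrected to a vector \<open>g\<close> whose
\<open>j\<close>-th coordinate is \<open>1 / p\<close>. Replacing the \<open>j\<close>-th basis vector by \<open>g\<close> divides
the determinant by \<open>p\<close>, and each class modulo the finer lattice splits into at most \<open>p\<close> classes.\<close>

lemma index_le_Det:
  assumes "\<And>j. j < m \<Longrightarrow> B j \<in> int_vecs m" "\<bar>Det m B\<bar> = real N" "N > 0" "finite Z" "Z \<subseteq> int_vecs m"
  shows "card ((\<lambda>z j. frac (coord m B z j)) ` Z) \<le> N"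
  using assms
proof (induction N arbitrary: B rule: less_induct)
  case (less N)
  have Bnz: "Det m B \<noteq> 0" using less.prems by auto
  show ?case
  proof (cases "\<forall>z\<in>int_vecs m. \<forall>j<m. coord m B z j \<in> \<int>")
    case True
    have "frac (coord m B z j) = 0" if "z \<in> Z" for z j
      using True that less.prems(5) by (cases "j < m") (auto simp: coord_def)
    then have "(\<lambda>z j. frac (coord m B z j)) ` Z \<subseteq> {\<lambda>_. 0}" by auto
    from card_mono[OF _ this] have "card ((\<lambda>z j. frac (coord m B z j)) ` Z) \<le> 1" by simp
    then show ?thesis using less.prems(3) by simp
  next
    case False
    then obtain z0 j0 where z0: "z0 \<in> int_vecs m" "j0 < m" "coord m B z0 j0 \<notin> \<int>" by blast
    define P where "P q \<longleftrightarrow> q > 0 \<and> (\<forall>j<m. real q * coord m B z0 j \<in> \<int>)" for q :: nat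
    have "P N"
    proof -
      have "real N * coord m B z0 j \<in> \<int>" for j
        using Det_coord_Ints[OF less.prems(1) z0(1) Bnz, of j] less.prems(2) by simp
      then show ?thesis using less.prems(3) by (simp add: P_def)
    qed
    define q where "q = (LEAST q. P q)"
    have q: "P q" and qmin: "\<And>r. r < q \<Longrightarrow> \<not> P r"
      unfolding q_def using LeastI[of P, OF \<open>P N\<close>] not_less_Least by blast+
    have "q \<noteq> 1" using q z0 by (auto simp: P_def)
    then obtain p where p: "prime p" "p dvd q" using prime_factor_nat by blast
    then obtain r where r: "q = p * r" by (elim dvdE)
    have p1: "p > 1" using p(1) prime_gt_1_nat by blast
    have r0: "r > 0" "r < q" using q r p1 by (auto simp: P_def)
    then have "\<not> P r" using qmin by blast
    then obtain j where j: "j < m" "real r * coord m B z0 j \<notin> \<int>" using r0 by (auto simp: P_def)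
    \<comment> \<open>The multiple \<open>r z0\<close> has order \<open>p\<close>; its \<open>j\<close>-th coordinate is \<open>n / p\<close> with \<open>n\<close> coprime to \<open>p\<close>.\<close>
    define c where "c l = real r * coord m B z0 l" for l
    have pc: "real p * c l \<in> \<int>" if "l < m" for l
      using q r that by (simp add: P_def c_def mult.assoc)
    obtain n :: int where n: "real p * c j = of_int n" using pc[OF j(1)] by (elim Ints_cases)
    have "\<not> int p dvd n"
    proof
      assume "int p dvd n"
      then obtain k where "n = int p * k" by (elim dvdE)
      then have "c j = of_int k" using n p1 by simp
      then show False using j(2) by (simp add: c_def)
    qed
    then have "coprime (int p) n" using p(1) by (intro prime_imp_coprime) simp_all
    then obtain u s where "u * int p + s * n = 1" using bezout_int[of "int p" n] by auto
    then have us: "real_of_int u * real p + real_of_int s * real_of_int n = 1"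
      by (metis of_int_1 of_int_add of_int_mult of_int_of_nat_eq)
    define g where "g i = real_of_int s * real r * z0 i + real_of_int u * B j i" for i
    have gint: "g \<in> int_vecs m"
      using z0(1) less.prems(1)[OF j(1)] by (auto simp: g_def int_vecs_def)
    have gc: "coord m B g l = real_of_int s * c l + (if l = j then real_of_int u else 0)" for l
      unfolding g_def using coord_linear[OF Bnz, of "real_of_int s * real r" z0 "real_of_int u" "B j" l]
        coord_basis[OF Bnz j(1), of l] by (simp add: c_def)
    have gj: "coord m B g j = 1 / real p"
    proof -
      have "real p * coord m B g j = 1" unfolding gc using us n by (simp add: algebra_simps)
      then show ?thesis using p1 by (simp add: field_simps)
    qed
    have pg: "real p * coord m B g l \<in> \<int>" for l
    proof (cases "l < m")
      case True
      have "real p * coord m B g l = real_of_int s * (real p * c l) + (if l = j then real p * real_of_int u else 0)"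
        unfolding gc by (simp add: algebra_simps)
      then show ?thesis using pc[OF True] by simp
    qed (simp add: coord_def)
    let ?B = "B(j := g)"
    have DetB': "Det m ?B = Det m B / real p"
      using gj j(1) Bnz by (simp add: coord_def field_simps)
    have B'int: "?B l \<in> int_vecs m" if "l < m" for l using less.prems(1)[OF that] gint by simp
    have "Det m ?B \<in> \<int>" by (rule Det_Ints) (use B'int in \<open>auto simp: int_vecs_def\<close>)
    then have "\<bar>Det m ?B\<bar> \<in> \<int>" by (rule Ints_abs)
    then obtain k' where k': "\<bar>Det m ?B\<bar> = of_int k'" by (elim Ints_cases)
    then have "real_of_int k' \<ge> 0" using abs_ge_zero[of "Det m ?B"] by linarith
    then have "\<bar>Det m ?B\<bar> = real (nat k')" using k' by simp
    then obtain N' :: nat where N': "\<bar>Det m ?B\<bar> = real N'" by blast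
    have NN': "N = p * N'"
    proof -
      have "real N / real p = real N'" using N' less.prems(2) unfolding DetB' by (simp add: abs_divide)
      then have "real N = real N' * real p" using p1 by (subst (asm) divide_eq_eq) (simp split: if_splits)
      then have "real N = real (p * N')" by simp
      then show ?thesis by (simp only: of_nat_eq_iff)
    qed
    have N'0: "N' > 0" "N' < N" using NN' less.prems(3) p1 by auto
    have B'nz: "Det m ?B \<noteq> 0" using N' N'0 by auto
    define y where "y z = coord m ?B z" for z
    have rel: "coord m B z l = (if l = j then 0 else y z l) + y z j * coord m B g l" if l: "l < m" for z l
    proof (rule coord_unique[OF Bnz _ l])
      fix i assume i: "i < m"
      have "z i = (\<Sum>k<m. y z k * ?B k i)" unfolding y_def by (rule coord_combination[OF B'nz i])
      also have "\<dots> = (\<Sum>k<m. (if k = j then 0 else y z k) * B k i) + y z j * g i"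
        using j(1) by (simp add: sum.remove[of "{..<m}" j])
      also have "g i = (\<Sum>k<m. coord m B g k * B k i)" by (rule coord_combination[OF Bnz i])
      finally show "z i = (\<Sum>k<m. ((if k = j then 0 else y z k) + y z j * coord m B g k) * B k i)"
        by (simp add: sum.distrib sum_distrib_left algebra_simps)
    qed
    \<comment> \<open>The class with respect to \<open>B\<close> is determined by the finer class and one integer modulo \<open>p\<close>.\<close>
    let ?h = "\<lambda>z. ((\<lambda>l. frac (y z l)), \<lfloor>y z j\<rfloor> mod int p)"
    have "card ((\<lambda>z l. frac (coord m B z l)) ` Z) \<le> card (?h ` Z)"
    proof (rule card_image_le_image[OF less.prems(4)])
      fix z w assume zw: "?h z = ?h w"
      have "(\<lambda>l. frac (y z l)) = (\<lambda>l. frac (y w l))"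
        using zw by (rule Pair_inject)
      then have h1: "frac (y z l) = frac (y w l)" for l by (rule fun_cong)
      have h2: "\<lfloor>y z j\<rfloor> mod int p = \<lfloor>y w j\<rfloor> mod int p"
        using zw by (rule Pair_inject)
      have yd: "y z l - y w l \<in> \<int>" for l using h1[of l] by (simp only: frac_eq_iff_Ints)
      have "int p dvd \<lfloor>y z j\<rfloor> - \<lfloor>y w j\<rfloor>" using h2 by (simp only: mod_eq_dvd_iff)
      then obtain k where k: "\<lfloor>y z j\<rfloor> - \<lfloor>y w j\<rfloor> = int p * k" by (elim dvdE)
      have "y z j - y w j = of_int (\<lfloor>y z j\<rfloor> - \<lfloor>y w j\<rfloor>)" using h1[of j] unfolding frac_def of_int_diff by linarith
      then have yj: "y z j - y w j = real p * of_int k" unfolding k by simp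
      have "coord m B z l - coord m B w l \<in> \<int>" for l
      proof (cases "l < m")
        case True
        have "coord m B z l - coord m B w l =
            (if l = j then 0 else y z l - y w l) + (y z j - y w j) * coord m B g l"
          using rel[OF True, of z] rel[OF True, of w] by (simp add: algebra_simps)
        also have "\<dots> = (if l = j then 0 else y z l - y w l) + of_int k * (real p * coord m B g l)"
          unfolding yj by simp
        also have "\<dots> \<in> \<int>"
        proof (rule Ints_add)
          show "(if l = j then 0 else y z l - y w l) \<in> \<int>" using yd[of l] by simp
          show "of_int k * (real p * coord m B g l) \<in> \<int>" by (rule Ints_mult[OF Ints_of_int pg])
        qed
        finally show ?thesis .
      qed (simp add: coord_def)
      then show "(\<lambda>l. frac (coord m B z l)) = (\<lambda>l. frac (coord m B w l))"
        by (simp add: fun_eq_iff frac_eq_iff_Ints)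
    qed
    also have "\<dots> \<le> card ((\<lambda>z l. frac (y z l)) ` Z \<times> {0..<int p})"
      using less.prems(4) p1 by (intro card_mono) auto
    also have "\<dots> = card ((\<lambda>z l. frac (y z l)) ` Z) * p" by (simp add: card_cartesian_product)
    also have "\<dots> \<le> N' * p"
    proof (rule mult_le_mono1)
      show "card ((\<lambda>z l. frac (y z l)) ` Z) \<le> N'"
        unfolding y_def by (rule less.IH[OF N'0(2) B'int N' N'0(1) less.prems(4,5)])
    qed
    finally show ?thesis using NN' by (simp add: mult.commute)
  qed
qed

text \<open>Determinants are linear in each column, so zero columns and signs do not enlarge them.\<close>

lemma Det_signed_columns:
  assumes C: "\<And>f. (\<And>j. j < m \<Longrightarrow> f j \<in> C) \<Longrightarrow> \<bar>Det m f\<bar> \<le> D" and D: "D \<ge> 0"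
    and f: "\<And>j. j < m \<Longrightarrow> f j \<in> C \<union> (\<lambda>z i. - z i) ` C \<union> {\<lambda>_. 0}"
  shows "\<bar>Det m f\<bar> \<le> (D :: real)"
proof -
  have gen: "\<bar>Det m f\<bar> \<le> D" if "finite K" "\<And>j. j < m \<Longrightarrow> j \<notin> K \<Longrightarrow> f j \<in> C"
    "\<And>j. j < m \<Longrightarrow> j \<in> K \<Longrightarrow> f j \<in> C \<union> (\<lambda>z i. - z i) ` C \<union> {\<lambda>_. 0}" for K f
    using that
  proof (induction K arbitrary: f rule: finite_induct)
    case empty
    show ?case by (rule C) (use empty in simp)
  next
    case (insert k K)
    show ?case
    proof (cases "k < m")
      case False
      show ?thesis
      proof (rule insert.IH)
        fix j assume j: "j < m"
        then have jk: "j \<noteq> k" using False by auto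
        show "f j \<in> C" if "j \<notin> K" using insert.prems(1)[of j] j jk that by simp
        show "f j \<in> C \<union> (\<lambda>z i. - z i) ` C \<union> {\<lambda>_. 0}" if "j \<in> K" using insert.prems(2)[of j] j that by simp
      qed
    next
      case True
      have IH: "\<bar>Det m (f(k := c))\<bar> \<le> D" if c: "c \<in> C" for c
      proof (rule insert.IH)
        fix j assume j: "j < m"
        show "(f(k := c)) j \<in> C" if "j \<notin> K" using insert.prems(1)[of j] j that c by simp
        show "(f(k := c)) j \<in> C \<union> (\<lambda>z i. - z i) ` C \<union> {\<lambda>_. 0}" if "j \<in> K"
          using insert.prems(2)[of j] j that c by simp
      qed
      consider "f k \<in> C" | c where "c \<in> C" "f k = (\<lambda>i. - c i)" | "f k = (\<lambda>_. 0)"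
        using insert.prems(2)[OF True] by auto
      then show ?thesis
      proof cases
        case 1
        then show ?thesis using IH[of "f k"] by simp
      next
        case 2
        have "Det m (f(k := f k)) = - Det m (f(k := c))"
          using Det_add[OF True, of "f k" "-1" c 0 c f] 2 by simp
        then have "Det m f = - Det m (f(k := c))" by (simp only: fun_upd_triv)
        then show ?thesis using IH[OF 2(1)] by simp
      next
        case 3
        have "Det m (f(k := f k)) = 0" using Det_add[OF True, of "f k" 0 "f k" 0 "f k" f] 3 by simp
        then have "Det m f = 0" by (simp only: fun_upd_triv)
        then show ?thesis using D by simp
      qed
    qed
  qed
  show ?thesis by (rule gen[of "{..<m}"]) (use f in simp_all)
qed

text \<open>A minor of coordinate vectors is a quotient of two determinants: the columns that belong to unit vectors are filled up
with basis vectors. As \<open>B\<close> has the largest determinant, these minors are bounded by 1. The coset bounds are then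
added up over the classes.\<close>

lemma differing_columns_bound:
  assumes m: "m \<ge> 1" and C: "C \<subseteq> int_vecs m" and B: "\<And>j. j < m \<Longrightarrow> B j \<in> C"
    and D: "\<bar>Det m B\<bar> = real D" "D > 0"
    and max: "\<And>f. (\<And>j. j < m \<Longrightarrow> f j \<in> C) \<Longrightarrow> \<bar>Det m f\<bar> \<le> real D"
    and S: "finite S" "S \<subseteq> C" "(\<lambda>_. 0) \<notin> S"
      "\<And>a b. a \<in> S \<Longrightarrow> b \<in> S \<Longrightarrow> a \<noteq> b \<Longrightarrow> a \<noteq> (\<lambda>i. - b i)"
  shows "2 * card S \<le> D\<^sup>2 * (m * (m + 1))"
proof -
  have Bnz: "Det m B \<noteq> 0" using D by auto
  have Bint: "B j \<in> int_vecs m" if "j < m" for j using B[OF that] C by blast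
  let ?neg = "\<lambda>z i. - z i :: real"
  define Z where "Z = insert (\<lambda>_. 0) (S \<union> ?neg ` S)"
  have finZ: "finite Z" using S(1) by (simp add: Z_def)
  have Zint: "Z \<subseteq> int_vecs m" using S(2) C by (auto simp: Z_def int_vecs_def)
  have cardZ: "card Z = 2 * card S + 1"
  proof -
    have "S \<inter> ?neg ` S = {}"
    proof (rule ccontr)
      assume "S \<inter> ?neg ` S \<noteq> {}"
      then obtain a b where ab: "a \<in> S" "b \<in> S" "a = (\<lambda>i. - b i)" by blast
      then have "a = b" using S(4) by blast
      then have "b i = - b i" for i using ab(3) by metis
      then have "b = (\<lambda>_. 0)" by (simp add: fun_eq_iff eq_neg_iff_add_eq_0)
      then show False using ab(2) S(3) by simp
    qed
    moreover have "inj_on ?neg S" by (rule inj_onI) (simp add: fun_eq_iff)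
    ultimately have "card (S \<union> ?neg ` S) = 2 * card S"
      using S(1) by (simp add: card_Un_disjoint card_image)
    moreover have "(\<lambda>_. 0) \<notin> S \<union> ?neg ` S"
    proof
      assume "(\<lambda>_. 0) \<in> S \<union> ?neg ` S"
      then obtain b where "b \<in> S" "(\<lambda>_. 0) = (\<lambda>i. - b i)" using S(3) by auto
      then have "b = (\<lambda>_. 0)" by (simp add: fun_eq_iff)
      then show False using \<open>b \<in> S\<close> S(3) by simp
    qed
    ultimately show ?thesis using S(1) by (simp add: Z_def)
  qed
  have inj: "inj_on (coord m B) Z"
  proof (rule inj_onI)
    fix z w assume zw: "z \<in> Z" "w \<in> Z" "coord m B z = coord m B w"
    have "z i = w i" for i
    proof (cases "i < m")
      case True
      show ?thesis unfolding coord_combination[OF Bnz True, of z] coord_combination[OF Bnz True, of w] zw(3) ..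
    next
      case False
      have "z \<in> int_vecs m" "w \<in> int_vecs m" using zw(1,2) Zint by auto
      then show ?thesis using False by (simp add: int_vecs_def)
    qed
    then show "z = w" by auto
  qed
  define X where "X = coord m B ` Z"
  have finX: "finite X" and cardX: "card X = 2 * card S + 1"
    using finZ cardZ card_image[OF inj] by (auto simp: X_def)
  have bounded: "bounded_minors m {..<m} X"
    unfolding bounded_minors_def
  proof (intro allI impI)
    fix J f assume J: "J \<subseteq> {..<m}" and f: "\<forall>j\<in>J. f j \<in> X"
    have "\<forall>j\<in>J. \<exists>z. z \<in> Z \<and> f j = coord m B z" using f by (auto simp: X_def)
    from bchoice[OF this] obtain z where z: "\<forall>j\<in>J. z j \<in> Z \<and> f j = coord m B (z j)" by (elim exE)
    define h where "h j = (if j \<in> J then z j else B j)" for j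
    have "Det m h = Det m B * minor m J f"
      unfolding minor_def
    proof (rule Det_mult)
      fix i j assume ij: "i < m" "j < m"
      show "h j i = (\<Sum>k<m. (if j \<in> J then f j else unit j) k * B k i)"
      proof (cases "j \<in> J")
        case True
        then show ?thesis using z coord_combination[OF Bnz ij(1), of "z j"] by (simp add: h_def)
      next
        case False
        have "(\<Sum>k<m. unit j k * B k i) = (\<Sum>k<m. if k = j then B j i else 0)"
          by (rule sum.cong) (auto simp: unit_def)
        then show ?thesis using False ij by (simp add: h_def)
      qed
    qed
    moreover have "\<bar>Det m h\<bar> \<le> real D"
    proof (rule Det_signed_columns[of m C, OF max])
      fix j assume j: "j < m"
      show "h j \<in> C \<union> ?neg ` C \<union> {\<lambda>_. 0}"
        using z B[OF j] S(2) by (auto simp: h_def Z_def)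
    qed simp_all
    ultimately have "real D * \<bar>minor m J f\<bar> \<le> real D * 1" using D(1) by (simp add: abs_mult)
    then show "\<bar>minor m J f\<bar> \<le> 1" using D(2) by simp
  qed
  define fr where "fr z = (\<lambda>j. frac (coord m B z j))" for z
  define G where "G = fr ` Z"
  have finG: "finite G" and cardG: "card G \<le> D"
    using finZ index_le_Det[OF Bint D finZ Zint] by (auto simp: G_def fr_def[abs_def])
  define Y where "Y c = {v\<in>X. (\<lambda>j. frac (v j)) = c}" for c
  have YX: "Y c \<subseteq> X" for c by (auto simp: Y_def)
  have Ybd: "bounded_minors m {..<m} (Y c)" for c
    by (rule bounded_minors_subset[OF bounded]) (use YX in auto)
  have Ycoset: "in_coset {..<m} c (Y c)" for c
    unfolding in_coset_def
  proof (intro ballI conjI allI impI)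
    fix v i assume v: "v \<in> Y c"
    show "v i - c i \<in> \<int>" using v by (auto simp: Y_def frac_def)
    show "v i = 0" if "i \<notin> {..<m}" using v that by (auto simp: Y_def X_def coord_def)
  qed
  have zeroG: "(\<lambda>_. 0) \<in> G"
    unfolding G_def fr_def by (rule image_eqI[of _ _ "\<lambda>_. 0"])
      (use coord_linear[OF Bnz, of 0 "\<lambda>_. 0" 0 "\<lambda>_. 0"] in \<open>auto simp: Z_def fun_eq_iff\<close>)
  have Y0: "card (Y (\<lambda>_. 0)) \<le> 1 + m * (m + 1)"
  proof -
    have "(\<lambda>_. 0) \<in> X"
      unfolding X_def by (rule image_eqI[of _ _ "\<lambda>_. 0"])
        (use coord_linear[OF Bnz, of 0 "\<lambda>_. 0" 0 "\<lambda>_. 0"] in \<open>auto simp: Z_def fun_eq_iff\<close>)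
    then have "(\<lambda>_. 0) \<in> Y (\<lambda>_. 0)" by (simp add: Y_def)
    from trivial_coset_card[OF subset_refl _ Ycoset Ybd this] show ?thesis
      using finite_subset[OF YX finX] by simp
  qed
  have Yc: "card (Y c) \<le> (D + 1) * (m * (m + 1))" if c: "c \<in> G" "D \<ge> 2" for c
  proof -
    obtain z where z: "z \<in> Z" "c = fr z" using c by (auto simp: G_def)
    have cy: "0 \<le> c y \<and> c y < 1 \<and> real D * c y \<in> \<int>" for y
    proof -
      have "real D * coord m B z y \<in> \<int>"
        using Det_coord_Ints[OF Bint _ Bnz, of z y] z(1) Zint D(1) by auto
      moreover have "real D * c y = real D * coord m B z y - of_int (int D * \<lfloor>coord m B z y\<rfloor>)"
        by (simp add: z(2) fr_def frac_def algebra_simps)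
      ultimately have "real D * c y \<in> \<int>" by (metis Ints_diff Ints_of_int)
      then show ?thesis by (simp add: z(2) fr_def frac_lt_1)
    qed
    have "{..<m} \<noteq> {}" using m by (simp add: lessThan_empty_iff)
    from coset_card[OF subset_refl this finite_subset[OF YX finX] Ycoset Ybd cy c(2)]
    show ?thesis by simp
  qed
  have "X \<subseteq> (\<Union>c\<in>G. Y c)" by (auto simp: X_def G_def Y_def fr_def)
  then have "card X \<le> card (\<Union>c\<in>G. Y c)" using finG finite_subset[OF YX finX] by (intro card_mono) auto
  also have "\<dots> \<le> (\<Sum>c\<in>G. card (Y c))" by (rule card_UN_le[OF finG])
  also have "\<dots> = card (Y (\<lambda>_. 0)) + (\<Sum>c\<in>G - {\<lambda>_. 0}. card (Y c))"
    using finG zeroG by (simp add: sum.remove)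
  also have "(\<Sum>c\<in>G - {\<lambda>_. 0}. card (Y c)) \<le> (D - 1) * ((D + 1) * (m * (m + 1)))"
  proof (cases "D \<ge> 2")
    case True
    have "(\<Sum>c\<in>G - {\<lambda>_. 0}. card (Y c)) \<le> card (G - {\<lambda>_. 0}) * ((D + 1) * (m * (m + 1)))"
      using sum_bounded_above[of "G - {\<lambda>_. 0}" "\<lambda>c. card (Y c)"] Yc[OF _ True] by simp
    also have "\<dots> \<le> (D - 1) * ((D + 1) * (m * (m + 1)))"
      using cardG zeroG finG by (intro mult_right_mono) auto
    finally show ?thesis .
  next
    case False
    then have "card G \<le> 1" using cardG by simp
    then have "G = {\<lambda>_. 0}" using zeroG finG card_le_Suc0_iff_eq[of G] by auto
    then show ?thesis by simp
  qed
  finally have "card X \<le> 1 + m * (m + 1) + (D - 1) * ((D + 1) * (m * (m + 1)))" using Y0 by simp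
  also have "\<dots> = 1 + D\<^sup>2 * (m * (m + 1))"
  proof -
    obtain E where "D = Suc E" using D(2) by (cases D) auto
    then show ?thesis by (simp add: power2_eq_square algebra_simps)
  qed
  finally show ?thesis using cardX by simp
qed

section \<open>Integer matrices and the column number\<close>

lemma Det_permute_columns:
  assumes "p permutes {..<m}"
  shows "\<bar>Det m (\<lambda>j. f (p j))\<bar> = \<bar>Det m f :: real\<bar>"
proof -
  define g where "g q j = (unit (q j) :: nat \<Rightarrow> int)" for q :: "nat \<Rightarrow> nat" and j
  have comp: "Det m (g (\<lambda>j. q (r j))) = Det m (g q) * Det m (g r)" if r: "r permutes {..<m}" for q r
  proof (rule Det_mult)
    fix i j assume "i < m" "j < m"
    then have "r j < m" using permutes_in_image[OF r, of j] by auto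
    have "(\<Sum>k<m. g r j k * g q k i) = (\<Sum>k<m. if k = r j then g q k i else 0)"
      by (rule sum.cong) (auto simp: g_def unit_def)
    then show "g (\<lambda>j. q (r j)) j i = (\<Sum>k<m. g r j k * g q k i)"
      using \<open>r j < m\<close> by (simp add: g_def)
  qed
  have "g (\<lambda>j. p (inv_into UNIV p j)) = unit" by (rule ext) (simp add: g_def permutes_inverses[OF assms])
  then have "Det m (g p) * Det m (g (inv_into UNIV p)) = 1"
    using comp[OF permutes_inv[OF assms], of p] by (simp add: Det_unit)
  then have "\<bar>Det m (g p)\<bar> = 1" by (metis abs_zmult_eq_1 abs_1)
  moreover have "Det m (\<lambda>j. f (p j)) = Det m f * Det m (\<lambda>j i. of_int (g p j i))"
  proof (rule Det_mult)
    fix i j assume "i < m" "j < m"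
    then have "p j < m" using permutes_in_image[OF assms, of j] by auto
    have "(\<Sum>k<m. of_int (g p j k) * f k i) = (\<Sum>k<m. if k = p j then f k i else 0)"
      by (rule sum.cong) (auto simp: g_def unit_def)
    then show "f (p j) i = (\<Sum>k<m. of_int (g p j k) * f k i)" using \<open>p j < m\<close> by simp
  qed
  ultimately show ?thesis by (simp add: Det_of_int abs_mult flip: of_int_abs)
qed

text \<open>Entries outside the range are 0, so that equality of functions is equality of columns.\<close>

definition column :: "int mat \<Rightarrow> nat \<Rightarrow> nat \<Rightarrow> real" where
  "column A k i = (if i < dim_row A then of_int (A $$ (i, k)) else 0)"

definition columns :: "int mat \<Rightarrow> (nat \<Rightarrow> real) set" where
  "columns A = column A ` {..<dim_col A}"

lemma columns_int_vecs: "A \<in> carrier_mat m n \<Longrightarrow> columns A \<subseteq> int_vecs m"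
  by (auto simp: columns_def column_def int_vecs_def)

lemma columns_choice:
  assumes "\<And>j. j < m \<Longrightarrow> f j \<in> columns A"
  obtains k where "\<And>j. j < m \<Longrightarrow> k j < dim_col A" "\<And>j. j < m \<Longrightarrow> f j = column A (k j)"
proof -
  have "\<forall>j\<in>{..<m}. \<exists>k. k < dim_col A \<and> f j = column A k" using assms unfolding columns_def by blast
  from bchoice[OF this] show ?thesis using that by auto
qed

lemma full_row_rank_basis:
  assumes A: "A \<in> carrier_mat m n" and rank: "full_row_rank A"
  obtains k where "\<And>j. j < m \<Longrightarrow> k j < n" "Det m (\<lambda>j. column A (k j)) \<noteq> 0"
proof -
  interpret vec_space "TYPE(real)" m .
  let ?R = "real_mat A"
  have R: "?R \<in> carrier_mat m n" using A by simp
  have "rank ?R = m" using rank A unfolding full_row_rank_def by simp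
  moreover obtain S where S: "finite S" "maximal S (\<lambda>T. T \<subseteq> set (cols ?R) \<and> lin_indpt T)"
    using maximal_exists_superset[of "set (cols ?R)" "\<lambda>T. T \<subseteq> set (cols ?R) \<and> lin_indpt T" "{}"]
    by (auto simp: lin_dep_def)
  ultimately have cS: "card S = m" using rank_card_indpt[OF R] by simp
  have SR: "S \<subseteq> set (cols ?R)" "lin_indpt S" using S(2) by (auto simp: maximal_def)
  obtain vs where vs: "set vs = S" "distinct vs" using finite_distinct_list[OF S(1)] by blast
  have len: "length vs = m" using vs cS distinct_card by metis
  have vs_dim: "set vs \<subseteq> carrier_vec m" using SR vs cols_dim[of ?R] R by auto
  let ?M = "mat_of_cols m vs"
  have M: "?M \<in> carrier_mat m m" using mat_of_cols_carrier(1)[of m vs] len by simp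
  have "cols ?M = vs" using vs_dim by (rule cols_mat_of_cols)
  then have "rank ?M = m" using lin_indpt_full_rank[OF M] vs SR by simp
  then have det: "det ?M \<noteq> 0" using det_rank_iff[OF M] by simp
  have "\<forall>j\<in>{..<m}. \<exists>k. k < n \<and> vs ! j = col ?R k"
  proof
    fix j assume "j \<in> {..<m}"
    then have "vs ! j \<in> set vs" using len by simp
    then have "vs ! j \<in> set (cols ?R)" using SR(1) vs(1) by blast
    then show "\<exists>k. k < n \<and> vs ! j = col ?R k" using R by (auto simp: cols_def)
  qed
  from bchoice[OF this] obtain k where k: "\<forall>j\<in>{..<m}. k j < n \<and> vs ! j = col ?R (k j)" by (elim exE)
  have "mat m m (\<lambda>(i, j). column A (k j) i) = ?M"
  proof (rule eq_matI)
    fix i j assume ij: "i < dim_row ?M" "j < dim_col ?M"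
    then have "j \<in> {..<m}" "i < m" using len by auto
    then show "mat m m (\<lambda>(i, j). column A (k j) i) $$ (i, j) = ?M $$ (i, j)"
      using k len A by (simp add: mat_of_cols_def column_def)
  qed (use len in auto)
  then have "Det m (\<lambda>j. column A (k j)) \<noteq> 0" using det unfolding Det_def by simp
  then show ?thesis using that k by auto
qed

lemma det_submatrix_columns:
  assumes A: "A \<in> carrier_mat m n" and IJ: "I \<subseteq> {..<m}" "J \<subseteq> {..<n}" "card I = m" "card J = m"
  shows "real_of_int (det (submatrix A I J)) = Det m (\<lambda>j. column A (pick J j))"
proof -
  have I: "I = {..<m}" using IJ card_subset_eq[of "{..<m}" I] by simp
  have cI: "card {i. i < dim_row A \<and> i \<in> I} = m" using I A by (simp add: lessThan_def[symmetric])
  have "{j. j < dim_col A \<and> j \<in> J} = J" using IJ A by auto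
  then have cJ: "card {j. j < dim_col A \<and> j \<in> J} = m" using IJ by simp
  have pI: "pick I i = i" if "i < m" for i
  proof -
    have "pick {i. i < m \<and> i \<in> UNIV} i = pick UNIV i" 
      by (rule pick_reduce_set[symmetric]) (use that in \<open>simp add: lessThan_def[symmetric]\<close>)
    then show ?thesis using I by (simp add: lessThan_def[symmetric] pick_UNIV)
  qed
  have "map_mat real_of_int (submatrix A I J) = mat m m (\<lambda>(i, j). column A (pick J j) i)"
    using cI cJ pI A unfolding submatrix_def by (intro eq_matI) (auto simp: column_def)
  then show ?thesis unfolding Det_def by (simp flip: of_int_hom.hom_det)
qed

text \<open>A submatrix has its columns in increasing order, whereas a family of columns may come in any order and with
repetitions. Reordering costs a sign, and repetition makes the determinant vanish.\<close>

lemma max_subdet_columns: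
  assumes A: "A \<in> carrier_mat m n" and rank: "full_row_rank A"
  shows max_subdet_ge: "\<And>f. (\<And>j. j < m \<Longrightarrow> f j \<in> columns A) \<Longrightarrow> \<bar>Det m f\<bar> \<le> of_int (max_subdet A)"
    and max_subdet_attained: "\<exists>f. (\<forall>j<m. f j \<in> columns A) \<and> \<bar>Det m f\<bar> = of_int (max_subdet A)"
    and max_subdet_pos: "max_subdet A \<ge> 1"
proof -
  let ?P = "\<lambda>I J. I \<subseteq> {..<m} \<and> J \<subseteq> {..<n} \<and> card I = m \<and> card J = m"
  define dets where "dets = {\<bar>det (submatrix A I J)\<bar> | I J. ?P I J}"
  have max: "max_subdet A = Max dets" unfolding max_subdet_def dets_def using A by simp
  have "dets \<subseteq> (\<lambda>(I, J). \<bar>det (submatrix A I J)\<bar>) ` (Pow {..<m} \<times> Pow {..<n})"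
    unfolding dets_def by auto
  then have fin: "finite dets" by (rule finite_subset) simp
  have covered: "\<exists>d\<in>dets. \<bar>Det m f\<bar> = of_int d" if f: "\<And>j. j < m \<Longrightarrow> f j \<in> columns A" and nz: "Det m f \<noteq> 0" for f
  proof -
    obtain k where k: "\<And>j. j < m \<Longrightarrow> k j < n" "\<And>j. j < m \<Longrightarrow> f j = column A (k j)"
      using columns_choice[of m f A] f A by auto
    have inj: "inj_on k {..<m}"
    proof (rule inj_onI, rule ccontr)
      fix i j assume ij: "i \<in> {..<m}" "j \<in> {..<m}" "k i = k j" "i \<noteq> j"
      then have "Det m f = 0" by (intro Det_equal_columns[of i m j]) (auto simp: k)
      then show False using nz by simp
    qed
    define J where "J = k ` {..<m}"
    have J: "J \<subseteq> {..<n}" "card J = m" using k(1) card_image[OF inj] by (auto simp: J_def)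
    have finJ: "finite J" by (simp add: J_def)
    have pick_inj: "inj_on (pick J) {..<m}"
    proof (rule inj_onI)
      fix i j assume ij: "i \<in> {..<m}" "j \<in> {..<m}" "pick J i = pick J j"
      show "i = j"
      proof (rule linorder_cases[of i j])
        assume "i < j" then show ?thesis using pick_mono_le[of j J i] ij J by simp
      next
        assume "j < i" then show ?thesis using pick_mono_le[of i J j] ij J by simp
      qed simp
    qed
    have "pick J ` {..<m} \<subseteq> J" using pick_in_set_le[of _ J] J by auto
    then have pick_img: "pick J ` {..<m} = J"
      using card_subset_eq[OF finJ] card_image[OF pick_inj] J by simp
    have "bij_betw (pick J) {..<m} J" using pick_inj pick_img by (simp add: bij_betw_def)
    moreover have "bij_betw k {..<m} J" using inj by (simp add: bij_betw_def J_def)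
    ultimately have bij: "bij_betw (inv_into {..<m} (pick J) \<circ> k) {..<m} {..<m}"
      using bij_betw_inv_into bij_betw_trans by blast
    define p where "p j = (if j < m then inv_into {..<m} (pick J) (k j) else j)" for j
    have "bij_betw p {..<m} {..<m}" using bij by (rule bij_betw_cong[THEN iffD1, rotated]) (simp add: p_def)
    then have perm: "p permutes {..<m}" by (rule bij_imp_permutes) (simp add: p_def)
    have pp: "pick J (p j) = k j" if "j < m" for j
      using that pick_img f_inv_into_f[of "k j" "pick J" "{..<m}"] by (simp add: p_def J_def)
    have "Det m f = Det m (\<lambda>j. column A (pick J (p j)))"
      by (rule Det_cong) (simp add: k pp)
    then have "\<bar>Det m f\<bar> = \<bar>Det m (\<lambda>j. column A (pick J j))\<bar>"
      using Det_permute_columns[OF perm, of "\<lambda>j. column A (pick J j)"] by simp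
    also have "\<dots> = of_int \<bar>det (submatrix A {..<m} J)\<bar>"
      using det_submatrix_columns[OF A subset_refl J(1) _ J(2)] by simp
    finally have "\<bar>Det m f\<bar> = of_int \<bar>det (submatrix A {..<m} J)\<bar>" .
    moreover have "\<bar>det (submatrix A {..<m} J)\<bar> \<in> dets"
      unfolding dets_def using J by (intro CollectI exI[of _ "{..<m}"] exI[of _ J]) simp
    ultimately show ?thesis by (rule bexI)
  qed
  obtain k0 where k0: "\<And>j. j < m \<Longrightarrow> k0 j < n" "Det m (\<lambda>j. column A (k0 j)) \<noteq> 0"
    using full_row_rank_basis[OF A rank] by blast
  have k0C: "column A (k0 j) \<in> columns A" if "j < m" for j using k0(1)[OF that] A by (auto simp: columns_def)
  obtain d0 where d0: "d0 \<in> dets" "\<bar>Det m (\<lambda>j. column A (k0 j))\<bar> = of_int d0" using covered[OF k0C k0(2)] by blast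
  have "d0 \<noteq> 0" using d0(2) k0(2) by auto
  moreover have "d0 \<ge> 0" using d0(1) by (auto simp: dets_def)
  ultimately have "d0 \<ge> 1" by simp
  then show pos: "max_subdet A \<ge> 1" using Max_ge[OF fin d0(1)] max by simp
  show "\<bar>Det m f\<bar> \<le> of_int (max_subdet A)" if "\<And>j. j < m \<Longrightarrow> f j \<in> columns A" for f
  proof (cases "Det m f = 0")
    case True
    then show ?thesis using pos by simp
  next
    case False
    then show ?thesis using covered[OF that False] Max_ge[OF fin] max by auto
  qed
  have "Max dets \<in> dets" using Max_in[OF fin] d0(1) by blast
  then obtain I J where IJ: "?P I J" "Max dets = \<bar>det (submatrix A I J)\<bar>" unfolding dets_def by blast
  have "column A (pick J j) \<in> columns A" if "j < m" for j
    using pick_in_set_le[of j J] that IJ A by (auto simp: columns_def)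
  moreover have "\<bar>Det m (\<lambda>j. column A (pick J j))\<bar> = of_int (max_subdet A)"
    using det_submatrix_columns[OF A, of I J] IJ max by simp
  ultimately show "\<exists>f. (\<forall>j<m. f j \<in> columns A) \<and> \<bar>Det m f\<bar> = of_int (max_subdet A)"
    by (intro exI[of _ "\<lambda>j. column A (pick J j)"]) simp
qed

definition vec_fun :: "nat \<Rightarrow> int vec \<Rightarrow> nat \<Rightarrow> real" where
  "vec_fun m v i = (if i < m then of_int (v $ i) else 0)"

lemma vec_fun_eq_iff: "v \<in> carrier_vec m \<Longrightarrow> w \<in> carrier_vec m \<Longrightarrow> vec_fun m v = vec_fun m w \<longleftrightarrow> v = w"
  by (auto simp: vec_fun_def fun_eq_iff intro!: eq_vecI split: if_splits)

lemma vec_fun_uminus: "v \<in> carrier_vec m \<Longrightarrow> vec_fun m (- v) = (\<lambda>i. - vec_fun m v i)"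
  by (auto simp: vec_fun_def fun_eq_iff)

lemma vec_fun_zero: "vec_fun m (0\<^sub>v m) = (\<lambda>_. 0)"
  by (auto simp: vec_fun_def)

lemma vec_fun_cols: "A \<in> carrier_mat m n \<Longrightarrow> vec_fun m ` set (cols A) = columns A"
proof -
  assume A: "A \<in> carrier_mat m n"
  have "vec_fun m (col A k) = column A k" if "k < n" for k
    using A that by (auto simp: vec_fun_def column_def fun_eq_iff)
  moreover have "set (cols A) = col A ` {..<n}" using A by (auto simp: cols_def)
  ultimately show ?thesis using A by (simp add: columns_def image_image)
qed

lemma differing_columns_set:
  "differing_columns m X \<Longrightarrow> X = mset_set (set_mset X) \<and> 0\<^sub>v m \<notin># X \<and>
     (\<forall>a\<in>#X. \<forall>b\<in>#X. a \<noteq> b \<longrightarrow> a \<noteq> - b)"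
proof -
  assume X: "differing_columns m X"
  have "count X a \<le> 1" for a
  proof (rule ccontr)
    assume "\<not> count X a \<le> 1"
    then have "{#a, a#} \<subseteq># X" by (simp add: subseteq_mset_def)
    then show False using X by (auto simp: differing_columns_def differ_def)
  qed
  then have "X = mset_set (set_mset X)"
    by (intro multiset_eqI) (simp add: count_mset_set' count_eq_zero_iff le_antisym Suc_le_eq)
  moreover have "a \<noteq> - b" if "a \<in># X" "b \<in># X" "a \<noteq> b" for a b
  proof -
    have "b \<in># X - {#a#}" using that by (simp add: in_diff_count)
    then have "{#a, b#} \<subseteq># X" using that(1) by (simp add: insert_subset_eq_iff)
    then show ?thesis using X by (auto simp: differing_columns_def differ_def)
  qed
  ultimately show ?thesis using X by (auto simp: differing_columns_def)
qed

lemma finite_num_differing: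
  "finite {size X | X. X \<subseteq># mset (cols A) \<and> differing_columns (dim_row A) X}"
proof (rule finite_subset)
  show "{size X | X. X \<subseteq># mset (cols A) \<and> differing_columns (dim_row A) X} \<subseteq> {..length (cols A)}"
    by (auto dest: size_mset_mono)
qed simp

lemma num_differing_bound:
  assumes m: "m \<ge> 1" and A: "A \<in> carrier_mat m n" "full_row_rank A" and D: "max_subdet A \<le> Delta"
  shows "2 * num_differing A \<le> (nat Delta)\<^sup>2 * (m * (m + 1))"
proof -
  let ?sizes = "{size X | X. X \<subseteq># mset (cols A) \<and> differing_columns (dim_row A) X}"
  have "size {#} \<in> ?sizes" by (auto simp: differing_columns_def)
  then have "num_differing A \<in> ?sizes"
    unfolding num_differing_def using Max_in[OF finite_num_differing[of A]] by blast
  then obtain X where X: "num_differing A = size X" "X \<subseteq># mset (cols A)" "differing_columns m X"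
    using A(1) by auto
  note Xset = differing_columns_set[OF X(3)]
  have XA: "set_mset X \<subseteq> set (cols A)" using X(2) by (metis set_mset_mono set_mset_mset)
  have dim: "v \<in> carrier_vec m" if "v \<in># X" for v using XA that cols_dim[of A] A(1) by auto
  have inj: "inj_on (vec_fun m) (set_mset X)" by (rule inj_onI) (simp add: vec_fun_eq_iff dim)
  define S where "S = vec_fun m ` set_mset X"
  have "size X = size (mset_set (set_mset X))" using Xset by simp
  then have cardS: "card S = num_differing A" using X(1) card_image[OF inj] by (simp add: S_def)
  obtain B where B: "\<And>j. j < m \<Longrightarrow> B j \<in> columns A" "\<bar>Det m B\<bar> = of_int (max_subdet A)"
    using max_subdet_attained[OF A] by blast
  have pos: "max_subdet A \<ge> 1" by (rule max_subdet_pos[OF A])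
  have "2 * card S \<le> (nat (max_subdet A))\<^sup>2 * (m * (m + 1))"
  proof (rule differing_columns_bound[OF m columns_int_vecs[OF A(1)] B(1)])
    show "\<bar>Det m B\<bar> = real (nat (max_subdet A))" "nat (max_subdet A) > 0" using B(2) pos by auto
    show "\<bar>Det m f\<bar> \<le> real (nat (max_subdet A))" if "\<And>j. j < m \<Longrightarrow> f j \<in> columns A" for f
      using max_subdet_ge[OF A that] pos by simp
    show "finite S" "S \<subseteq> columns A" using XA vec_fun_cols[OF A(1)] by (auto simp: S_def)
    show "(\<lambda>_. 0) \<notin> S"
    proof
      assume "(\<lambda>_. 0) \<in> S"
      then obtain v where v: "v \<in># X" "vec_fun m v = vec_fun m (0\<^sub>v m)" by (auto simp: S_def vec_fun_zero)
      then have "v = 0\<^sub>v m" using vec_fun_eq_iff[OF dim[OF v(1)]] by simp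
      then show False using Xset v by simp
    qed
    show "a \<noteq> (\<lambda>i. - b i)" if ab: "a \<in> S" "b \<in> S" "a \<noteq> b" for a b
    proof
      assume eq: "a = (\<lambda>i. - b i)"
      obtain v w where vw: "v \<in># X" "w \<in># X" "a = vec_fun m v" "b = vec_fun m w" using ab by (auto simp: S_def)
      then have "vec_fun m v = vec_fun m (- w)" using eq vec_fun_uminus[OF dim[OF vw(2)]] by simp
      then have "v = - w" using vec_fun_eq_iff[OF dim[OF vw(1)], of "- w"] dim[OF vw(2)] by simp
      moreover have "v \<noteq> w" using vw(3,4) ab(3) by blast
      ultimately show False using Xset vw(1,2) by blast
    qed
  qed
  also have "\<dots> \<le> (nat Delta)\<^sup>2 * (m * (m + 1))"
    using D by (intro mult_right_mono power_mono nat_mono) auto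
  finally show ?thesis using cardS by simp
qed

text \<open>The uniform bound on \<open>num_differing\<close> is what makes the maximum in the definition of the column number a
maximum over a finite set.\<close>

lemma col_number_bounds:
  assumes m: "m \<ge> 1" and A: "A \<in> carrier_mat m n" "full_row_rank A" "max_subdet A \<le> Delta"
  shows num_differing_le_col_number: "num_differing A \<le> col_number Delta m"
    and col_number_bound: "2 * col_number Delta m \<le> (nat Delta)\<^sup>2 * (m * (m + 1))"
proof -
  define N where "N = {num_differing A | A n. A \<in> carrier_mat m n \<and> full_row_rank A \<and> max_subdet A \<le> Delta}"
  have bound: "2 * k \<le> (nat Delta)\<^sup>2 * (m * (m + 1))" if "k \<in> N" for k
    using that num_differing_bound[OF m] unfolding N_def by blast
  have "N \<subseteq> {..(nat Delta)\<^sup>2 * (m * (m + 1))}"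
  proof
    fix k assume "k \<in> N"
    from bound[OF this] show "k \<in> {..(nat Delta)\<^sup>2 * (m * (m + 1))}" by simp
  qed
  then have fin: "finite N" by (rule finite_subset) simp
  have AN: "num_differing A \<in> N" unfolding N_def using A by blast
  have c: "col_number Delta m = Max N" by (simp add: col_number_def N_def)
  show "num_differing A \<le> col_number Delta m" unfolding c by (rule Max_ge[OF fin AN])
  have "Max N \<in> N" using Max_in[OF fin] AN by blast
  then show "2 * col_number Delta m \<le> (nat Delta)\<^sup>2 * (m * (m + 1))" unfolding c by (rule bound)
qed

text \<open>By maximality of a largest set of pairwise differing nonzero columns, every other nonzero column is the negative of a
member.\<close>

lemma distinct_columns_bound:
  assumes A: "A \<in> carrier_mat m n"
  shows "card (columns A) \<le> 2 * num_differing A + 1"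
proof -
  let ?P = "\<lambda>S. S \<subseteq> set (cols A) \<and> 0\<^sub>v m \<notin> S \<and> (\<forall>a\<in>S. \<forall>b\<in>S. a \<noteq> b \<longrightarrow> a \<noteq> - b)"
  have "?P {}" by simp
  moreover have "\<forall>S. ?P S \<longrightarrow> card S \<le> card (set (cols A))" by (auto intro: card_mono)
  ultimately have "\<exists>S. ?P S \<and> (\<forall>T. ?P T \<longrightarrow> card T \<le> card S)"
    by (intro ex_has_greatest_nat[of ?P "{}" card "Suc (card (set (cols A)))"]) (auto simp: less_Suc_eq_le)
  then obtain S where S: "?P S" "\<And>T. ?P T \<Longrightarrow> card T \<le> card S" by blast
  have finS: "finite S" using S(1) finite_subset by blast
  have dims: "v \<in> carrier_vec m" if "v \<in> set (cols A)" for v using that cols_dim[of A] A by auto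
  have cover: "v \<in> insert (0\<^sub>v m) (S \<union> uminus ` S)" if v: "v \<in> set (cols A)" for v
  proof (rule ccontr)
    assume n: "v \<notin> insert (0\<^sub>v m) (S \<union> uminus ` S)"
    have "v \<noteq> - b" "b \<noteq> - v" if b: "b \<in> S" for b
    proof -
      show "v \<noteq> - b" using n b by blast
      show "b \<noteq> - v"
      proof
        assume "b = - v"
        then have "v = - b" using uminus_uminus_vec[of v] by simp
        then show False using n b by blast
      qed
    qed
    then have "?P (insert v S)" using S(1) v n by auto
    from S(2)[OF this] show False using finS n by simp
  qed
  have "card (columns A) = card (set (cols A))"
  proof -
    have "inj_on (vec_fun m) (set (cols A))" by (rule inj_onI) (simp add: vec_fun_eq_iff dims)
    then show ?thesis using vec_fun_cols[OF A] card_image by metis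
  qed
  also have "\<dots> \<le> card (insert (0\<^sub>v m) (S \<union> uminus ` S))"
    using finS cover by (intro card_mono) auto
  also have "\<dots> \<le> card (S \<union> uminus ` S) + 1" using finS by (simp add: card_insert_if)
  also have "\<dots> \<le> 2 * card S + 1"
    using card_Un_le[of S "uminus ` S"] card_image_le[OF finS, of uminus] by simp
  also have "card S \<le> num_differing A"
  proof -
    have "differing_columns (dim_row A) (mset_set S)"
      unfolding differing_columns_def
    proof (intro conjI allI impI)
      fix a b assume ab: "{#a, b#} \<subseteq># mset_set S"
      then have in_S: "a \<in> S" "b \<in> S" using finS by (auto dest: mset_subset_eqD)
      have "a \<noteq> b"
      proof
        assume "a = b"
        then have "count {#a, b#} a \<le> count (mset_set S) a" using ab by (simp only: subseteq_mset_def)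
        then show False using \<open>a = b\<close> in_S finS by simp
      qed
      then show "differ a b" using S(1) in_S by (simp add: differ_def)
    next
      show "0\<^sub>v (dim_row A) \<notin># mset_set S" using S(1) A finS by simp
    qed
    moreover have "mset_set S \<subseteq># mset (cols A)"
    proof -
      have "mset_set S \<subseteq># mset_set (set (cols A))" using S(1) by (intro subset_imp_msubset_mset_set) auto
      also have "\<dots> \<subseteq># mset (cols A)" by (rule mset_set_set_mset_msubset[of "mset (cols A)", simplified])
      finally show ?thesis .
    qed
    ultimately show ?thesis
      unfolding num_differing_def using finS
      by (intro Max_ge[OF finite_num_differing]) (auto intro!: exI[of _ "mset_set S"])
  qed
  finally show ?thesis by simp
qed

section \<open>Integral relations between columns\<close>

definition relation :: "nat \<Rightarrow> (nat \<Rightarrow> real) set \<Rightarrow> ((nat \<Rightarrow> real) \<Rightarrow> real) \<Rightarrow> bool" where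
  "relation m T h \<longleftrightarrow> (\<forall>i<m. (\<Sum>a\<in>T. h a * a i) = 0)"

definition independent_columns :: "nat \<Rightarrow> (nat \<Rightarrow> real) set \<Rightarrow> bool" where
  "independent_columns m T \<longleftrightarrow> (\<forall>h. relation m T h \<longrightarrow> (\<forall>a\<in>T. h a = 0))"

lemma relation_supset:
  assumes "finite T" "S \<subseteq> T"
  shows "relation m T (\<lambda>a. if a \<in> S then h a else 0) \<longleftrightarrow> relation m S h"
proof -
  have "(\<Sum>a\<in>T. (if a \<in> S then h a else 0) * a i) = (\<Sum>a\<in>S. h a * a i)" for i
    using assms by (intro sum.mono_neutral_cong_right) auto
  then show ?thesis by (simp add: relation_def)
qed

lemma relation_diff:
  assumes "relation m T h" "relation m T k"
  shows "relation m T (\<lambda>a. h a - c * k a)"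
proof -
  have "(\<Sum>a\<in>T. (h a - c * k a) * a i) = (\<Sum>a\<in>T. h a * a i) - c * (\<Sum>a\<in>T. k a * a i)" for i
    by (simp add: sum_subtractf[symmetric] sum_distrib_left algebra_simps)
  then show ?thesis using assms by (simp add: relation_def)
qed

lemma independent_columns_subset:
  assumes "finite T" "S \<subseteq> T" "independent_columns m T"
  shows "independent_columns m S"
  unfolding independent_columns_def
proof (intro allI impI ballI)
  fix h a assume h: "relation m S h" and a: "a \<in> S"
  have "relation m T (\<lambda>a. if a \<in> S then h a else 0)" using h relation_supset[OF assms(1,2)] by blast
  then have "\<forall>a\<in>T. (if a \<in> S then h a else 0) = 0" using assms(3) unfolding independent_columns_def by blast
  then show "h a = 0" using a assms(2) by fastforce
qed

lemma Det_nonzero_inj: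
  assumes "Det m f \<noteq> 0"
  shows "inj_on f {..<m}"
proof (rule inj_onI, rule ccontr)
  fix i j assume ij: "i \<in> {..<m}" "j \<in> {..<m}" "f i = f j" "i \<noteq> j"
  have "Det m f = 0" by (rule Det_equal_columns[of i m j]) (use ij in auto)
  then show False using assms by simp
qed

text \<open>Steinitz exchange: a basis \<open>f\<close> that contains \<open>T\<close> represents \<open>t\<close> with a nonzero
coefficient at some column outside \<open>T\<close>, and this column can be replaced by \<open>t\<close>.\<close>

lemma independent_columns_extend:
  assumes C: "\<And>j. j < m \<Longrightarrow> B j \<in> C" "Det m B \<noteq> 0"
    and T: "finite T" "T \<subseteq> C" "independent_columns m T"
  obtains f where "\<And>j. j < m \<Longrightarrow> f j \<in> C" "Det m f \<noteq> 0" "T \<subseteq> f ` {..<m}"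
proof -
  have "\<exists>f. (\<forall>j<m. f j \<in> C) \<and> Det m f \<noteq> 0 \<and> T \<subseteq> f ` {..<m}"
    using T
  proof (induction T rule: finite_induct)
    case empty
    then show ?case using C by blast
  next
    case (insert t T)
    have "independent_columns m T"
      by (rule independent_columns_subset[OF _ _ insert.prems(2)]) (use insert in auto)
    then obtain f where f: "\<forall>j<m. f j \<in> C" "Det m f \<noteq> 0" "T \<subseteq> f ` {..<m}" using insert by auto
    define J where "J = {j. j < m \<and> f j \<in> T}"
    have inj: "inj_on f {..<m}" by (rule Det_nonzero_inj[OF f(2)])
    have fJ: "f ` J = T" using f(3) by (auto simp: J_def)
    have JS: "J \<subseteq> {..<m}" by (auto simp: J_def)
    have "\<exists>j<m. j \<notin> J \<and> coord m f t j \<noteq> 0"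
    proof (rule ccontr)
      assume no: "\<not> (\<exists>j<m. j \<notin> J \<and> coord m f t j \<noteq> 0)"
      define q where "q = inv_into {..<m} f"
      have q: "q (f j) = j" if "j < m" for j using inv_into_f_f[OF inj, of j] that by (simp add: q_def)
      define h where "h a = (if a = t then -1 else coord m f t (q a))" for a
      have "(\<Sum>a\<in>insert t T. h a * a i) = 0" if i: "i < m" for i
      proof -
        have "(\<Sum>a\<in>T. h a * a i) = (\<Sum>j\<in>J. h (f j) * f j i)"
          unfolding fJ[symmetric] by (rule sum.reindex[OF inj_on_subset[OF inj JS], unfolded o_def])
        also have "\<dots> = (\<Sum>j\<in>J. coord m f t j * f j i)"
        proof (rule sum.cong[OF refl])
          fix j assume j: "j \<in> J"
          then have "f j \<noteq> t" using insert.hyps(2) by (auto simp: J_def)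
          then show "h (f j) * f j i = coord m f t j * f j i" using q[of j] j by (simp add: h_def J_def)
        qed
        also have "\<dots> = (\<Sum>j<m. coord m f t j * f j i)"
          by (rule sum.mono_neutral_left) (use JS no in auto)
        also have "\<dots> = t i" by (rule coord_combination[OF f(2) i, symmetric])
        finally show ?thesis using insert.hyps by (simp add: h_def)
      qed
      then have "relation m (insert t T) h" by (simp add: relation_def)
      then have "\<forall>a\<in>insert t T. h a = 0" using insert.prems(2) unfolding independent_columns_def by blast
      then show False by (simp add: h_def)
    qed
    then obtain j where j: "j < m" "j \<notin> J" "coord m f t j \<noteq> 0" by blast
    have D: "Det m (f(j := t)) \<noteq> 0" using j by (auto simp: coord_def)
    have "T \<subseteq> f(j := t) ` {..<m}"
    proof
      fix a assume "a \<in> T"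
      then obtain k where k: "k \<in> J" "a = f k" using fJ by blast
      then have "k \<noteq> j" using j by blast
      then show "a \<in> f(j := t) ` {..<m}" using k JS by (intro image_eqI[of _ _ k]) auto
    qed
    moreover have "t \<in> f(j := t) ` {..<m}" using j by (intro image_eqI[of _ _ j]) auto
    moreover have "\<forall>k<m. (f(j := t)) k \<in> C" using f(1) insert.prems by simp
    ultimately show ?case using D by (intro exI[of _ "f(j := t)"] conjI insert_subsetI)
  qed
  then show ?thesis using that by blast
qed

lemma conformal_trans:
  assumes "(a::real) * b > 0" "b * c > 0"
  shows "a * c > 0"
  using assms by (auto simp: zero_less_mult_iff)

text \<open>A relation \<open>h\<close> inside the support that avoids \<open>c\<close> could be subtracted from \<open>y\<close>
until the first entry vanishes. No entry would change its sign, and the entry at \<open>c\<close> would stay, so the support would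
not be minimal.\<close>

lemma minimal_support_independent:
  fixes y :: "(nat \<Rightarrow> real) \<Rightarrow> real"
  assumes C: "finite C" and y: "relation m C y"
    and least: "\<And>y'. relation m C y' \<Longrightarrow> (\<exists>a\<in>C. y' a \<noteq> 0) \<Longrightarrow> (\<forall>a\<in>C. y' a \<noteq> 0 \<longrightarrow> y' a * y a > 0) \<Longrightarrow>
      card {a \<in> C. y a \<noteq> 0} \<le> card {a \<in> C. y' a \<noteq> 0}"
    and c: "c \<in> C" "y c \<noteq> 0"
  shows "independent_columns m ({a \<in> C. y a \<noteq> 0} - {c})"
  unfolding independent_columns_def
proof (intro allI impI ballI, rule ccontr)
  let ?T = "{a \<in> C. y a \<noteq> 0} - {c}"
  fix h0 a1 assume h0: "relation m ?T h0" and a1: "a1 \<in> ?T" "h0 a1 \<noteq> 0"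
  define s where "s = sgn (h0 a1 * y a1)"
  have s: "s * (h0 a1 * y a1) > 0" using a1 by (simp add: s_def sgn_if mult_less_0_iff zero_less_mult_iff) linarith
  define h where "h a = (if a \<in> ?T then s * h0 a else 0)" for a
  have "relation m ?T (\<lambda>a. s * h0 a)"
    using h0 by (simp add: relation_def mult.assoc sum_distrib_left[symmetric])
  then have h: "relation m C h"
    unfolding h_def using relation_supset[OF C, of ?T m "\<lambda>a. s * h0 a"] by blast
  define Q where "Q = {a \<in> ?T. h a * y a > 0}"
  have Q: "finite Q" "a1 \<in> Q" using C a1 s by (auto simp: Q_def h_def mult.assoc)
  define t where "t = Min ((\<lambda>a. y a / h a) ` Q)"
  have t_le: "t \<le> y a / h a" if "a \<in> Q" for a unfolding t_def using Q that by (intro Min_le) auto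
  have "t \<in> (\<lambda>a. y a / h a) ` Q" unfolding t_def using Q by (intro Min_in) auto
  then obtain a2 where a2: "a2 \<in> Q" "t = y a2 / h a2" by blast
  have t: "t > 0" using a2 by (auto simp: Q_def zero_less_divide_iff zero_less_mult_iff)
  define y' where "y' a = y a - t * h a" for a
  have rel: "relation m C y'" unfolding y'_def by (rule relation_diff[OF y h])
  have supp: "y a \<noteq> 0" if "a \<in> C" "y' a \<noteq> 0" for a using that by (auto simp: y'_def h_def split: if_splits)
  have conf: "y' a * y a > 0" if a: "a \<in> C" "y' a \<noteq> 0" for a
  proof -
    have ya: "y a \<noteq> 0" by (rule supp[OF a])
    have eq: "y' a * y a = y a * y a - t * (h a * y a)" by (simp add: y'_def algebra_simps)
    have "y' a * y a \<ge> 0"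
    proof (cases "a \<in> Q")
      case True
      then have p: "h a * y a > 0" by (simp add: Q_def)
      have "t * (h a * y a) \<le> y a / h a * (h a * y a)" by (rule mult_right_mono[OF t_le[OF True]]) (use p in simp)
      also have "\<dots> = y a * y a" using p by auto
      finally show ?thesis using eq by simp
    next
      case False
      then have "h a * y a \<le> 0" using a by (auto simp: Q_def h_def)
      then have "t * (h a * y a) \<le> 0" using t by (simp add: mult_nonneg_nonpos)
      then show ?thesis using eq zero_le_square[of "y a"] by linarith
    qed
    moreover have "y' a * y a \<noteq> 0" using a(2) ya by simp
    ultimately show ?thesis by (simp only: less_le) metis
  qed
  have "h c = 0" by (simp add: h_def)
  then have ex: "\<exists>a\<in>C. y' a \<noteq> 0" using c by (intro bexI[of _ c]) (simp_all add: y'_def)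
  have a2': "a2 \<in> C" "y a2 \<noteq> 0" "y' a2 = 0" using a2 by (auto simp: Q_def y'_def)
  have "{a \<in> C. y' a \<noteq> 0} \<subset> {a \<in> C. y a \<noteq> 0}" using supp a2' by blast
  then have "card {a \<in> C. y' a \<noteq> 0} < card {a \<in> C. y a \<noteq> 0}" by (rule psubset_card_mono[rotated]) (simp add: C)
  moreover have "card {a \<in> C. y a \<noteq> 0} \<le> card {a \<in> C. y' a \<noteq> 0}"
    by (rule least[OF rel ex]) (use conf in blast)
  ultimately show False by simp
qed

text \<open>Among the relations with signs conforming to \<open>y\<close> take one with minimal support. All but one of the
columns in its support extend to a basis \<open>f\<close>, and the coefficients are the coordinates of the remaining column
\<open>c\<close> with respect to \<open>f\<close>, up to a common factor. Scaled by \<open>|det f|\<close>, they are determinants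
by Cramer's rule, hence integers bounded by \<open>D\<close>.\<close>

lemma elementary_relation:
  fixes y :: "(nat \<Rightarrow> real) \<Rightarrow> real"
  assumes C: "finite C" "C \<subseteq> int_vecs m"
    and D: "\<And>f. (\<And>j. j < m \<Longrightarrow> f j \<in> C) \<Longrightarrow> \<bar>Det m f\<bar> \<le> D"
    and B: "\<And>j. j < m \<Longrightarrow> B j \<in> C" "Det m B \<noteq> 0"
    and y: "relation m C y" "\<exists>a\<in>C. y a \<noteq> 0"
  obtains g where "relation m C g" "\<exists>a\<in>C. g a \<noteq> 0" "\<And>a. a \<in> C \<Longrightarrow> g a \<in> \<int>"
    "\<And>a. a \<in> C \<Longrightarrow> g a \<noteq> 0 \<Longrightarrow> g a * y a > 0" "(\<Sum>a\<in>C. \<bar>g a\<bar>) \<le> real (m + 1) * D"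
proof -
  define P where "P y' \<longleftrightarrow> relation m C y' \<and> (\<exists>a\<in>C. y' a \<noteq> 0) \<and> (\<forall>a\<in>C. y' a \<noteq> 0 \<longrightarrow> y' a * y a > 0)" for y'
  have "y a * y a > 0" if "y a \<noteq> 0" for a using that by (simp add: zero_less_mult_iff) linarith
  then have "P y" using y by (simp add: P_def)
  then obtain y' where y': "P y'" "\<And>w. P w \<Longrightarrow> card {a \<in> C. y' a \<noteq> 0} \<le> card {a \<in> C. w a \<noteq> 0}"
    using ex_has_least_nat[of P y "\<lambda>w. card {a \<in> C. w a \<noteq> 0}"] by blast
  have rel: "relation m C y'" and conf: "\<And>a. a \<in> C \<Longrightarrow> y' a \<noteq> 0 \<Longrightarrow> y' a * y a > 0"
    using y'(1) unfolding P_def by blast+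
  obtain c where c: "c \<in> C" "y' c \<noteq> 0" using y'(1) unfolding P_def by blast
  define T where "T = {a \<in> C. y' a \<noteq> 0} - {c}"
  have T: "finite T" "T \<subseteq> C" "c \<notin> T" using C by (auto simp: T_def)
  have "independent_columns m T"
    unfolding T_def
  proof (rule minimal_support_independent[OF C(1) rel _ c])
    fix w assume w: "relation m C w" "\<exists>a\<in>C. w a \<noteq> 0" "\<forall>a\<in>C. w a \<noteq> 0 \<longrightarrow> w a * y' a > 0"
    have "w a * y a > 0" if a: "a \<in> C" "w a \<noteq> 0" for a
    proof -
      have p: "w a * y' a > 0" using w(3) a by blast
      then have "y' a \<noteq> 0" by auto
      then show ?thesis using conformal_trans[OF p conf[OF a(1)]] by simp
    qed
    then have "P w" using w by (simp add: P_def)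
    then show "card {a \<in> C. y' a \<noteq> 0} \<le> card {a \<in> C. w a \<noteq> 0}" by (rule y'(2))
  qed
  from independent_columns_extend[OF B T(1,2) this]
  obtain f where f: "\<And>j. j < m \<Longrightarrow> f j \<in> C" "Det m f \<noteq> 0" "T \<subseteq> f ` {..<m}" by blast
  define J where "J = {j. j < m \<and> f j \<in> T}"
  have inj: "inj_on f {..<m}" by (rule Det_nonzero_inj[OF f(2)])
  have fJ: "f ` J = T" using f(3) by (auto simp: J_def)
  have JS: "J \<subseteq> {..<m}" by (auto simp: J_def)
  have c_comb: "c i = (\<Sum>j<m. (if j \<in> J then - y' (f j) / y' c else 0) * f j i)" if i: "i < m" for i
  proof -
    have "0 = (\<Sum>a\<in>C. y' a * a i)" using rel i by (simp add: relation_def)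
    also have "\<dots> = (\<Sum>a\<in>insert c T. y' a * a i)"
      using C(1) c by (intro sum.mono_neutral_right) (auto simp: T_def)
    also have "\<dots> = y' c * c i + (\<Sum>a\<in>T. y' a * a i)" using T by simp
    also have "(\<Sum>a\<in>T. y' a * a i) = (\<Sum>j\<in>J. y' (f j) * f j i)"
      unfolding fJ[symmetric] by (rule sum.reindex[OF inj_on_subset[OF inj JS], unfolded o_def])
    finally have "c i = - (\<Sum>j\<in>J. y' (f j) * f j i) / y' c" using c(2) by (simp add: field_simps)
    also have "\<dots> = (\<Sum>j\<in>J. - y' (f j) / y' c * f j i)" 
      by (simp add: sum_negf sum_divide_distrib)
    also have "\<dots> = (\<Sum>j<m. (if j \<in> J then - y' (f j) / y' c else 0) * f j i)"
      using JS by (intro sum.mono_neutral_cong_left) auto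
    finally show ?thesis .
  qed
  have coord: "Det m (f(j := c)) / Det m f = - y' (f j) / y' c" if j: "j \<in> J" for j
  proof -
    have "coord m f c j = (if j \<in> J then - y' (f j) / y' c else 0)"
      by (rule coord_unique[OF f(2) c_comb]) (use j JS in auto)
    then show ?thesis using j JS by (auto simp: coord_def)
  qed
  define s where "s = \<bar>Det m f\<bar> / \<bar>y' c\<bar>"
  have s: "s > 0" using f(2) c(2) by (simp add: s_def)
  define g where "g a = s * y' a" for a
  have small: "\<bar>g a\<bar> \<le> D \<and> g a \<in> \<int>" if a: "a \<in> insert c T" for a
  proof -
    have "\<exists>e. (\<forall>j<m. e j \<in> C) \<and> \<bar>g a\<bar> = \<bar>Det m e\<bar>"
    proof (cases "a = c")
      case True
      then show ?thesis using f c(2) by (intro exI[of _ f]) (simp add: g_def s_def abs_mult)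
    next
      case False
      then obtain j where j: "j \<in> J" "a = f j" using a fJ by blast
      have "\<bar>Det m (f(j := c))\<bar> = \<bar>y' a\<bar> / \<bar>y' c\<bar> * \<bar>Det m f\<bar>"
        using arg_cong[OF coord[OF j(1)], of abs] f(2) j(2) by (simp add: abs_divide field_simps)
      then show ?thesis using f(1) c(1)
        by (intro exI[of _ "f(j := c)"]) (simp add: g_def s_def abs_mult field_simps)
    qed
    then obtain e where e: "\<And>j. j < m \<Longrightarrow> e j \<in> C" "\<bar>g a\<bar> = \<bar>Det m e\<bar>" by blast
    have "Det m e \<in> \<int>"
      by (rule Det_Ints) (use e(1) C(2) in \<open>force simp: int_vecs_def\<close>)
    then have "\<bar>g a\<bar> \<in> \<int>" using e(2) by (simp add: Ints_abs)
    then have "g a \<in> \<int>" by (cases "g a \<ge> 0") (auto simp: abs_if minus_in_Ints_iff split: if_splits)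
    then show ?thesis using D[OF e(1)] e(2) by simp
  qed
  have zero: "g a = 0" if "a \<in> C" "a \<notin> insert c T" for a using that by (simp add: g_def T_def)
  have subs: "insert c T \<subseteq> C" using T c by simp
  show ?thesis
  proof
    show "relation m C g" using rel by (simp add: relation_def g_def mult.assoc sum_distrib_left[symmetric])
    show "\<exists>a\<in>C. g a \<noteq> 0" using c s by (auto simp: g_def)
    show "g a \<in> \<int>" if "a \<in> C" for a using small[of a] zero[OF that] by (cases "a \<in> insert c T") auto
    show "g a * y a > 0" if "a \<in> C" "g a \<noteq> 0" for a
      using conf[OF that(1)] that(2) s by (auto simp: g_def mult.assoc)
    have "(\<Sum>a\<in>C. \<bar>g a\<bar>) = (\<Sum>a\<in>insert c T. \<bar>g a\<bar>)"
      using C(1) subs zero by (intro sum.mono_neutral_right) auto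
    also have "\<dots> \<le> real (card (insert c T)) * D"
      by (rule sum_bounded_above) (use small in blast)
    also have "\<dots> \<le> real (m + 1) * D"
    proof (rule mult_right_mono)
      have "card T \<le> m" using card_mono[OF _ f(3)] card_image_le[of "{..<m}" f] by simp
      then show "real (card (insert c T)) \<le> real (m + 1)" using T by simp
      show "D \<ge> 0" using D[of B] B(1) abs_ge_zero[of "Det m B"] by (meson order_trans)
    qed
    finally show "(\<Sum>a\<in>C. \<bar>g a\<bar>) \<le> real (m + 1) * D" .
  qed
qed

lemma conformal_step:
  assumes "(g::real) * y \<ge> 0" "0 \<le> t" "t * \<bar>g\<bar> \<le> \<bar>y\<bar>"
  shows "\<bar>y - t * g\<bar> = \<bar>y\<bar> - t * \<bar>g\<bar>"
proof (cases "g = 0")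
  case False
  show ?thesis
  proof (cases "g > 0")
    case True
    then show ?thesis using assms by (simp add: zero_le_mult_iff)
  next
    case neg: False
    then have "g < 0" using False by simp
    moreover have "y \<le> 0" using assms(1) \<open>g < 0\<close> by (simp add: zero_le_mult_iff)
    ultimately show ?thesis using assms(3) by simp
  qed
qed simp

text \<open>Subtract the largest multiple \<open>t g\<close> of an elementary relation that changes no sign. If \<open>t \<ge>
1\<close>, the relation \<open>g\<close> itself is small enough. If \<open>t < 1\<close>, the norm decreases by at most \<open>(m
+ 1) D\<close> and the support shrinks, so the hypothesis persists. Nor does a step with \<open>t < 1\<close> use up everything,
because then \<open>y = t g\<close> would have norm less than \<open>(m + 1) D\<close>.\<close>

lemma conformal_integral_relation:
  fixes y :: "(nat \<Rightarrow> real) \<Rightarrow> real"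
  assumes C: "finite C" "C \<subseteq> int_vecs m"
    and D: "\<And>f. (\<And>j. j < m \<Longrightarrow> f j \<in> C) \<Longrightarrow> \<bar>Det m f\<bar> \<le> D"
    and B: "\<And>j. j < m \<Longrightarrow> B j \<in> C" "Det m B \<noteq> 0"
    and "relation m C y" "\<exists>a\<in>C. y a \<noteq> 0"
    and "(\<Sum>a\<in>C. \<bar>y a\<bar>) \<ge> real (card {a \<in> C. y a \<noteq> 0}) * (real (m + 1) * D)"
  shows "\<exists>g. relation m C g \<and> (\<exists>a\<in>C. g a \<noteq> 0) \<and>
    (\<forall>a\<in>C. g a \<in> \<int> \<and> g a * y a \<ge> 0 \<and> \<bar>g a\<bar> \<le> \<bar>y a\<bar>)"
  using assms(6-8)
proof (induction "card {a \<in> C. y a \<noteq> 0}" arbitrary: y rule: less_induct)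
  case less
  define M where "M = real (m + 1) * D"
  have y_large: "(\<Sum>a\<in>C. \<bar>y a\<bar>) \<ge> real (card {a \<in> C. y a \<noteq> 0}) * M"
    using less.prems(3) unfolding M_def .
  obtain g where g: "relation m C g" "\<exists>a\<in>C. g a \<noteq> 0" "\<And>a. a \<in> C \<Longrightarrow> g a \<in> \<int>"
    "\<And>a. a \<in> C \<Longrightarrow> g a \<noteq> 0 \<Longrightarrow> g a * y a > 0" "(\<Sum>a\<in>C. \<bar>g a\<bar>) \<le> M"
    using elementary_relation[OF C D B less.prems(1,2)] unfolding M_def by blast
  have g0: "g a * y a \<ge> 0" if "a \<in> C" for a using g(4)[OF that] by (cases "g a = 0") auto
  show ?case
  proof (cases "\<forall>a\<in>C. \<bar>g a\<bar> \<le> \<bar>y a\<bar>")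
    case True
    then show ?thesis using g(1,2,3) g0 by blast
  next
    case False
    define G where "G = {a \<in> C. g a \<noteq> 0}"
    have G: "finite G" "G \<noteq> {}" using C(1) g(2) by (auto simp: G_def)
    define t where "t = Min ((\<lambda>a. \<bar>y a\<bar> / \<bar>g a\<bar>) ` G)"
    have t_le: "t * \<bar>g a\<bar> \<le> \<bar>y a\<bar>" if a: "a \<in> C" for a
    proof (cases "g a = 0")
      case False
      then have "t \<le> \<bar>y a\<bar> / \<bar>g a\<bar>" unfolding t_def using G a by (intro Min_le) (auto simp: G_def)
      then show ?thesis using False by (simp add: pos_le_divide_eq)
    qed simp
    have "t \<in> (\<lambda>a. \<bar>y a\<bar> / \<bar>g a\<bar>) ` G" unfolding t_def using G by (intro Min_in) auto
    then obtain a2 where a2: "a2 \<in> G" "t = \<bar>y a2\<bar> / \<bar>g a2\<bar>" by blast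
    have t0: "t \<ge> 0" using a2(2) by simp
    obtain a3 where a3: "a3 \<in> C" "\<bar>g a3\<bar> > \<bar>y a3\<bar>" using False by force
    have t1: "t < 1"
    proof (rule ccontr)
      assume "\<not> t < 1"
      then have "1 * \<bar>g a3\<bar> \<le> t * \<bar>g a3\<bar>" by (intro mult_right_mono) auto
      then show False using t_le[OF a3(1)] a3(2) by linarith
    qed
    define w where "w a = y a - t * g a" for a
    have abs_w: "\<bar>w a\<bar> = \<bar>y a\<bar> - t * \<bar>g a\<bar>" if "a \<in> C" for a
      unfolding w_def by (rule conformal_step[OF g0[OF that] t0 t_le[OF that]])
    have rel: "relation m C w" unfolding w_def by (rule relation_diff[OF less.prems(1) g(1)])
    have sum_w: "(\<Sum>a\<in>C. \<bar>w a\<bar>) = (\<Sum>a\<in>C. \<bar>y a\<bar>) - t * (\<Sum>a\<in>C. \<bar>g a\<bar>)"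
      by (simp add: abs_w sum_subtractf sum_distrib_left)
    have K0: "M \<ge> 0" by (rule order_trans[OF sum_nonneg g(5)]) simp
    have tg: "t * (\<Sum>a\<in>C. \<bar>g a\<bar>) \<le> t * M" by (rule mult_left_mono[OF g(5) t0])
    have abs_w_le: "\<bar>w a\<bar> \<le> \<bar>y a\<bar>" if "a \<in> C" for a
    proof -
      have "0 \<le> t * \<bar>g a\<bar>" using t0 by simp
      then show ?thesis using abs_w[OF that] by simp
    qed
    have supp: "y a \<noteq> 0" if "a \<in> C" "w a \<noteq> 0" for a
      using abs_w_le[OF that(1)] that(2) by auto
    have a2': "a2 \<in> C" "y a2 \<noteq> 0" "w a2 = 0"
    proof -
      show "a2 \<in> C" using a2 by (simp add: G_def)
      show "y a2 \<noteq> 0" using a2(1) g(4)[of a2] by (auto simp: G_def)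
      show "w a2 = 0" using abs_w[of a2] a2 by (simp add: G_def)
    qed
    have psub: "{a \<in> C. w a \<noteq> 0} \<subset> {a \<in> C. y a \<noteq> 0}" using supp a2' by blast
    have fin: "finite {a \<in> C. y a \<noteq> 0}" using C(1) by simp
    have smaller: "card {a \<in> C. w a \<noteq> 0} < card {a \<in> C. y a \<noteq> 0}" by (rule psubset_card_mono[OF fin psub])
    then have "real (card {a \<in> C. w a \<noteq> 0}) * M \<le> (real (card {a \<in> C. y a \<noteq> 0}) - 1) * M"
      using K0 by (intro mult_right_mono) auto
    moreover have "t * M \<le> M" using t1 K0 t0 by (simp add: mult_left_le_one_le)
    ultimately have large: "(\<Sum>a\<in>C. \<bar>w a\<bar>) \<ge> real (card {a \<in> C. w a \<noteq> 0}) * M"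
      using sum_w tg y_large by (simp add: left_diff_distrib)
    have ex: "\<exists>a\<in>C. w a \<noteq> 0"
    proof (rule ccontr)
      assume "\<not> (\<exists>a\<in>C. w a \<noteq> 0)"
      then have "(\<Sum>a\<in>C. \<bar>y a\<bar>) = t * (\<Sum>a\<in>C. \<bar>g a\<bar>)" using sum_w by simp
      moreover obtain a0 where g0': "a0 \<in> C" "g a0 \<noteq> 0" using g(2) by blast
      have "(\<Sum>a\<in>C. \<bar>g a\<bar>) > 0"
        by (rule sum_pos2[OF C(1) g0'(1)]) (use g0'(2) in auto)
      then have "t * (\<Sum>a\<in>C. \<bar>g a\<bar>) < 1 * (\<Sum>a\<in>C. \<bar>g a\<bar>)" using t1 by (rule mult_strict_right_mono[rotated])
      ultimately have "(\<Sum>a\<in>C. \<bar>y a\<bar>) < M" using g(5) by linarith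
      moreover have "1 * M \<le> real (card {a \<in> C. y a \<noteq> 0}) * M"
        using smaller K0 by (intro mult_right_mono) auto
      ultimately show False using y_large by linarith
    qed
    from less.hyps[OF smaller rel ex large[unfolded M_def]] obtain g' where g': "relation m C g'" "\<exists>a\<in>C. g' a \<noteq> 0"
      "\<forall>a\<in>C. g' a \<in> \<int> \<and> g' a * w a \<ge> 0 \<and> \<bar>g' a\<bar> \<le> \<bar>w a\<bar>" by blast
    have "g' a * y a \<ge> 0 \<and> \<bar>g' a\<bar> \<le> \<bar>y a\<bar>" if a: "a \<in> C" for a
    proof
      show "\<bar>g' a\<bar> \<le> \<bar>y a\<bar>" using bspec[OF g'(3) a] abs_w_le[OF a] by linarith
      show "g' a * y a \<ge> 0"
      proof (cases "w a = 0")
        case True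
        then show ?thesis using g'(3) a by fastforce
      next
        case False
        have y: "y a \<noteq> 0" by (rule supp[OF a False])
        have "w a * y a \<ge> 0"
        proof -
          have "t * \<bar>g a\<bar> * \<bar>y a\<bar> \<le> \<bar>y a\<bar> * \<bar>y a\<bar>" by (rule mult_right_mono[OF t_le[OF a]]) simp
          moreover have "\<bar>g a\<bar> * \<bar>y a\<bar> = g a * y a" using g0[OF a] by (simp add: abs_mult[symmetric])
          ultimately have "t * (g a * y a) \<le> y a * y a" by (simp add: mult.assoc)
          then show ?thesis by (simp add: w_def algebra_simps)
        qed
        then show ?thesis using g'(3) a False y by (auto simp: zero_le_mult_iff)
      qed
    qed
    then show ?thesis using g' by blast
  qed
qed

lemma split_int_sum:
  fixes N :: "'k \<Rightarrow> int"
  assumes "finite K" "\<And>k. k \<in> K \<Longrightarrow> 0 \<le> N k" "0 \<le> g" "g \<le> sum N K"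
  shows "\<exists>h. (\<forall>k\<in>K. 0 \<le> h k \<and> h k \<le> N k) \<and> sum h K = g"
  using assms
proof (induction K arbitrary: g rule: finite_induct)
  case (insert k K)
  define c where "c = min g (N k)"
  have c: "0 \<le> c" "c \<le> N k" "c \<le> g" using insert.prems by (auto simp: c_def)
  have "g - c \<le> sum N K"
  proof (cases "g \<le> N k")
    case True
    then show ?thesis using insert.prems(1) by (simp add: c_def sum_nonneg)
  next
    case False
    then show ?thesis using insert by (simp add: c_def)
  qed
  then obtain h where h: "\<forall>k\<in>K. 0 \<le> h k \<and> h k \<le> N k" "sum h K = g - c"
    using insert.IH[of "g - c"] insert.prems(1) c by auto
  have "sum (h(k := c)) K = sum h K" using insert.hyps(2) by (intro sum.cong) auto
  then show ?case using insert.hyps h c by (intro exI[of _ "h(k := c)"]) auto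
qed simp

text \<open>With at most one fractional number among the \<open>y k\<close>, rounding all of them down changes the sum by less
than 1, so the integer \<open>g\<close> does not exceed the sum of the rounded numbers.\<close>

lemma round_down_split:
  fixes y :: "'k \<Rightarrow> real"
  assumes K: "finite K" and y: "\<And>k. k \<in> K \<Longrightarrow> 0 \<le> y k"
    and one: "\<And>j k. j \<in> K \<Longrightarrow> k \<in> K \<Longrightarrow> j \<noteq> k \<Longrightarrow> y j \<in> \<int> \<or> y k \<in> \<int>"
    and g: "g \<in> \<int>" "0 \<le> g" "g \<le> sum y K"
  shows "\<exists>h. (\<forall>k\<in>K. h k \<in> \<int> \<and> 0 \<le> h k \<and> h k \<le> y k) \<and> sum h K = g"
proof -
  obtain G where G: "g = of_int G" using g(1) by (auto elim: Ints_cases)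
  have "sum y K < (\<Sum>k\<in>K. of_int \<lfloor>y k\<rfloor>) + 1"
  proof (cases "\<exists>k\<in>K. y k \<notin> \<int>")
    case True
    then obtain k where k: "k \<in> K" "y k \<notin> \<int>" by blast
    have rest: "(\<Sum>j\<in>K - {k}. y j) = (\<Sum>j\<in>K - {k}. of_int \<lfloor>y j\<rfloor>)"
    proof (rule sum.cong[OF refl])
      fix j assume j: "j \<in> K - {k}"
      then have "y j \<in> \<int>" using one[OF k(1), of j] k(2) by blast
      then show "y j = of_int \<lfloor>y j\<rfloor>" by (simp add: of_int_floor_cancel)
    qed
    have "sum y K = y k + (\<Sum>j\<in>K - {k}. y j)" by (rule sum.remove[OF K k(1)])
    moreover have "(\<Sum>j\<in>K. real_of_int \<lfloor>y j\<rfloor>) = of_int \<lfloor>y k\<rfloor> + (\<Sum>j\<in>K - {k}. of_int \<lfloor>y j\<rfloor>)"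
      by (rule sum.remove[OF K k(1)])
    ultimately show ?thesis using rest real_of_int_floor_add_one_gt[of "y k"] by linarith
  next
    case False
    then have "sum y K = (\<Sum>k\<in>K. of_int \<lfloor>y k\<rfloor>)" by (intro sum.cong) (auto simp: of_int_floor_cancel)
    then show ?thesis by simp
  qed
  then have "real_of_int G < of_int ((\<Sum>k\<in>K. \<lfloor>y k\<rfloor>) + 1)" using g(3) G by simp
  then have "G \<le> (\<Sum>k\<in>K. \<lfloor>y k\<rfloor>)" by (simp only: of_int_less_iff)
  then obtain h where h: "\<forall>k\<in>K. 0 \<le> h k \<and> h k \<le> \<lfloor>y k\<rfloor>" "sum h K = G"
    using split_int_sum[OF K, of "\<lambda>k. \<lfloor>y k\<rfloor>" G] y g(2) G by auto
  have "real_of_int (h k) \<le> y k" if "k \<in> K" for k using h(1) that le_floor_iff by blast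
  then show ?thesis using h G by (intro exI[of _ "\<lambda>k. of_int (h k)"]) (auto simp flip: of_int_sum)
qed

lemma conformal_split:
  fixes y :: "'k \<Rightarrow> real"
  assumes K: "finite K" and sign: "(\<forall>k\<in>K. 0 \<le> y k) \<or> (\<forall>k\<in>K. y k \<le> 0)"
    and one: "\<And>j k. j \<in> K \<Longrightarrow> k \<in> K \<Longrightarrow> j \<noteq> k \<Longrightarrow> y j \<in> \<int> \<or> y k \<in> \<int>"
    and g: "g \<in> \<int>" "0 \<le> g * sum y K" "\<bar>g\<bar> \<le> \<bar>sum y K\<bar>"
  shows "\<exists>h. (\<forall>k\<in>K. h k \<in> \<int> \<and> 0 \<le> h k * y k \<and> \<bar>h k\<bar> \<le> \<bar>y k\<bar>) \<and> sum h K = g"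
proof -
  have pos: "\<exists>h. (\<forall>k\<in>K. h k \<in> \<int> \<and> 0 \<le> h k * w k \<and> \<bar>h k\<bar> \<le> \<bar>w k\<bar>) \<and> sum h K = g'"
    if w: "\<forall>k\<in>K. 0 \<le> w k" and one: "\<And>j k. j \<in> K \<Longrightarrow> k \<in> K \<Longrightarrow> j \<noteq> k \<Longrightarrow> w j \<in> \<int> \<or> w k \<in> \<int>"
      and g': "g' \<in> \<int>" "0 \<le> g' * sum w K" "\<bar>g'\<bar> \<le> \<bar>sum w K\<bar>" for w :: "'k \<Rightarrow> real" and g'
  proof -
    have s: "sum w K \<ge> 0" by (rule sum_nonneg) (rule bspec[OF w])
    have g0: "0 \<le> g'" using g'(2,3) s by (cases "sum w K = 0") (auto simp: zero_le_mult_iff)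
    have g1: "g' \<le> sum w K" using g'(3) s by simp
    have "\<exists>h. (\<forall>k\<in>K. h k \<in> \<int> \<and> 0 \<le> h k \<and> h k \<le> w k) \<and> sum h K = g'"
    proof (rule round_down_split[OF K _ _ g'(1) g0 g1])
      show "0 \<le> w k" if "k \<in> K" for k using w that by blast
      show "w j \<in> \<int> \<or> w k \<in> \<int>" if "j \<in> K" "k \<in> K" "j \<noteq> k" for j k by (rule one[OF that])
    qed
    then obtain h where h: "\<forall>k\<in>K. h k \<in> \<int> \<and> 0 \<le> h k \<and> h k \<le> w k" "sum h K = g'" by (elim exE conjE)
    have "h k \<in> \<int> \<and> 0 \<le> h k * w k \<and> \<bar>h k\<bar> \<le> \<bar>w k\<bar>" if "k \<in> K" for k
      using bspec[OF h(1) that] bspec[OF w that] by simp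
    then show ?thesis using h(2) by (intro exI[of _ h]) simp
  qed
  from sign show ?thesis
  proof
    assume "\<forall>k\<in>K. 0 \<le> y k"
    then show ?thesis by (rule pos[OF _ one g])
  next
    assume "\<forall>k\<in>K. y k \<le> 0"
    then have "\<forall>k\<in>K. 0 \<le> - y k" by simp
    moreover have "- y j \<in> \<int> \<or> - y k \<in> \<int>" if "j \<in> K" "k \<in> K" "j \<noteq> k" for j k
      using one[OF that] by (simp add: minus_in_Ints_iff)
    moreover have "- g \<in> \<int>" "0 \<le> - g * (\<Sum>k\<in>K. - y k)" "\<bar>- g\<bar> \<le> \<bar>\<Sum>k\<in>K. - y k\<bar>"
      using g by (simp_all add: sum_negf minus_in_Ints_iff)
    ultimately have "\<exists>h. (\<forall>k\<in>K. h k \<in> \<int> \<and> 0 \<le> h k * - y k \<and> \<bar>h k\<bar> \<le> \<bar>- y k\<bar>) \<and> sum h K = - g"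
      by (rule pos)
    then obtain h where h: "\<forall>k\<in>K. h k \<in> \<int> \<and> 0 \<le> h k * - y k \<and> \<bar>h k\<bar> \<le> \<bar>- y k\<bar>" "sum h K = - g"
      by (elim exE conjE)
    then show ?thesis by (intro exI[of _ "\<lambda>k. - h k"]) (simp add: sum_negf minus_in_Ints_iff)
  qed
qed

text \<open>Here \<open>y\<close> stands for the difference between the closest integer point and the vertex. An integral step
\<open>h\<close> is admissible if it goes towards the vertex in every entry and overshoots it by less than 1, which never violates
integral bounds. The assumption \<open>closest\<close> says that no admissible step decreases the distance. It is used twice: a
step that shifts one unit between two equal columns shows that the entries of \<open>y\<close> at equal columns have the same
sign, and a step that stems from an integral relation between the distinct columns shows that \<open>y\<close> is short.\<close>

lemma proximity_core:
  fixes y :: "nat \<Rightarrow> real" and col :: "nat \<Rightarrow> nat \<Rightarrow> real" and n :: nat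
  defines "C \<equiv> col ` {..<n}"
  assumes C: "C \<subseteq> int_vecs m"
    and D: "\<And>f. (\<And>j. j < m \<Longrightarrow> f j \<in> C) \<Longrightarrow> \<bar>Det m f\<bar> \<le> D"
    and B: "\<And>j. j < m \<Longrightarrow> B j \<in> C" "Det m B \<noteq> 0"
    and y: "\<And>i. i < m \<Longrightarrow> (\<Sum>j<n. y j * col j i) = 0"
    and one: "\<And>j k. j < n \<Longrightarrow> k < n \<Longrightarrow> j \<noteq> k \<Longrightarrow> col j = col k \<Longrightarrow> y j \<in> \<int> \<or> y k \<in> \<int>"
    and closest: "\<And>h. (\<forall>j<n. h j \<in> \<int> \<and> (h j \<noteq> 0 \<longrightarrow> h j * y j > 0 \<and> \<bar>h j\<bar> < \<bar>y j\<bar> + 1)) \<Longrightarrow>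
      (\<forall>i<m. (\<Sum>j<n. h j * col j i) = 0) \<Longrightarrow> (\<Sum>j<n. \<bar>y j\<bar>) \<le> (\<Sum>j<n. \<bar>y j - h j\<bar>)"
  shows "(\<Sum>j<n. \<bar>y j\<bar>) \<le> real (card C) * (real (m + 1) * D)"
proof (rule ccontr)
  assume "\<not> ?thesis"
  then have large: "(\<Sum>j<n. \<bar>y j\<bar>) > real (card C) * (real (m + 1) * D)" by simp
  have finC: "finite C" by (simp add: C_def)
  define K where "K a = {j \<in> {..<n}. col j = a}" for a
  have finK: "finite (K a)" for a by (simp add: K_def)
  have group: "(\<Sum>j<n. f j) = (\<Sum>a\<in>C. sum f (K a))" for f :: "nat \<Rightarrow> real"
    unfolding C_def K_def by (rule sum.image_gen) simp
  have same_sign: "\<not> (y j > 0 \<and> y k < 0)" if jk: "j < n" "k < n" "col j = col k" for j k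
  proof
    assume s: "y j > 0 \<and> y k < 0"
    then have ne: "j \<noteq> k" by auto
    define h where "h l = (if l = j then 1 else if l = k then -1 else (0::real))" for l
    have sum_h: "(\<Sum>l<n. h l * c l) = c j - c k" for c :: "nat \<Rightarrow> real"
    proof -
      have "(\<Sum>l<n. h l * c l) = (\<Sum>l\<in>{j, k}. h l * c l)"
        by (rule sum.mono_neutral_right) (use jk in \<open>auto simp: h_def\<close>)
      then show ?thesis using ne by (simp add: h_def)
    qed
    have dist: "(\<Sum>l<n. \<bar>y l\<bar>) \<le> (\<Sum>l<n. \<bar>y l - h l\<bar>)"
    proof (rule closest)
      show "\<forall>l<n. h l \<in> \<int> \<and> (h l \<noteq> 0 \<longrightarrow> h l * y l > 0 \<and> \<bar>h l\<bar> < \<bar>y l\<bar> + 1)"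
        using s by (auto simp: h_def)
      show "\<forall>i<m. (\<Sum>l<n. h l * col l i) = 0" using sum_h[of "\<lambda>l. col l i" for i] jk(3) by simp
    qed
    have split: "(\<Sum>l<n. f l) = f j + f k + (\<Sum>l\<in>{..<n} - {j, k}. f l)" for f :: "nat \<Rightarrow> real"
    proof -
      have "(\<Sum>l<n. f l) = (\<Sum>l\<in>{..<n} - {j, k}. f l) + (\<Sum>l\<in>{j, k}. f l)"
        by (rule sum.subset_diff) (use jk in auto)
      then show ?thesis using ne by simp
    qed
    have "(\<Sum>l\<in>{..<n} - {j, k}. \<bar>y l - h l\<bar>) = (\<Sum>l\<in>{..<n} - {j, k}. \<bar>y l\<bar>)"
      by (rule sum.cong) (auto simp: h_def)
    then have "\<bar>y j\<bar> + \<bar>y k\<bar> \<le> \<bar>y j - 1\<bar> + \<bar>y k + 1\<bar>"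
      using dist split[of "\<lambda>l. \<bar>y l\<bar>"] split[of "\<lambda>l. \<bar>y l - h l\<bar>"] ne by (simp add: h_def)
    then have big: "\<not> y j \<ge> 1" "\<not> y k \<le> -1" using s by auto
    from one[OF jk(1,2) ne jk(3)] show False
    proof
      assume "y j \<in> \<int>"
      then show False using big s by (auto elim!: Ints_cases)
    next
      assume "y k \<in> \<int>"
      then show False using big s by (auto elim!: Ints_cases)
    qed
  qed
  have sign: "(\<forall>j\<in>K a. 0 \<le> y j) \<or> (\<forall>j\<in>K a. y j \<le> 0)" for a
  proof (rule ccontr)
    assume "\<not> ?thesis"
    then obtain j k where "j \<in> K a" "k \<in> K a" "y j < 0" "y k > 0" by (auto simp: not_le)
    then show False using same_sign[of k j] by (simp add: K_def)
  qed
  define Y where "Y a = sum y (K a)" for a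
  have absY: "\<bar>Y a\<bar> = (\<Sum>j\<in>K a. \<bar>y j\<bar>)" for a
    using sign[of a]
  proof
    assume "\<forall>j\<in>K a. 0 \<le> y j"
    then show ?thesis by (simp add: Y_def sum_nonneg cong: sum.cong)
  next
    assume s: "\<forall>j\<in>K a. y j \<le> 0"
    then have "(\<Sum>j\<in>K a. \<bar>y j\<bar>) = - Y a" by (simp add: Y_def sum_negf[symmetric] cong: sum.cong)
    moreover have "Y a \<le> 0" unfolding Y_def using s by (intro sum_nonpos) auto
    ultimately show ?thesis by simp
  qed
  have relation_group: "(\<Sum>j<n. h j * col j i) = (\<Sum>a\<in>C. sum h (K a) * a i)" for h :: "nat \<Rightarrow> real" and i
  proof -
    have "(\<Sum>j\<in>K a. h j * col j i) = sum h (K a) * a i" for a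
      unfolding sum_distrib_right by (rule sum.cong) (auto simp: K_def)
    then show ?thesis by (simp add: group)
  qed
  have relY: "relation m C Y" using y relation_group[of y] by (simp add: relation_def Y_def)
  have sumY: "(\<Sum>a\<in>C. \<bar>Y a\<bar>) = (\<Sum>j<n. \<bar>y j\<bar>)" by (simp add: group absY)
  have D0: "D \<ge> 0" by (rule order_trans[OF abs_ge_zero D[OF B(1)]])
  have exY: "\<exists>a\<in>C. Y a \<noteq> 0"
  proof (rule ccontr)
    assume "\<not> (\<exists>a\<in>C. Y a \<noteq> 0)"
    then have "(\<Sum>a\<in>C. \<bar>Y a\<bar>) = 0" by simp
    moreover have "real (card C) * (real (m + 1) * D) \<ge> 0" using D0 by simp
    ultimately show False using large sumY by simp
  qed
  have "real (card {a \<in> C. Y a \<noteq> 0}) * (real (m + 1) * D) \<le> real (card C) * (real (m + 1) * D)"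
    using finC D0 by (intro mult_right_mono) (auto intro!: card_mono)
  then have "(\<Sum>a\<in>C. \<bar>Y a\<bar>) \<ge> real (card {a \<in> C. Y a \<noteq> 0}) * (real (m + 1) * D)"
    using large unfolding sumY by (rule order_trans[OF _ less_imp_le])
  from conformal_integral_relation[OF finC C D B relY exY this]
  obtain g where g: "relation m C g" "\<exists>a\<in>C. g a \<noteq> 0"
    "\<forall>a\<in>C. g a \<in> \<int> \<and> g a * Y a \<ge> 0 \<and> \<bar>g a\<bar> \<le> \<bar>Y a\<bar>" by blast
  have "\<forall>a\<in>C. \<exists>h. (\<forall>j\<in>K a. h j \<in> \<int> \<and> 0 \<le> h j * y j \<and> \<bar>h j\<bar> \<le> \<bar>y j\<bar>) \<and> sum h (K a) = g a"
  proof
    fix a assume a: "a \<in> C"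
    show "\<exists>h. (\<forall>j\<in>K a. h j \<in> \<int> \<and> 0 \<le> h j * y j \<and> \<bar>h j\<bar> \<le> \<bar>y j\<bar>) \<and> sum h (K a) = g a"
    proof (rule conformal_split[OF finK sign])
      show "y j \<in> \<int> \<or> y k \<in> \<int>" if "j \<in> K a" "k \<in> K a" "j \<noteq> k" for j k
        using one[of j k] that by (simp add: K_def)
    qed (use g(3) a in \<open>auto simp: Y_def\<close>)
  qed
  from bchoice[OF this] obtain H where H: "\<forall>a\<in>C. (\<forall>j\<in>K a. H a j \<in> \<int> \<and> 0 \<le> H a j * y j \<and> \<bar>H a j\<bar> \<le> \<bar>y j\<bar>) \<and> sum (H a) (K a) = g a" ..
  define h where "h j = H (col j) j" for j
  have h: "h j \<in> \<int>" "0 \<le> h j * y j" "\<bar>h j\<bar> \<le> \<bar>y j\<bar>" if j: "j < n" for j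
  proof -
    have "col j \<in> C" "j \<in> K (col j)" using j by (auto simp: C_def K_def)
    then show "h j \<in> \<int>" "0 \<le> h j * y j" "\<bar>h j\<bar> \<le> \<bar>y j\<bar>" using H unfolding h_def by blast+
  qed
  have sum_h: "sum h (K a) = g a" if "a \<in> C" for a
  proof -
    have "sum h (K a) = sum (H a) (K a)" by (rule sum.cong) (auto simp: h_def K_def)
    then show ?thesis using H that by simp
  qed
  have "(\<Sum>j<n. \<bar>y j\<bar>) \<le> (\<Sum>j<n. \<bar>y j - h j\<bar>)"
  proof (rule closest)
    show "\<forall>j<n. h j \<in> \<int> \<and> (h j \<noteq> 0 \<longrightarrow> h j * y j > 0 \<and> \<bar>h j\<bar> < \<bar>y j\<bar> + 1)"
    proof (intro allI impI conjI)
      fix j assume j: "j < n"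
      show "h j \<in> \<int>" by (rule h(1)[OF j])
      show "\<bar>h j\<bar> < \<bar>y j\<bar> + 1" using h(3)[OF j] by simp
      assume "h j \<noteq> 0"
      then have "h j * y j \<noteq> 0" using h(3)[OF j] by auto
      then show "h j * y j > 0" using h(2)[OF j] by (metis less_le)
    qed
    show "\<forall>i<m. (\<Sum>j<n. h j * col j i) = 0"
      using g(1) by (simp add: relation_group relation_def sum_h)
  qed
  also have "\<dots> = (\<Sum>j<n. \<bar>y j\<bar> - \<bar>h j\<bar>)"
  proof (rule sum.cong[OF refl])
    fix j assume "j \<in> {..<n}"
    then have j: "j < n" by simp
    show "\<bar>y j - h j\<bar> = \<bar>y j\<bar> - \<bar>h j\<bar>" using conformal_step[OF h(2)[OF j], of 1] h(3)[OF j] by simp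
  qed
  finally have "(\<Sum>j<n. \<bar>h j\<bar>) \<le> 0" by (simp add: sum_subtractf)
  then have "(\<Sum>j<n. \<bar>h j\<bar>) = 0" by (rule order_antisym) (rule sum_nonneg, simp)
  then have "\<forall>j\<in>{..<n}. \<bar>h j\<bar> = 0" by (subst (asm) sum_nonneg_eq_0_iff) auto
  then have "sum h (K a) = 0" for a by (intro sum.neutral) (auto simp: K_def)
  then show False using g(2) sum_h by force
qed

section \<open>Vertices and closest integer points\<close>

text \<open>An integral lower bound of \<open>x\<close> is a lower bound of its floor as well.\<close>

lemma extended_int_le:
  assumes "e \<in> extended_ints" "e \<le> ereal x" "of_int \<lfloor>x\<rfloor> \<le> v"
  shows "e \<le> ereal v"
proof (cases e)
  case (real r)
  then obtain k where k: "e = ereal (of_int k)" using assms(1) by (auto simp: extended_ints_def)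
  then have "k \<le> \<lfloor>x\<rfloor>" using assms(2) by (simp add: le_floor_iff)
  then have "real_of_int k \<le> of_int \<lfloor>x\<rfloor>" by (simp only: of_int_le_iff)
  then show ?thesis using k assms(3) by simp
qed (use assms in auto)

lemma extended_int_ge:
  assumes "e \<in> extended_ints" "ereal x \<le> e" "v \<le> of_int \<lceil>x\<rceil>"
  shows "ereal v \<le> e"
proof (cases e)
  case (real r)
  then obtain k where k: "e = ereal (of_int k)" using assms(1) by (auto simp: extended_ints_def)
  then have "\<lceil>x\<rceil> \<le> k" using assms(2) by (simp add: ceiling_le_iff)
  then have "of_int \<lceil>x\<rceil> \<le> real_of_int k" by (simp only: of_int_le_iff)
  then show ?thesis using k assms(3) by simp
qed (use assms in auto)

lemma LP_iff:
  assumes "A \<in> carrier_mat m n" "b \<in> carrier_vec m" "l \<in> carrier_vec n" "u \<in> carrier_vec n"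
  shows "x \<in> LP A b l u \<longleftrightarrow> x \<in> carrier_vec n \<and>
    (\<forall>i<m. (\<Sum>j<n. x $ j * column A j i) = of_int (b $ i)) \<and>
    (\<forall>j<n. l $ j \<le> ereal (x $ j) \<and> ereal (x $ j) \<le> u $ j)"
proof (cases "x \<in> carrier_vec n")
  case True
  have "(real_mat A *\<^sub>v x) $ i = (\<Sum>j<n. x $ j * column A j i)" if "i < m" for i
    using assms(1) True that
    by (auto simp: scalar_prod_def column_def lessThan_atLeast0 mult.commute intro!: sum.cong)
  then have "real_mat A *\<^sub>v x = real_vec b \<longleftrightarrow> (\<forall>i<m. (\<Sum>j<n. x $ j * column A j i) = of_int (b $ i))"
    using assms(1,2) by (auto simp: vec_eq_iff)
  then show ?thesis using assms True by (auto simp: LP_def less_eq_vec_def)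
qed (use assms in \<open>simp add: LP_def\<close>)

lemma IP_iff:
  assumes "A \<in> carrier_mat m n" "b \<in> carrier_vec m"
  shows "z \<in> IP A b l u \<longleftrightarrow> z \<in> carrier_vec n \<and> real_vec z \<in> LP A b l u"
proof (cases "z \<in> carrier_vec n")
  case True
  have "real_mat A *\<^sub>v real_vec z = real_vec (A *\<^sub>v z)"
    by (rule of_int_hom.mult_mat_vec_hom[OF assms(1) True, symmetric])
  moreover have "real_vec (A *\<^sub>v z) = real_vec b \<longleftrightarrow> A *\<^sub>v z = b"
    by (auto simp: vec_eq_iff)
  ultimately show ?thesis using assms True by (simp add: IP_def LP_def)
qed (use assms in \<open>simp add: IP_def\<close>)

text \<open>If both entries were fractional, a small amount could be shifted between them in either direction, and
\<open>x\<close> would be the midpoint of two feasible points.\<close>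

lemma vertex_equal_columns:
  assumes A: "A \<in> carrier_mat m n" "b \<in> carrier_vec m" "l \<in> carrier_vec n" "u \<in> carrier_vec n"
    and ext: "\<forall>i<n. l $ i \<in> extended_ints \<and> u $ i \<in> extended_ints"
    and x: "x \<in> vertices (LP A b l u)"
    and jk: "j < n" "k < n" "j \<noteq> k" "column A j = column A k"
  shows "x $ j \<in> \<int> \<or> x $ k \<in> \<int>"
proof (rule ccontr)
  assume "\<not> (x $ j \<in> \<int> \<or> x $ k \<in> \<int>)"
  then have frac: "0 < frac (x $ j)" "0 < frac (x $ k)"
    by (auto simp: frac_gt_0_iff)
  have xLP: "x \<in> LP A b l u" using x by (simp add: vertices_def)
  note xx = xLP[unfolded LP_iff[OF A]]
  define e where "e = min (min (frac (x $ j)) (1 - frac (x $ j))) (min (frac (x $ k)) (1 - frac (x $ k)))"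
  have e: "0 < e" "e \<le> frac (x $ j)" "e \<le> 1 - frac (x $ j)" "e \<le> frac (x $ k)" "e \<le> 1 - frac (x $ k)"
    using frac frac_lt_1[of "x $ j"] frac_lt_1[of "x $ k"] by (auto simp: e_def)
  define w where "w s = vec n (\<lambda>i. x $ i + s * ((if i = j then 1 else 0) - (if i = k then 1 else 0)))" for s :: real
  have inLP: "w s \<in> LP A b l u" if s: "\<bar>s\<bar> \<le> e" for s
    unfolding LP_iff[OF A]
  proof (intro conjI allI impI)
    show "w s \<in> carrier_vec n" by (simp add: w_def)
    show "(\<Sum>i<n. w s $ i * column A i r) = of_int (b $ r)" if r: "r < m" for r
    proof -
      have "(\<Sum>i<n. w s $ i * column A i r) = (\<Sum>i<n. x $ i * column A i r
         + (if i = j then s * column A j r else 0) - (if i = k then s * column A k r else 0))"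
        using jk(3) by (intro sum.cong) (auto simp: w_def algebra_simps)
      also have "\<dots> = (\<Sum>i<n. x $ i * column A i r)"
        using jk by (simp add: sum.distrib sum_subtractf)
      finally show ?thesis using xx r by simp
    qed
    fix i assume i: "i < n"
    have li: "l $ i \<in> extended_ints" "u $ i \<in> extended_ints" using ext i by auto
    have bounds: "l $ i \<le> ereal (x $ i)" "ereal (x $ i) \<le> u $ i" using xx i by auto
    show "l $ i \<le> ereal (w s $ i)"
    proof (cases "i = j \<or> i = k")
      case True
      then have "of_int \<lfloor>x $ i\<rfloor> \<le> w s $ i" using s e i jk(3) by (auto simp: w_def frac_def)
      then show ?thesis by (rule extended_int_le[OF li(1) bounds(1)])
    next
      case False
      then show ?thesis using bounds i by (simp add: w_def)
    qed
    show "ereal (w s $ i) \<le> u $ i"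
    proof (cases "i = j \<or> i = k")
      case True
      then have "w s $ i \<le> of_int \<lfloor>x $ i\<rfloor> + 1" using s e i jk(3) by (auto simp: w_def frac_def)
      moreover have "x $ i \<notin> \<int>" using True frac by (auto simp: frac_gt_0_iff)
      then have "\<lceil>x $ i\<rceil> = \<lfloor>x $ i\<rfloor> + 1" by (metis Ints_of_int ceiling_altdef)
      ultimately have "w s $ i \<le> of_int \<lceil>x $ i\<rceil>" by simp
      then show ?thesis by (rule extended_int_ge[OF li(2) bounds(2)])
    next
      case False
      then show ?thesis using bounds i by (simp add: w_def)
    qed
  qed
  have "w (- e) $ j \<noteq> w e $ j" using e(1) jk by (simp add: w_def)
  then have ne: "w (- e) \<noteq> w e" by metis
  have mid: "x = (1 - 1/2) \<cdot>\<^sub>v w (- e) + (1/2) \<cdot>\<^sub>v w e"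
    using xx by (intro eq_vecI) (auto simp: w_def algebra_simps)
  have "\<exists>a\<in>LP A b l u. \<exists>c\<in>LP A b l u. \<exists>t. a \<noteq> c \<and> 0 < t \<and> t < 1 \<and> x = (1 - t) \<cdot>\<^sub>v a + t \<cdot>\<^sub>v c"
    using inLP[of "- e"] inLP[of e] e(1) ne mid
    by (intro bexI[of _ "w (- e)"] bexI[of _ "w e"] exI[of _ "1/2"] conjI) auto
  then show False using x unfolding vertices_def by blast
qed

text \<open>Only finitely many integer points are at most as far away as a given one.\<close>

lemma closest_integer_point:
  assumes Z: "Z \<subseteq> carrier_vec n" "Z \<noteq> {}"
  obtains z where "z \<in> Z" "\<And>w. w \<in> Z \<Longrightarrow> (\<Sum>j<n. \<bar>real_of_int (z $ j) - x j\<bar>) \<le> (\<Sum>j<n. \<bar>of_int (w $ j) - x j\<bar>)"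
proof -
  define d where "d w = (\<Sum>j<n. \<bar>real_of_int (w $ j) - x j\<bar>)" for w
  obtain z0 where z0: "z0 \<in> Z" using Z(2) by blast
  define N where "N = {w \<in> Z. d w \<le> d z0}"
  have "N \<subseteq> vec n ` PiE {..<n} (\<lambda>j. {\<lfloor>x j - d z0\<rfloor>..\<lceil>x j + d z0\<rceil>})"
  proof
    fix w assume w: "w \<in> N"
    have "w $ j \<in> {\<lfloor>x j - d z0\<rfloor>..\<lceil>x j + d z0\<rceil>}" if j: "j < n" for j
    proof -
      have "\<bar>of_int (w $ j) - x j\<bar> \<le> d w" unfolding d_def by (rule member_le_sum) (use j in auto)
      then have "\<bar>of_int (w $ j) - x j\<bar> \<le> d z0" using w by (simp add: N_def)
      then have "x j - d z0 \<le> of_int (w $ j)" "of_int (w $ j) \<le> x j + d z0" by linarith+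
      then show ?thesis by (simp add: floor_le_iff le_ceiling_iff)
    qed
    moreover have "w = vec n (restrict (\<lambda>j. w $ j) {..<n})" using w Z by (intro eq_vecI) (auto simp: N_def)
    ultimately show "w \<in> vec n ` PiE {..<n} (\<lambda>j. {\<lfloor>x j - d z0\<rfloor>..\<lceil>x j + d z0\<rceil>})"
      by (intro image_eqI[of _ _ "restrict (\<lambda>j. w $ j) {..<n}"]) auto
  qed
  then have "finite N" by (rule finite_subset) (intro finite_imageI finite_PiE, auto)
  moreover have "N \<noteq> {}" using z0 by (auto simp: N_def)
  ultimately obtain z where z: "z \<in> N" "\<forall>w\<in>N. d z \<le> d w"
    using ex_min_if_finite[of "d ` N"] by (metis (no_types, lifting) arg_min_if_finite(1) arg_min_least)
  show ?thesis
  proof (rule that[of z])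
    show "z \<in> Z" using z by (simp add: N_def)
    show "(\<Sum>j<n. \<bar>real_of_int (z $ j) - x j\<bar>) \<le> (\<Sum>j<n. \<bar>of_int (w $ j) - x j\<bar>)" if "w \<in> Z" for w
    proof (cases "w \<in> N")
      case True
      then show ?thesis using z by (simp add: d_def)
    next
      case False
      then have "d w > d z0" using that by (simp add: N_def)
      moreover have "d z \<le> d z0" using z by (simp add: N_def)
      ultimately show ?thesis by (simp add: d_def)
    qed
  qed
qed

lemma vertex_proximity:
  assumes A: "A \<in> carrier_mat m n" "b \<in> carrier_vec m" "l \<in> carrier_vec n" "u \<in> carrier_vec n"
    and rank: "full_row_rank A"
    and ext: "\<forall>i<n. l $ i \<in> extended_ints \<and> u $ i \<in> extended_ints"
    and feasible: "IP A b l u \<noteq> {}"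
    and x: "x \<in> vertices (LP A b l u)"
  shows "\<exists>z\<in>IP A b l u. l1_norm (x - real_vec z) \<le> real (card (columns A)) * (real (m + 1) * of_int (max_subdet A))"
proof -
  have IP_sub: "IP A b l u \<subseteq> carrier_vec n" using IP_iff[OF A(1,2)] by blast
  obtain z where z: "z \<in> IP A b l u" and closest:
      "\<And>w. w \<in> IP A b l u \<Longrightarrow> (\<Sum>j<n. \<bar>real_of_int (z $ j) - x $ j\<bar>) \<le> (\<Sum>j<n. \<bar>of_int (w $ j) - x $ j\<bar>)"
    using closest_integer_point[OF IP_sub feasible, of "\<lambda>j. x $ j"] by blast
  have dimz: "z \<in> carrier_vec n" using z IP_sub by blast
  have "x \<in> LP A b l u" using x by (simp add: vertices_def)
  note xx = this[unfolded LP_iff[OF A]]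
  have "real_vec z \<in> LP A b l u" using z IP_iff[OF A(1,2)] by blast
  note zz = this[unfolded LP_iff[OF A]]
  define y where "y j = of_int (z $ j) - x $ j" for j
  have zy: "real_vec z $ j = x $ j + y j" if "j < n" for j using dimz that by (simp add: y_def)
  have cols: "columns A = column A ` {..<n}" using A(1) by (simp add: columns_def)
  obtain B where B: "\<And>j. j < m \<Longrightarrow> B j \<in> columns A" "\<bar>Det m B\<bar> = of_int (max_subdet A)"
    using max_subdet_attained[OF A(1) rank] by blast
  have Bnz: "Det m B \<noteq> 0" using B(2) max_subdet_pos[OF A(1) rank] by auto
  have "(\<Sum>j<n. \<bar>y j\<bar>) \<le> real (card (column A ` {..<n})) * (real (m + 1) * of_int (max_subdet A))"
  proof (rule proximity_core[where col = "column A" and m = m and B = B])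
    show "column A ` {..<n} \<subseteq> int_vecs m" using columns_int_vecs[OF A(1)] cols by simp
    show "\<bar>Det m f\<bar> \<le> of_int (max_subdet A)" if "\<And>j. j < m \<Longrightarrow> f j \<in> column A ` {..<n}" for f
      by (rule max_subdet_ge[OF A(1) rank]) (use that cols in simp)
    show "B j \<in> column A ` {..<n}" if "j < m" for j using B(1)[OF that] cols by simp
    show "Det m B \<noteq> 0" by (rule Bnz)
    show "(\<Sum>j<n. y j * column A j i) = 0" if i: "i < m" for i
    proof -
      have "(\<Sum>j<n. real_vec z $ j * column A j i) = (\<Sum>j<n. x $ j * column A j i)" using xx zz i by simp
      moreover have "(\<Sum>j<n. real_vec z $ j * column A j i) = (\<Sum>j<n. (x $ j + y j) * column A j i)"
        by (intro sum.cong) (simp_all add: zy del: index_map_vec)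
      ultimately show ?thesis by (simp add: distrib_right sum.distrib)
    qed
    show "y j \<in> \<int> \<or> y k \<in> \<int>" if "j < n" "k < n" "j \<noteq> k" "column A j = column A k" for j k
      using vertex_equal_columns[OF A ext x that] by (auto simp: y_def)
    fix h assume h: "\<forall>j<n. h j \<in> \<int> \<and> (h j \<noteq> 0 \<longrightarrow> h j * y j > 0 \<and> \<bar>h j\<bar> < \<bar>y j\<bar> + 1)"
      and hrel: "\<forall>i<m. (\<Sum>j<n. h j * column A j i) = 0"
    define w where "w = vec n (\<lambda>j. z $ j - \<lfloor>h j\<rfloor>)"
    have wj: "real_of_int (w $ j) = x $ j + y j - h j" if j: "j < n" for j
    proof -
      have "h j \<in> \<int>" using h j by blast
      then have "real_of_int \<lfloor>h j\<rfloor> = h j" by (auto elim!: Ints_cases)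
      then show ?thesis using j by (simp add: w_def y_def)
    qed
    have "w \<in> IP A b l u"
      unfolding IP_iff[OF A(1,2)] LP_iff[OF A]
    proof (intro conjI allI impI)
      show wn: "w \<in> carrier_vec n" "real_vec w \<in> carrier_vec n" by (simp_all add: w_def)
      have rw: "real_vec w $ j = real_of_int (w $ j)" if "j < n" for j using that wn by simp
      show "(\<Sum>j<n. real_vec w $ j * column A j i) = of_int (b $ i)" if i: "i < m" for i
      proof -
        have "(\<Sum>j<n. real_vec w $ j * column A j i) = (\<Sum>j<n. (real_vec z $ j - h j) * column A j i)"
          by (intro sum.cong) (simp_all add: rw wj zy del: index_map_vec)
        also have "\<dots> = (\<Sum>j<n. real_vec z $ j * column A j i) - (\<Sum>j<n. h j * column A j i)"
          by (simp only: left_diff_distrib sum_subtractf)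
        also have "\<dots> = of_int (b $ i)" using zz hrel i by simp
        finally show ?thesis .
      qed
      fix j assume j: "j < n"
      have lj: "l $ j \<in> extended_ints" "u $ j \<in> extended_ints" using ext j by auto
      have bx: "l $ j \<le> ereal (x $ j)" "ereal (x $ j) \<le> u $ j" using xx j by auto
      have bz: "l $ j \<le> ereal (of_int (z $ j))" "ereal (of_int (z $ j)) \<le> u $ j" using zz j dimz by auto
      have hj: "h j \<noteq> 0 \<longrightarrow> h j * y j > 0 \<and> \<bar>h j\<bar> < \<bar>y j\<bar> + 1" using h j by blast
      show "l $ j \<le> ereal (real_vec w $ j)"
      proof (cases "h j > 0")
        case True
        then have "x $ j - 1 < of_int (w $ j)" using hj wj[OF j] by (auto simp: zero_less_mult_iff)
        then have "\<lfloor>x $ j\<rfloor> \<le> w $ j" by linarith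
        then have "real_of_int \<lfloor>x $ j\<rfloor> \<le> real_vec w $ j" unfolding rw[OF j] by (simp only: of_int_le_iff)
        then show ?thesis by (rule extended_int_le[OF lj(1) bx(1)])
      next
        case False
        then have "real_of_int (z $ j) \<le> real_vec w $ j" using wj[OF j] rw[OF j] by (simp add: y_def)
        then show ?thesis using bz(1) by (meson ereal_less_eq(3) order_trans)
      qed
      show "ereal (real_vec w $ j) \<le> u $ j"
      proof (cases "h j < 0")
        case True
        then have "of_int (w $ j) < x $ j + 1" using hj wj[OF j] by (auto simp: zero_less_mult_iff)
        then have "w $ j \<le> \<lceil>x $ j\<rceil>" by linarith
        then have "real_vec w $ j \<le> real_of_int \<lceil>x $ j\<rceil>" unfolding rw[OF j] by (simp only: of_int_le_iff)
        then show ?thesis by (rule extended_int_ge[OF lj(2) bx(2)])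
      next
        case False
        then have "real_vec w $ j \<le> real_of_int (z $ j)" using wj[OF j] rw[OF j] by (simp add: y_def)
        then show ?thesis using bz(2) by (meson ereal_less_eq(3) order_trans)
      qed
    qed
    from closest[OF this] have "(\<Sum>j<n. \<bar>y j\<bar>) \<le> (\<Sum>j<n. \<bar>of_int (w $ j) - x $ j\<bar>)"
      by (simp add: y_def)
    also have "\<dots> = (\<Sum>j<n. \<bar>y j - h j\<bar>)" by (intro sum.cong) (simp_all add: wj)
    finally show "(\<Sum>j<n. \<bar>y j\<bar>) \<le> (\<Sum>j<n. \<bar>y j - h j\<bar>)" .
  qed
  moreover have "l1_norm (x - real_vec z) = (\<Sum>j<n. \<bar>y j\<bar>)"
    using dimz unfolding l1_norm_def by (intro sum.cong) (auto simp: y_def abs_minus_commute)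
  ultimately show ?thesis unfolding cols by (intro bexI[OF _ z]) simp
qed

theorem theorem3:
  fixes m n :: nat and A :: "int mat" and b :: "int vec" and l u :: "ereal vec"
  assumes "m \<ge> 1"
    and "A \<in> carrier_mat m n"
    and "full_row_rank A"
    and "b \<in> carrier_vec m"
    and "l \<in> carrier_vec n" and "u \<in> carrier_vec n"
    and "\<forall>i<n. l $ i \<in> extended_ints \<and> u $ i \<in> extended_ints"
    and "\<forall>i<n. l $ i < u $ i"
    and "IP A b l u \<noteq> {}"
  shows "let \<Delta> = max_subdet A; c = int (col_number \<Delta> m) in
    proximity A b l u \<le> ereal (real_of_int ((int m + 1) * \<Delta> * (2 * c + 1))) \<and>
    (int m + 1) * \<Delta> * (2 * c + 1) \<le> int m * (int m + 1)^2 * \<Delta>^3 + (int m + 1) * \<Delta>"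
proof -
  define D where "D = max_subdet A"
  define c where "c = int (col_number D m)"
  have D: "D \<ge> 1" unfolding D_def by (rule max_subdet_pos[OF assms(2,3)])
  have "card (columns A) \<le> 2 * num_differing A + 1" by (rule distinct_columns_bound[OF assms(2)])
  moreover have "num_differing A \<le> col_number D m"
    by (rule num_differing_le_col_number[OF assms(1-3)]) (simp add: D_def)
  ultimately have "int (card (columns A)) \<le> 2 * c + 1" unfolding c_def by linarith
  then have card: "real (card (columns A)) \<le> of_int (2 * c + 1)"
    by (metis of_int_le_iff of_int_of_nat_eq)
  have "real (card (columns A)) * (real (m + 1) * of_int D) \<le> of_int (2 * c + 1) * (real (m + 1) * of_int D)"
    using D by (intro mult_right_mono[OF card]) simp
  also have "\<dots> = of_int ((int m + 1) * D * (2 * c + 1))" by (simp add: algebra_simps)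
  finally have bound: "real (card (columns A)) * (real (m + 1) * of_int D) \<le> of_int ((int m + 1) * D * (2 * c + 1))" .
  have "proximity A b l u \<le> ereal (of_int ((int m + 1) * D * (2 * c + 1)))"
    unfolding proximity_def
  proof (rule SUP_least)
    fix x assume "x \<in> vertices (LP A b l u)"
    from vertex_proximity[OF assms(2,4,5,6,3,7,9) this] obtain z where z: "z \<in> IP A b l u"
      "l1_norm (x - real_vec z) \<le> real (card (columns A)) * (real (m + 1) * of_int D)" unfolding D_def by blast
    show "(INF z\<in>IP A b l u. ereal (l1_norm (x - real_vec z))) \<le> ereal (of_int ((int m + 1) * D * (2 * c + 1)))"
      by (rule INF_lower2[OF z(1)]) (use z(2) bound in simp)
  qed
  moreover have "(int m + 1) * D * (2 * c + 1) \<le> int m * (int m + 1)^2 * D^3 + (int m + 1) * D"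
  proof -
    have "2 * col_number D m \<le> (nat D)\<^sup>2 * (m * (m + 1))"
      by (rule col_number_bound[OF assms(1-3)]) (simp add: D_def)
    then have "int (2 * col_number D m) \<le> int ((nat D)\<^sup>2 * (m * (m + 1)))" by (simp only: of_nat_le_iff)
    then have "2 * c \<le> D\<^sup>2 * (int m * (int m + 1))" using D by (simp add: c_def algebra_simps)
    then have "(int m + 1) * D * (2 * c) \<le> (int m + 1) * D * (D\<^sup>2 * (int m * (int m + 1)))"
      using D by (intro mult_left_mono) auto
    then show ?thesis by (simp add: algebra_simps power2_eq_square power3_eq_cube)
  qed
  ultimately show ?thesis by (simp add: Let_def c_def D_def)
qed

end
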